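(* Let $U\subset\mathbb{R}^n$ be open. Given a holomorphic regularisation procedure $\mathcal{R}:\omega\mapsto\omega(z)$ on $\Omega\,CS_{\rm com}(U)$ induced by a holomorphic regularisation procedure $\mathcal{R}:\sigma\mapsto\sigma(z)$ on $CS_{\rm com}(U)$, and any symbol valued form $\omega\in\Omega\,CS_{\rm com}(U)$, the map $z\mapsto-\!\!\!\!\int_{T_x^*U}\omega(z)$ (resp. $z\mapsto-\!\!\!\!\int_{T^*U}\omega(z)$) is meromorphic with simple poles at points in $\alpha^{-1}([-n,+\infty[\,\cap\,\mathbb{Z})$, where $\alpha$ is the order of $\omega(z)$. Moreover, for any $x\in U$, $$\mathrm{Res}_{z=0}-\!\!\!\!\!\int_{T_x^*U}\omega(z)(x,\xi)=-\frac{1}{\alpha'(0)}\,\mathrm{res}_x(\omega(0)),$$ respectively $$\mathrm{Res}_{z=0}-\!\!\!\!\!\int_{T^*U}\omega(z)(x,\xi)=-\frac{1}{\alpha'(0)}\,\mathrm{res}(\omega(0)).$$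
   Context: $U\subset\mathbb{R}^n$ is open, $T^*U=U\times\mathbb{R}^n$ with coordinates $(x,\xi)$, $|\xi|$ the Euclidean norm. $S^m(U)$ denotes symbols of order $m$. Fix a smooth function $\chi$ on $T^*U$ with $\chi=0$ for $|\xi|\le 1/2$ and $\chi=1$ for $|\xi|\ge 1$. A symbol $\sigma$ is classical of order $m\in\mathbb{C}$ if for every positive integer $N$, $\sigma=\sum_{i=0}^N\chi\,\sigma_{m-i}+\sigma_{(N)}$ with $\sigma_{m-i}$ positively homogeneous of degree $m-i$ in $\xi\ne0$ and $\sigma_{(N)}$ a symbol of order $m-N-1$ (i.e. $\mathrm{Re}(m)-N-1$). $CS^m_{\rm com}(U)$: classical symbols of order $m$ with compact support in $x\in U$; $CS_{\rm com}(U)$: algebra generated by them over all $m\in\mathbb{C}$. A symbol valued form of order $m$ is $\sum_{I,J}\alpha_{I,J}\,dx_I\wedge d\xi_J$ with $\alpha_{I,J}\in CS_{\rm com}^{m-|J|}(U)$; $\Omega\,CS_{\rm com}(U)$ is generated by these over all orders and degrees. Holomorphic regularisation on $CS_{\rm com}(U)$: a map $\sigma\mapsto\sigma(z)$ to holomorphic families (in a complex parameter $z$) with values in $CS_{\rm com}(U)$, with $\sigma(0)=\sigma$ and $\sigma(z)$ of holomorphic order $\alpha(z)$ (so $\alpha(0)$ is the order of $\sigma$) such that $\alpha'(0)\ne0$. Holomorphic means: each homogeneous component $\sigma_{\alpha(z)-j}(z)$ is holomorphic in $z$, and for any integer $N\ge1$ the remainder $\sigma_{(N)}(z)=\sigma(z)-\sum_{j=0}^{N-1}\chi\,\sigma_{\alpha(z)-j}(z)$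 is holomorphic in $z$ as an element of $C^\infty(U\times\mathbb{R}^n)$, with $k$-th $z$-derivative in $S^{\mathrm{Re}\,\alpha(z)-N+\epsilon}(U)$ for any $\epsilon>0$. The induced holomorphic regularisation on forms acts on coefficients: $\omega(z)=\sum_{I,J}\omega_{I,J}(z)\,dx_I\wedge d\xi_J$, with $\omega(0)=\omega$ and $\omega(z)$ of holomorphic order $\alpha(z)$ such that $\alpha'(0)\ne0$; thus $\omega_{I,J}(z)$ has order $\alpha(z)-|J|$. Cut-off integral: for a classical symbol $\sigma$, $-\!\!\!\!\int_{T_x^*U}\sigma(x,\xi)\,d\xi$ is the constant term in the asymptotic expansion of $\int_{|\xi|\le R}\sigma(x,\xi)\,d\xi$ as $R\to\infty$ (in powers of $R$ with nonzero exponents, $\log R$ and a constant). For a form $\alpha=\sum\alpha_{I,J}\,dx_I\wedge d\xi_J$: $-\!\!\!\!\int_{T_x^*U}\alpha=\sum_{I,\,|J|=n}\big(-\!\!\!\!\int_{T_x^*U}\alpha_{I,J}\,d\xi\big)dx_I$ (meromorphy and residues being understood coefficientwise), and $-\!\!\!\!\int_{T^*U}\alpha=\int_U dx\,-\!\!\!\!\int_{T_x^*U}\alpha_{I,J}\,d\xi$ with $|I|=|J|=n$, other terms contributing $0$. Residues: $\mathrm{res}_x(\sigma)=\int_{|\xi|=1}\sigma_{-n}(x,\xi)\,d_S\xi$ where $\sigma_{-n}$ is the homogeneous component of degree $-n$ and $d_S\xi=\sum_i(-1)^{i+1}\xi_i\,d\xi_1\wedge\cdots\wedge\widehat{d\xi_i}\wedge\cdots\wedge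 d\xi_n$; $\mathrm{res}_x(\alpha)=\sum_{I,\,|J|=n}\mathrm{res}_x(\alpha_{I,J})\,dx_I$; $\mathrm{res}(\alpha)=\int_U\mathrm{res}_x(\alpha_{I,J})\,dx$ with $|I|=|J|=n$, other terms contributing $0$.
   Formalization: Poles are shown simple where α' is nonzero; at critical points of α the pole order is at most the multiplicity of α, since simplicity can fail there. Symbol estimates on remainders and their z-derivatives are required locally uniformly in z; with pointwise estimates the claim fails. *)

theory Defs
  imports "HOL-Complex_Analysis.Complex_Analysis"
begin

text \<open>
  \<open>real ^ 'n\<close> is \<open>\<real>\<^sup>n\<close> with \<open>n = CARD('n)\<close>. Points of \<open>T\<^sup>*U = U \<times> \<real>\<^sup>n\<close> are pairs \<open>(x, \<xi>)\<close>.
  The symbol-valued form \<open>\<Sum>\<^bsub>I,J\<^esub> \<omega>\<^bsub>I,J\<^esub> dx\<^sub>I \<and> d\<xi>\<^sub>J\<close> is the family \<open>\<omega> I J\<close> of its coefficients, where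
  \<open>I\<close> and \<open>J\<close> run over all subsets of the index type.
\<close>

type_synonym 'n symb = "(real ^ 'n) \<times> (real ^ 'n) \<Rightarrow> complex"
type_synonym 'n symb_form = "'n set \<Rightarrow> 'n set \<Rightarrow> 'n symb"


subsection \<open>Smooth functions\<close>

fun iter_deriv :: "'a::real_normed_vector list \<Rightarrow> ('a \<Rightarrow> 'b::real_normed_vector) \<Rightarrow> 'a \<Rightarrow> 'b" where
  "iter_deriv [] f = f"
| "iter_deriv (v # vs) f = (\<lambda>p. frechet_derivative (iter_deriv vs f) (at p) v)"

text \<open>To be used on open sets only.\<close>

definition smooth_on :: "'a::euclidean_space set \<Rightarrow> ('a \<Rightarrow> 'b::real_normed_vector) \<Rightarrow> bool" where
  "smooth_on S f \<longleftrightarrow> (\<forall>vs \<in> lists Basis. \<forall>p\<in>S. iter_deriv vs f differentiable (at p))"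

text \<open>
  Complex differentiability of a map with values in the Frechet space \<open>C\<^sup>\<infinity>(S)\<close>: the difference
  quotients converge, with all their derivatives, uniformly on compact subsets of \<open>S\<close>.
\<close>

definition holomorphic_smooth :: "'a::euclidean_space set \<Rightarrow> (complex \<Rightarrow> 'a \<Rightarrow> complex) \<Rightarrow> bool" where
  "holomorphic_smooth S f \<longleftrightarrow>
     (\<forall>z. smooth_on S (f z)) \<and>
     (\<forall>z. \<exists>g. smooth_on S g \<and>
        (\<forall>K vs. compact K \<and> K \<subseteq> S \<and> vs \<in> lists Basis \<longrightarrow>
           uniform_limit K (\<lambda>h. iter_deriv vs (\<lambda>p. (f (z + h) p - f z p) / h)) (iter_deriv vs g) (at 0)))"


subsection \<open>Symbols\<close>

text \<open>\<open>\<partial>\<^sub>x\<^sup>A \<partial>\<^sub>\<xi>\<^sup>B\<close>, with multi-indices given as lists of coordinate indices.\<close>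

definition symb_deriv :: "'n::finite list \<Rightarrow> 'n list \<Rightarrow> 'n symb \<Rightarrow> 'n symb" where
  "symb_deriv A B = iter_deriv (map (\<lambda>i. (axis i 1, 0)) A @ map (\<lambda>i. (0, axis i 1)) B)"

text \<open>
  Families \<open>f z \<in> S\<^bsup>m z\<^esup>(U)\<close> whose symbol estimates hold uniformly for \<open>z\<close> in compact sets.
\<close>

definition locally_uniform_symbols ::
  "(real ^ 'n::finite) set \<Rightarrow> (complex \<Rightarrow> real) \<Rightarrow> (complex \<Rightarrow> 'n symb) \<Rightarrow> bool" where
  "locally_uniform_symbols U m f \<longleftrightarrow>
     (\<forall>z. smooth_on (U \<times> UNIV) (f z)) \<and>
     (\<forall>Z K A B. compact Z \<and> compact K \<and> K \<subseteq> U \<longrightarrow>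
        (\<exists>C. \<forall>z\<in>Z. \<forall>x\<in>K. \<forall>\<xi>.
           norm (symb_deriv A B (f z) (x, \<xi>)) \<le> C * (1 + norm \<xi>) powr (m z - real (length B))))"

definition symbols :: "(real ^ 'n::finite) set \<Rightarrow> real \<Rightarrow> 'n symb set" where
  "symbols U m = {\<sigma>. smooth_on (U \<times> UNIV) \<sigma> \<and>
     (\<forall>K A B. compact K \<and> K \<subseteq> U \<longrightarrow>
        (\<exists>C. \<forall>x\<in>K. \<forall>\<xi>.
           norm (symb_deriv A B \<sigma> (x, \<xi>)) \<le> C * (1 + norm \<xi>) powr (m - real (length B))))}"

definition cutoff_function :: "(real ^ 'n::finite) set \<Rightarrow> 'n symb \<Rightarrow> bool" where
  "cutoff_function U \<psi> \<longleftrightarrow> smooth_on (U \<times> UNIV) \<psi> \<and>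
     (\<forall>x\<in>U. \<forall>\<xi>. (norm \<xi> \<le> 1/2 \<longrightarrow> \<psi> (x, \<xi>) = 0) \<and> (norm \<xi> \<ge> 1 \<longrightarrow> \<psi> (x, \<xi>) = 1))"

text \<open>The values \<open>h (x, 0)\<close> are irrelevant.\<close>

definition pos_homogeneous :: "(real ^ 'n::finite) set \<Rightarrow> complex \<Rightarrow> 'n symb \<Rightarrow> bool" where
  "pos_homogeneous U d h \<longleftrightarrow> smooth_on (U \<times> (- {0})) h \<and>
     (\<forall>x\<in>U. \<forall>\<xi>. \<forall>t>0. \<xi> \<noteq> 0 \<longrightarrow> h (x, t *\<^sub>R \<xi>) = of_real t powr d * h (x, \<xi>))"

text \<open>\<open>s j\<close> is the homogeneous component of degree \<open>m - j\<close> of \<open>\<sigma>\<close>.\<close>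

definition classical_expansion ::
  "'n::finite symb \<Rightarrow> (real ^ 'n) set \<Rightarrow> complex \<Rightarrow> 'n symb \<Rightarrow> (nat \<Rightarrow> 'n symb) \<Rightarrow> bool" where
  "classical_expansion \<psi> U m \<sigma> s \<longleftrightarrow>
     (\<forall>j. pos_homogeneous U (m - of_nat j) (s j)) \<and>
     (\<forall>N\<ge>1. (\<lambda>p. \<sigma> p - (\<Sum>j=0..N. \<psi> p * s j p)) \<in> symbols U (Re m - real N - 1))"

text \<open>
  Symbols with compact support in \<open>x \<in> U\<close> are extended by \<open>0\<close> to all \<open>x\<close>.
\<close>

definition CS_com_order :: "'n::finite symb \<Rightarrow> (real ^ 'n) set \<Rightarrow> complex \<Rightarrow> 'n symb set" where
  "CS_com_order \<psi> U m = {\<sigma>. (\<exists>s. classical_expansion \<psi> U m \<sigma> s) \<and>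
     (\<exists>K. compact K \<and> K \<subseteq> U \<and> (\<forall>x \<xi>. x \<notin> K \<longrightarrow> \<sigma> (x, \<xi>) = 0))}"

inductive_set CS_com :: "'n::finite symb \<Rightarrow> (real ^ 'n) set \<Rightarrow> 'n symb set"
  for \<psi> :: "'n::finite symb" and U :: "(real ^ 'n) set" where
  "\<sigma> \<in> CS_com_order \<psi> U m \<Longrightarrow> \<sigma> \<in> CS_com \<psi> U"
| "\<sigma> \<in> CS_com \<psi> U \<Longrightarrow> (\<lambda>p. c * \<sigma> p) \<in> CS_com \<psi> U"
| "\<sigma> \<in> CS_com \<psi> U \<Longrightarrow> \<tau> \<in> CS_com \<psi> U \<Longrightarrow> (\<lambda>p. \<sigma> p + \<tau> p) \<in> CS_com \<psi> U"
| "\<sigma> \<in> CS_com \<psi> U \<Longrightarrow> \<tau> \<in> CS_com \<psi> U \<Longrightarrow> (\<lambda>p. \<sigma> p * \<tau> p) \<in> CS_com \<psi> U"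

definition form_CS_com_order :: "'n::finite symb \<Rightarrow> (real ^ 'n) set \<Rightarrow> complex \<Rightarrow> 'n symb_form set" where
  "form_CS_com_order \<psi> U m = {\<omega>. \<forall>I J. \<omega> I J \<in> CS_com_order \<psi> U (m - of_nat (card J))}"

text \<open>
  Closure under exterior products and multiplication by symbols would add nothing: a product of
  classical symbols of orders \<open>a\<close> and \<open>b\<close> is a classical symbol of order \<open>a + b\<close>.
\<close>

inductive_set form_CS_com :: "'n::finite symb \<Rightarrow> (real ^ 'n) set \<Rightarrow> 'n symb_form set"
  for \<psi> :: "'n::finite symb" and U :: "(real ^ 'n) set" where
  "\<omega> \<in> form_CS_com_order \<psi> U m \<Longrightarrow> \<omega> \<in> form_CS_com \<psi> U"
| "\<omega> \<in> form_CS_com \<psi> U \<Longrightarrow> \<eta> \<in> form_CS_com \<psi> U \<Longrightarrow> (\<lambda>I J p. \<omega> I J p + \<eta> I J p) \<in> form_CS_com \<psi> U"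


subsection \<open>Holomorphic families and regularisations\<close>

text \<open>
  The \<open>k\<close>-th \<open>z\<close>-derivative of the remainder lies in \<open>S\<^bsup>Re \<alpha>(z) - N + \<epsilon>\<^esup>(U)\<close> locally uniformly in \<open>z\<close>,
  as is customary for holomorphic families. Without local uniformity in \<open>z\<close> the
  integral over \<open>\<xi>\<close> of a remainder need not even depend continuously on \<open>z\<close>.
\<close>

definition holomorphic_family ::
  "'n::finite symb \<Rightarrow> (real ^ 'n) set \<Rightarrow> (complex \<Rightarrow> complex) \<Rightarrow> (complex \<Rightarrow> 'n symb) \<Rightarrow> bool" where
  "holomorphic_family \<psi> U \<alpha> f \<longleftrightarrow>
     \<alpha> holomorphic_on UNIV \<and>
     (\<forall>z. f z \<in> CS_com_order \<psi> U (\<alpha> z)) \<and>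
     (\<exists>s. (\<forall>z. classical_expansion \<psi> U (\<alpha> z) (f z) (s z)) \<and>
        (\<forall>j. holomorphic_smooth (U \<times> (- {0})) (\<lambda>z. s z j)) \<and>
        (\<forall>N\<ge>1. let rem = (\<lambda>z p. f z p - (\<Sum>j<N. \<psi> p * s z j p)) in
           holomorphic_smooth (U \<times> UNIV) rem \<and>
           (\<forall>k. \<forall>\<epsilon>>0. locally_uniform_symbols U (\<lambda>z. Re (\<alpha> z) - real N + \<epsilon>)
              (\<lambda>z p. (deriv ^^ k) (\<lambda>w. rem w p) z))))"

text \<open>
  Sums of symbols whose orders do not differ by integers have no order; on those only the
  conditions that do not refer to an order are imposed. If \<open>\<sigma>\<close> has an order, then \<open>\<alpha> 0\<close> is an
  order of \<open>\<sigma>\<close> since \<open>R \<sigma> 0 = \<sigma>\<close>.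
\<close>

definition holomorphic_regularisation ::
  "'n::finite symb \<Rightarrow> (real ^ 'n) set \<Rightarrow> ('n symb \<Rightarrow> complex \<Rightarrow> 'n symb) \<Rightarrow> bool" where
  "holomorphic_regularisation \<psi> U R \<longleftrightarrow>
     (\<forall>\<sigma> \<in> CS_com \<psi> U. R \<sigma> 0 = \<sigma> \<and> (\<forall>z. R \<sigma> z \<in> CS_com \<psi> U)) \<and>
     (\<forall>m. \<forall>\<sigma> \<in> CS_com_order \<psi> U m. \<exists>\<alpha>. holomorphic_family \<psi> U \<alpha> (R \<sigma>) \<and> deriv \<alpha> 0 \<noteq> 0)"

definition holomorphic_form_family ::
  "'n::finite symb \<Rightarrow> (real ^ 'n) set \<Rightarrow> (complex \<Rightarrow> complex) \<Rightarrow> (complex \<Rightarrow> 'n symb_form) \<Rightarrow> bool" where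
  "holomorphic_form_family \<psi> U \<alpha> F \<longleftrightarrow>
     (\<forall>I J. holomorphic_family \<psi> U (\<lambda>z. \<alpha> z - of_nat (card J)) (\<lambda>z. F z I J))"

definition holomorphic_form_regularisation ::
  "'n::finite symb \<Rightarrow> (real ^ 'n) set \<Rightarrow> ('n symb_form \<Rightarrow> complex \<Rightarrow> 'n symb_form) \<Rightarrow> bool" where
  "holomorphic_form_regularisation \<psi> U \<R> \<longleftrightarrow>
     (\<forall>\<omega> \<in> form_CS_com \<psi> U. \<R> \<omega> 0 = \<omega> \<and> (\<forall>z. \<R> \<omega> z \<in> form_CS_com \<psi> U)) \<and>
     (\<forall>m. \<forall>\<omega> \<in> form_CS_com_order \<psi> U m.
        \<exists>\<alpha>. holomorphic_form_family \<psi> U \<alpha> (\<R> \<omega>) \<and> deriv \<alpha> 0 \<noteq> 0)"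

definition induced_regularisation ::
  "('n::finite symb \<Rightarrow> complex \<Rightarrow> 'n symb) \<Rightarrow> 'n symb_form \<Rightarrow> complex \<Rightarrow> 'n symb_form" where
  "induced_regularisation R \<omega> z = (\<lambda>I J. R (\<omega> I J) z)"


subsection \<open>Cut-off integrals\<close>

text \<open>
  The constant term only depends on the asymptotic expansion up to \<open>o(1)\<close>, which has finitely many
  terms; the expansion may contain oscillating terms \<open>R\<^bsup>it\<^esup>\<close>, \<open>t \<noteq> 0\<close>.
\<close>

definition has_constant_term :: "(real \<Rightarrow> complex) \<Rightarrow> complex \<Rightarrow> bool" where
  "has_constant_term F c \<longleftrightarrow>
     (\<exists>A a b. finite A \<and> 0 \<notin> A \<and>
        ((\<lambda>R. F R - ((\<Sum>e\<in>A. a e * of_real R powr e) + b * of_real (ln R) + c)) \<longlongrightarrow> 0) at_top)"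

definition cutoff_integral :: "(real ^ 'n::finite \<Rightarrow> complex) \<Rightarrow> complex" where
  "cutoff_integral f = (THE c. has_constant_term (\<lambda>R. LINT \<xi>:cball 0 R|lborel. f \<xi>) c)"

text \<open>
  The only \<open>J\<close> with \<open>|J| = n\<close> is \<open>UNIV\<close>. The result is the family of coefficients of the \<open>dx\<^sub>I\<close>.
\<close>

definition fibre_cutoff_integral :: "'n::finite symb_form \<Rightarrow> real ^ 'n \<Rightarrow> 'n set \<Rightarrow> complex" where
  "fibre_cutoff_integral \<omega> x I = cutoff_integral (\<lambda>\<xi>. \<omega> I UNIV (x, \<xi>))"

definition total_cutoff_integral :: "(real ^ 'n::finite) set \<Rightarrow> 'n symb_form \<Rightarrow> complex" where
  "total_cutoff_integral U \<omega> = (LINT x:U|lborel. fibre_cutoff_integral \<omega> x UNIV)"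


subsection \<open>Residues\<close>

definition hom_component ::
  "'n::finite symb \<Rightarrow> (real ^ 'n) set \<Rightarrow> 'n symb \<Rightarrow> complex \<Rightarrow> 'n symb" where
  "hom_component \<psi> U \<sigma> d p =
     (if \<exists>m s j. classical_expansion \<psi> U m \<sigma> s \<and> m - of_nat j = d
      then THE c. \<exists>m s j. classical_expansion \<psi> U m \<sigma> s \<and> m - of_nat j = d \<and> c = s j p
      else 0)"

text \<open>
  The integral of the form \<open>f d\<^sub>S\<xi>\<close>, \<open>d\<^sub>S\<xi> = \<Sum>\<^sub>i (-1)\<^bsup>i+1\<^esup> \<xi>\<^sub>i d\<xi>\<^sub>1 \<and> \<dots> (omit d\<xi>\<^sub>i) \<dots> \<and> d\<xi>\<^sub>n\<close>, over the unit sphere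
  oriented by the outer normal. For the \<open>i\<close>-th summand the hemispheres \<open>\<xi>\<^sub>i > 0\<close> and \<open>\<xi>\<^sub>i < 0\<close> are
  parametrised as graphs over the unit ball in the variables \<open>y = (\<xi>\<^sub>j)\<^bsub>j \<noteq> i\<^esub>\<close>; there
  \<open>(-1)\<^bsup>i+1\<^esup> d\<xi>\<^sub>1 \<and> \<dots> (omit d\<xi>\<^sub>i) \<dots> \<and> d\<xi>\<^sub>n\<close> is \<open>dy\<close> and \<open>- dy\<close> respectively. On the equator \<open>\<xi>\<^sub>i = 0\<close>,
  a null set, the summand vanishes.
\<close>

definition sphere_integral :: "(real ^ 'n::finite \<Rightarrow> complex) \<Rightarrow> complex" where
  "sphere_integral f =
     (\<Sum>i\<in>UNIV. LINT y:{y. (\<Sum>j\<in>-{i}. (y j)\<^sup>2) < 1}|(\<Pi>\<^sub>M j\<in>-{i}. lborel).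
        (let r = sqrt (1 - (\<Sum>j\<in>-{i}. (y j)\<^sup>2));
             pt = (\<lambda>t. \<chi> j. if j = i then t else y j)
         in f (pt r) * of_real r - f (pt (- r)) * of_real (- r)))"

definition symb_res :: "'n::finite symb \<Rightarrow> (real ^ 'n) set \<Rightarrow> 'n symb \<Rightarrow> real ^ 'n \<Rightarrow> complex" where
  "symb_res \<psi> U \<sigma> x = sphere_integral (\<lambda>\<xi>. hom_component \<psi> U \<sigma> (- of_nat CARD('n)) (x, \<xi>))"

definition fibre_res ::
  "'n::finite symb \<Rightarrow> (real ^ 'n) set \<Rightarrow> 'n symb_form \<Rightarrow> real ^ 'n \<Rightarrow> 'n set \<Rightarrow> complex" where
  "fibre_res \<psi> U \<omega> x I = symb_res \<psi> U (\<omega> I UNIV) x"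

definition total_res :: "'n::finite symb \<Rightarrow> (real ^ 'n) set \<Rightarrow> 'n symb_form \<Rightarrow> complex" where
  "total_res \<psi> U \<omega> = (LINT x:U|lborel. fibre_res \<psi> U \<omega> x UNIV)"


subsection \<open>Poles\<close>

text \<open>
  \<open>f\<close> is meromorphic on the plane, has no poles outside \<open>\<alpha>\<^sup>-\<^sup>1(E)\<close>, and its poles are simple. At a
  critical point \<open>z\<close> of \<open>\<alpha>\<close> simplicity is meant with respect to the local function \<open>\<alpha> - \<alpha>(z)\<close>:
  a simple pole of \<open>w \<mapsto> 1 / (w - \<alpha>(z))\<close> pulled back by \<open>\<alpha>\<close> has as order the multiplicity of \<open>\<alpha>\<close> at \<open>z\<close>.
\<close>

definition meromorphic_simple_poles ::
  "(complex \<Rightarrow> complex) \<Rightarrow> complex set \<Rightarrow> (complex \<Rightarrow> complex) \<Rightarrow> bool" where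
  "meromorphic_simple_poles \<alpha> E f \<longleftrightarrow>
     f meromorphic_on UNIV \<and>
     f holomorphic_on (- (\<alpha> -` E)) \<and>
     (\<forall>z. is_pole f z \<longrightarrow> z \<in> \<alpha> -` E) \<and>
     (\<forall>z. is_pole f z \<and> deriv \<alpha> z \<noteq> 0 \<longrightarrow> zorder f z = -1) \<and>
     (\<forall>z. is_pole f z \<longrightarrow> zorder f z \<ge> - zorder (\<lambda>w. \<alpha> w - \<alpha> z) z)"

end

theory Submission
  imports Defs "HOL-Probability.Sinc_Integral"
begin

text \<open>
  Write \<open>\<sigma>(z) = \<Sum>\<^bsub>j<N\<^esub> \<psi> s\<^sub>j(z) + \<rho>\<^sub>N(z)\<close> for the coefficient of \<open>d\<xi>\<close> in \<open>\<omega>(z)\<close>, where \<open>s\<^sub>j(z)\<close> has degree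
  \<open>\<alpha>(z) - n - j\<close>. Integrating \<open>s\<^sub>j(z)\<close> over \<open>1 \<le> |\<xi>| \<le> R\<close> gives \<open>S\<^sub>j(z) (R\<^bsup>\<alpha>(z)-j\<^esup> - 1) / (\<alpha>(z) - j)\<close>, with
  \<open>S\<^sub>j(z)\<close> the integral of \<open>s\<^sub>j(z)\<close> over the unit sphere, or \<open>S\<^sub>j(z) ln R\<close> if \<open>\<alpha>(z) = j\<close>. For large \<open>N\<close> the
  cut-off integral is therefore \<open>A(z) - \<Sum>\<^bsub>j<N\<^esub> S\<^sub>j(z) / (\<alpha>(z) - j)\<close> with \<open>A\<close> and \<open>S\<^sub>j\<close> holomorphic. The poles
  and the residue \<open>- S\<^sub>k(0) / \<alpha>'(0)\<close>, \<open>k = \<alpha>(0)\<close>, can be read off, and \<open>S\<^sub>k(0)\<close> is the residue density.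
\<close>

text \<open>Holomorphy of \<open>S\<close> is not visible from \<open>sphere_integral\<close>, a sum
  over hemisphere charts of functions whose degree moves with z. The divergence theorem on a
  spherical shell therefore serves twice: it computes the integral over 1 \<le> |\<xi>| \<le> R, and
  it rewrites the sphere integral as an integral over a fixed compact shell, where differentiation
  under the integral sign applies. \<open>N\<close> must grow with Re \<alpha>(z), so each formula
  holds only on the preimage of a half-plane; these sets exhaust the plane, and all statements about
  poles are local. With x / 0 = 0 the formula is an equality of values everywhere, also at
  \<alpha>(z) = j. The residue side needs a uniqueness result of its own: a symbol may have several
  orders, and its component of degree -n is well defined because constant terms along rays are
  unique. Integration over \<open>U\<close> requires bounds uniform in x and a compact x-support
  independent of z.\<close>

no_notation fps_nth (infixl \<open>$\<close> 75)

subsection \<open>Uniqueness of the constant term\<close>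

text \<open>The solutions of exp w = 1 are the integer multiples of 2 pi i, and apart from 0 they
  have modulus above 6. This supplies a shift that detects a given nonzero exponent.\<close>

lemma exp_ne_1_if_norm_1:
  fixes w :: complex
  assumes "norm w = 1"
  shows "exp w \<noteq> 1"
proof
  assume "exp w = 1"
  then obtain n :: int where n: "Re w = 0" "Im w = of_int (2 * n) * pi"
    by (auto simp: exp_eq_1)
  then have "\<bar>of_int (2 * n) * pi\<bar> = 1"
    using assms by (simp add: cmod_eq_Im)
  then have "real_of_int \<bar>2 * n\<bar> * pi = 1"
    by (simp add: abs_mult)
  moreover have "real_of_int \<bar>2 * n\<bar> * pi \<ge> 2 * 3" if "n \<noteq> 0"
    using that pi_gt3 by (intro mult_mono) auto
  ultimately show False by (cases "n = 0") auto
qed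

text \<open>The operator \<open>G \<mapsto> G(t + h) - e\<^bsup>eh\<^esup> G(t)\<close> removes the exponent \<open>e\<close> and keeps the shape of \<open>G\<close>.\<close>

lemma exp_sum_tendsto_0_imp_0:
  fixes a :: "complex \<Rightarrow> complex"
  assumes "finite A" "0 \<notin> A"
    and "((\<lambda>t::real. (\<Sum>e\<in>A. a e * exp (e * of_real t)) + b * of_real t + c) \<longlongrightarrow> 0) at_top"
  shows "b = 0 \<and> c = 0"
  using assms
proof (induction A arbitrary: a b c rule: finite_induct)
  case empty
  then have G: "((\<lambda>t::real. b * of_real t + c) \<longlongrightarrow> 0) at_top" by simp
  have "((\<lambda>t::real. b * of_real (t + 1) + c) \<longlongrightarrow> 0) at_top"
    by (rule filterlim_compose[OF G])
       (simp only: add.commute[of _ 1], rule filterlim_tendsto_add_at_top[OF tendsto_const filterlim_ident])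
  from tendsto_diff[OF this G] have "((\<lambda>t::real. b) \<longlongrightarrow> 0) at_top"
    by (simp add: algebra_simps)
  then have "b = 0" by (simp add: tendsto_const_iff)
  moreover from this G have "c = 0"
    by (simp add: tendsto_const_iff)
  ultimately show ?case by simp
next
  case (insert e A)
  \<comment> \<open>The shift is scaled so that \<open>e * h\<close> lies on the unit circle, hence
    \<open>q \<noteq> 1\<close>. The operator sends b to \<open>b * (1 - q)\<close> and c to
    \<open>b * h + c * (1 - q)\<close>, so that neither of them is lost.\<close>
  define h where "h = 1 / norm e"
  define q where "q = exp (e * of_real h)"
  have "e \<noteq> 0" using insert.prems by auto
  then have q: "q \<noteq> 1"
    unfolding q_def h_def by (intro exp_ne_1_if_norm_1) (simp add: norm_mult norm_divide)
  let ?G = "\<lambda>t::real. (\<Sum>e\<in>insert e A. a e * exp (e * of_real t)) + b * of_real t + c"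
  have "((\<lambda>t::real. ?G (t + h)) \<longlongrightarrow> 0) at_top"
    by (rule filterlim_compose[OF insert.prems(2)])
       (simp only: add.commute[of _ h], rule filterlim_tendsto_add_at_top[OF tendsto_const filterlim_ident])
  from tendsto_diff[OF this tendsto_mult_left[OF insert.prems(2), of q]]
  have lim: "((\<lambda>t. ?G (t + h) - q * ?G t) \<longlongrightarrow> 0) at_top" by simp
  have eq: "?G (t + h) - q * ?G t =
      (\<Sum>e'\<in>A. (a e' * (exp (e' * of_real h) - q)) * exp (e' * of_real t)) +
      (b * (1 - q)) * of_real t + (b * of_real h + c * (1 - q))" for t :: real
  proof -
    have "(\<Sum>e'\<in>A. (a e' * (exp (e' * of_real h) - q)) * exp (e' * of_real t)) =
       (\<Sum>e'\<in>A. a e' * exp (e' * of_real (t + h))) - q * (\<Sum>e'\<in>A. a e' * exp (e' * of_real t))"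
      unfolding sum_distrib_left sum_subtractf[symmetric]
      by (intro sum.cong) (auto simp: algebra_simps exp_add)
    moreover have "exp (e * of_real (t + h)) = q * exp (e * of_real t)"
      by (simp add: q_def algebra_simps exp_add)
    ultimately show ?thesis
      using insert.hyps by (simp add: algebra_simps)
  qed
  have "0 \<notin> A" using insert.prems by auto
  from insert.IH[OF this lim[unfolded eq]]
  have "b * (1 - q) = 0 \<and> b * of_real h + c * (1 - q) = 0" .
  then show ?case using q by auto
qed

text \<open>The substitution R = exp t turns powers into exponentials and ln R into t. Two
  expansions are compared on the union of their exponent sets, with coefficients extended by
  0.\<close>

lemma has_constant_term_unique:
  assumes "has_constant_term F c" "has_constant_term F c'"
  shows "c = c'"
proof -
  from assms(1) obtain A a b where A: "finite A" "0 \<notin> A"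
    and lim: "((\<lambda>R. F R - ((\<Sum>e\<in>A. a e * of_real R powr e) + b * of_real (ln R) + c)) \<longlongrightarrow> 0) at_top"
    unfolding has_constant_term_def by blast
  from assms(2) obtain A' a' b' where A': "finite A'" "0 \<notin> A'"
    and lim': "((\<lambda>R. F R - ((\<Sum>e\<in>A'. a' e * of_real R powr e) + b' * of_real (ln R) + c')) \<longlongrightarrow> 0) at_top"
    unfolding has_constant_term_def by blast
  define d where "d e = (if e \<in> A' then a' e else 0) - (if e \<in> A then a e else 0)" for e
  have "((\<lambda>R. (\<Sum>e\<in>A'. a' e * of_real R powr e) + b' * of_real (ln R) + c'
      - ((\<Sum>e\<in>A. a e * of_real R powr e) + b * of_real (ln R) + c)) \<longlongrightarrow> 0) at_top"
    using tendsto_diff[OF lim lim'] by (simp add: algebra_simps)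
  from filterlim_compose[OF this exp_at_top]
  have "((\<lambda>t::real. (\<Sum>e\<in>A'. a' e * exp (e * of_real t)) + b' * of_real t + c'
      - ((\<Sum>e\<in>A. a e * exp (e * of_real t)) + b * of_real t + c)) \<longlongrightarrow> 0) at_top"
    by (simp add: powr_def Ln_of_real)
  moreover have "(\<Sum>e\<in>A'. a' e * exp (e * of_real t)) + b' * of_real t + c'
      - ((\<Sum>e\<in>A. a e * exp (e * of_real t)) + b * of_real t + c)
    = (\<Sum>e\<in>A \<union> A'. d e * exp (e * of_real t)) + (b' - b) * of_real t + (c' - c)" for t :: real
  proof -
    have "(\<Sum>e\<in>A'. a' e * exp (e * of_real t)) = (\<Sum>e\<in>A \<union> A'. (if e \<in> A' then a' e else 0) * exp (e * of_real t))"
      "(\<Sum>e\<in>A. a e * exp (e * of_real t)) = (\<Sum>e\<in>A \<union> A'. (if e \<in> A then a e else 0) * exp (e * of_real t))"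
      using A A' by (auto intro!: sum.mono_neutral_cong_left)
    then show ?thesis
      by (simp add: d_def algebra_simps sum_subtractf)
  qed
  ultimately have "((\<lambda>t::real. (\<Sum>e\<in>A \<union> A'. d e * exp (e * of_real t)) + (b' - b) * of_real t + (c' - c)) \<longlongrightarrow> 0) at_top"
    by simp
  then have "c' - c = 0"
    using exp_sum_tendsto_0_imp_0[of "A \<union> A'" d "b' - b" "c' - c"] A A' by blast
  then show ?thesis by simp
qed

text \<open>Exponents arise indexed by j, and one of them may be 0. That term equals a_j and moves
  into the constant term; injectivity of \<open>e\<close> allows the others to be indexed by the
  exponents themselves, as \<open>has_constant_term\<close> demands.\<close>

lemma has_constant_termI:
  fixes e :: "'i \<Rightarrow> complex"
  assumes "finite J" "inj_on e J"
    and "((\<lambda>R. F R - ((\<Sum>j\<in>J. a j * of_real R powr e j) + b * of_real (ln R) + c)) \<longlongrightarrow> 0) at_top"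
  shows "has_constant_term F (c + (\<Sum>j\<in>J. if e j = 0 then a j else 0))"
proof -
  define J' where "J' = {j\<in>J. e j \<noteq> 0}"
  have inj: "inj_on e J'" using assms(2) by (auto simp: J'_def inj_on_def)
  let ?c = "c + (\<Sum>j\<in>J. if e j = 0 then a j else 0)"
  have "eventually (\<lambda>R::real. F R - ((\<Sum>j\<in>J. a j * of_real R powr e j) + b * of_real (ln R) + c) =
    F R - ((\<Sum>w\<in>e ` J'. a (the_inv_into J' e w) * of_real R powr w) + b * of_real (ln R) + ?c)) at_top"
    using eventually_gt_at_top[of 0]
  proof eventually_elim
    case (elim R)
    have "(\<Sum>w\<in>e ` J'. a (the_inv_into J' e w) * of_real R powr w) = (\<Sum>j\<in>J'. a j * of_real R powr e j)"
      using inj by (simp add: sum.reindex the_inv_into_f_f)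
    moreover have "(\<Sum>j\<in>J. a j * of_real R powr e j)
        = (\<Sum>j\<in>J. (if e j = 0 then 0 else a j * of_real R powr e j) + (if e j = 0 then a j else 0))"
      using elim by (intro sum.cong) auto
    moreover have "(\<Sum>j\<in>J. if e j = 0 then 0 else a j * of_real R powr e j) = (\<Sum>j\<in>J'. a j * of_real R powr e j)"
      unfolding J'_def using assms(1) by (intro sum.mono_neutral_cong_right) auto
    ultimately show ?case by (simp add: sum.distrib)
  qed
  then have "((\<lambda>R. F R - ((\<Sum>w\<in>e ` J'. a (the_inv_into J' e w) * of_real R powr w) + b * of_real (ln R) + ?c)) \<longlongrightarrow> 0) at_top"
    using assms(3) by (rule Lim_transform_eventually[rotated])
  then show ?thesis
    unfolding has_constant_term_def using assms(1)
    by (intro exI[of _ "e ` J'"] exI[of _ "\<lambda>w. a (the_inv_into J' e w)"] exI[of _ b]) (auto simp: J'_def)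
qed

subsection \<open>Holomorphic functions with poles along the integer fibres of a holomorphic function\<close>

text \<open>A nonzero derivative at one point excludes constancy, and the identity theorem then
  makes the fibres of \<alpha> discrete at every z, not only at 0.\<close>

lemma nonconstant_imp_eventually_ne:
  assumes "\<alpha> holomorphic_on UNIV" "deriv \<alpha> 0 \<noteq> 0"
  shows "eventually (\<lambda>w. \<alpha> w \<noteq> \<alpha> z) (at z)"
proof -
  have "\<not> \<alpha> constant_on UNIV"
  proof
    assume "\<alpha> constant_on UNIV"
    then obtain c where "\<alpha> = (\<lambda>_. c)" by (auto simp: constant_on_def fun_eq_iff)
    with assms(2) show False by simp
  qed
  then obtain w where w: "\<alpha> w \<noteq> \<alpha> z" by (force simp: constant_on_def)
  have "eventually (\<lambda>w. \<alpha> w - \<alpha> z \<noteq> 0) (at z)"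
  proof (rule non_zero_neighbour_alt[of _ UNIV z w, THEN eventually_mono])
    show "(\<lambda>w. \<alpha> w - \<alpha> z) holomorphic_on UNIV" using assms(1) by (intro holomorphic_intros)
  qed (use w in auto)
  then show ?thesis by simp
qed

context
  fixes \<alpha> \<Phi> :: "complex \<Rightarrow> complex" and A S :: "nat \<Rightarrow> complex \<Rightarrow> complex" and c :: real
  assumes \<alpha>: "\<alpha> holomorphic_on UNIV"
    and \<alpha>': "deriv \<alpha> 0 \<noteq> 0"
    and c: "c \<ge> 0"
    and A: "\<And>N. N \<ge> 1 \<Longrightarrow> A N holomorphic_on {z. Re (\<alpha> z) + c < real N}"
    and S: "\<And>j. S j holomorphic_on UNIV"
    and \<Phi>: "\<And>N z. N \<ge> 1 \<Longrightarrow> Re (\<alpha> z) + c < real N \<Longrightarrow> \<Phi> z = A N z - (\<Sum>j<N. S j z / (\<alpha> z - of_nat j))"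
begin

lemma cont_\<alpha>: "continuous_on UNIV \<alpha>"
  using \<alpha> by (rule holomorphic_on_imp_continuous_on)

lemma open_halfplane: "open {z. Re (\<alpha> z) + c < real N}"
  by (intro open_Collect_less continuous_intros cont_\<alpha>)

text \<open>Each point lies in one of the open sets on which the formula holds with a fixed
  \<open>N\<close>. None of its \<open>N\<close> denominators vanishes at \<open>z0\<close>, hence
  none vanishes nearby.\<close>

lemma local_regular:
  assumes "\<forall>k. \<alpha> z0 \<noteq> of_nat k"
  shows "\<Phi> analytic_on {z0}"
proof -
  obtain N where "max 1 (Re (\<alpha> z0) + c) < real N" using reals_Archimedean2 by blast
  then have N: "N \<ge> 1" "Re (\<alpha> z0) + c < real N" by auto
  define W where "W = {z. Re (\<alpha> z) + c < real N} \<inter> (\<Inter>j\<in>{..<N}. {z. \<alpha> z \<noteq> of_nat j})"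
  have W: "open W" "z0 \<in> W"
    using assms N unfolding W_def
    by (auto intro!: open_Int open_halfplane open_INT open_Collect_neq cont_\<alpha> continuous_intros)
  have "(\<lambda>z. A N z - (\<Sum>j<N. S j z / (\<alpha> z - of_nat j))) holomorphic_on W"
    by (intro holomorphic_intros holomorphic_on_subset[OF A[OF N(1)]] holomorphic_on_subset[OF S]
          holomorphic_on_subset[OF \<alpha>]) (auto simp: W_def)
  then have "\<Phi> holomorphic_on W"
    by (rule holomorphic_transform) (use N(1) in \<open>auto simp: W_def \<Phi>\<close>)
  then show ?thesis using W analytic_at by blast
qed

lemma local_pole:
  assumes "\<alpha> z0 = of_nat k"
  obtains W B where "open W" "z0 \<in> W" "B holomorphic_on W"
    "\<And>z. z \<in> W \<Longrightarrow> \<Phi> z = B z - S k z / (\<alpha> z - of_nat k)"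
proof -
  obtain N where "max 1 (Re (\<alpha> z0) + c) < real N" using reals_Archimedean2 by blast
  then have N: "N \<ge> 1" "Re (\<alpha> z0) + c < real N" by auto
  \<comment> \<open>Here \<open>c \<ge> 0\<close> enters: the singular index has to be among the
    summands for the chosen \<open>N\<close>.\<close>
  then have k: "k < N" using assms c by simp
  define W where "W = {z. Re (\<alpha> z) + c < real N} \<inter> (\<Inter>j\<in>{..<N} - {k}. {z. \<alpha> z \<noteq> of_nat j})"
  define B where "B z = A N z - (\<Sum>j\<in>{..<N} - {k}. S j z / (\<alpha> z - of_nat j))" for z
  have W: "open W" "z0 \<in> W"
    using assms N unfolding W_def
    by (auto intro!: open_Int open_halfplane open_INT open_Collect_neq cont_\<alpha> continuous_intros)
  have "B holomorphic_on W" unfolding B_def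
    by (intro holomorphic_intros holomorphic_on_subset[OF A[OF N(1)]] holomorphic_on_subset[OF S]
          holomorphic_on_subset[OF \<alpha>]) (auto simp: W_def)
  moreover have "\<Phi> z = B z - S k z / (\<alpha> z - of_nat k)" if "z \<in> W" for z
  proof -
    have "(\<Sum>j<N. S j z / (\<alpha> z - of_nat j)) =
        S k z / (\<alpha> z - of_nat k) + (\<Sum>j\<in>{..<N} - {k}. S j z / (\<alpha> z - of_nat j))"
      using k by (intro sum.remove) auto
    then show ?thesis using that \<Phi>[of N z] N(1) by (simp add: W_def B_def)
  qed
  ultimately show ?thesis using W that by blast
qed

lemma meromorphic_sum: "\<Phi> meromorphic_on {z0}"
proof (cases "\<exists>k. \<alpha> z0 = of_nat k")
  case True
  then obtain k where k: "\<alpha> z0 = of_nat k" by blast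
  from local_pole[OF this] obtain W B where W: "open W" "z0 \<in> W" "B holomorphic_on W"
    and eq: "\<And>z. z \<in> W \<Longrightarrow> \<Phi> z = B z - S k z / (\<alpha> z - of_nat k)" by metis
  have "(\<lambda>z. B z - S k z / (\<alpha> z - of_nat k)) meromorphic_on {z0}"
    by (intro meromorphic_intros analytic_on_imp_meromorphic_on)
       (use W \<alpha> S in \<open>auto simp: analytic_at intro: holomorphic_on_subset\<close>)
  moreover have "eventually (\<lambda>z. \<Phi> z = B z - S k z / (\<alpha> z - of_nat k)) (at z0)"
    using eventually_at_in_open'[OF W(1,2)] by eventually_elim (simp add: eq)
  ultimately show ?thesis
    by (subst meromorphic_on_cong[where g = "\<lambda>z. B z - S k z / (\<alpha> z - of_nat k)" and B = "{z0}"]) auto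
next
  case False
  then show ?thesis using local_regular analytic_on_imp_meromorphic_on by blast
qed

lemma pole_imp_nat:
  assumes "is_pole \<Phi> z0"
  obtains k where "\<alpha> z0 = of_nat k"
  using assms local_regular analytic_at_imp_no_pole by blast

text \<open>Multiplication by \<alpha> - \<alpha>(z0) clears the only singular denominator, so near
  \<open>z0\<close> the product agrees with the analytic function \<open>H\<close>, of order at
  least 0; orders are additive.\<close>

lemma zorder_pole_ge:
  assumes "is_pole \<Phi> z0"
  shows "zorder \<Phi> z0 \<ge> - zorder (\<lambda>w. \<alpha> w - \<alpha> z0) z0"
proof -
  obtain k where k: "\<alpha> z0 = of_nat k" using pole_imp_nat[OF assms] .
  from local_pole[OF this] obtain W B where W: "open W" "z0 \<in> W" "B holomorphic_on W"
    and eq: "\<And>z. z \<in> W \<Longrightarrow> \<Phi> z = B z - S k z / (\<alpha> z - of_nat k)" by metis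
  define H where "H z = B z * (\<alpha> z - \<alpha> z0) - S k z" for z
  have H: "H analytic_on {z0}"
    unfolding H_def using W \<alpha> S by (intro analytic_intros) (auto simp: analytic_at intro: holomorphic_on_subset)
  have \<alpha>an: "(\<lambda>w. \<alpha> w - \<alpha> z0) analytic_on {z0}"
    using \<alpha> by (intro analytic_intros) (auto simp: analytic_at)
  have \<alpha>ne: "eventually (\<lambda>w. \<alpha> w \<noteq> \<alpha> z0) (at z0)"
    by (rule nonconstant_imp_eventually_ne[OF \<alpha> \<alpha>'])
  have prod: "eventually (\<lambda>z. \<Phi> z * (\<alpha> z - \<alpha> z0) = H z) (at z0)"
    using eventually_at_in_open'[OF W(1,2)] \<alpha>ne
    by eventually_elim (auto simp: eq H_def k field_simps)
  have ne: "eventually (\<lambda>z. \<Phi> z \<noteq> 0) (at z0)"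
    using assms non_zero_neighbour_pole by blast
  \<comment> \<open>Near a pole \<open>\<Phi>\<close> is nonzero, so \<open>H\<close> does not
    vanish identically and its order is meaningful.\<close>
  have Hne: "eventually (\<lambda>z. H z \<noteq> 0) (at z0)"
    using prod ne \<alpha>ne by eventually_elim auto
  have "zorder \<Phi> z0 + zorder (\<lambda>w. \<alpha> w - \<alpha> z0) z0 = zorder (\<lambda>z. \<Phi> z * (\<alpha> z - \<alpha> z0)) z0"
  proof (rule zorder_times_analytic'[symmetric])
    show "\<exists>\<^sub>F z in at z0. \<Phi> z * (\<alpha> z - \<alpha> z0) \<noteq> 0"
      by (rule eventually_frequently) (use ne \<alpha>ne in \<open>auto elim: eventually_elim2\<close>)
  qed (use meromorphic_sum \<alpha>an in \<open>auto simp: meromorphic_at_iff\<close>)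
  also have "\<dots> = zorder H z0"
    by (rule zorder_cong) (use prod in auto)
  also have "\<dots> \<ge> 0"
    using H Hne by (intro zorder_ge_0) (auto intro: eventually_frequently)
  finally show ?thesis by simp
qed

lemma meromorphic_simple_poles_sum: "meromorphic_simple_poles \<alpha> (of_int ` {- int n..}) \<Phi>"
proof -
  \<comment> \<open>Poles occur only over natural numbers, which belong to the admissible set
    whatever \<open>n\<close> is.\<close>
  have E: "(of_nat k :: complex) \<in> of_int ` {- int n..}" for k
    by (rule image_eqI[of _ _ "int k"]) auto
  have "\<Phi> meromorphic_on UNIV"
    using meromorphic_sum meromorphic_on_meromorphic_at by blast
  moreover have "\<Phi> analytic_on (- (\<alpha> -` of_int ` {- int n..}))"
    using local_regular E by (subst analytic_on_analytic_at) (metis ComplD vimageI2)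
  then have "\<Phi> holomorphic_on (- (\<alpha> -` of_int ` {- int n..}))"
    by (rule analytic_imp_holomorphic)
  moreover have "z \<in> \<alpha> -` of_int ` {- int n..}" if "is_pole \<Phi> z" for z
    using pole_imp_nat[OF that] E by (metis vimageI)
  moreover have "zorder \<Phi> z = -1" if z: "is_pole \<Phi> z" "deriv \<alpha> z \<noteq> 0" for z
  proof -
    have "zorder (\<lambda>w. \<alpha> w - \<alpha> z) z = 1"
    proof (rule zorder_zero_eqI')
      show "(\<lambda>w. \<alpha> w - \<alpha> z) analytic_on {z}" using \<alpha> by (intro analytic_intros) (auto simp: analytic_at)
      have "\<alpha> field_differentiable at z"
        using \<alpha> by (simp add: holomorphic_on_imp_differentiable_at)
      then have "deriv (\<lambda>w. \<alpha> w - \<alpha> z) z = deriv \<alpha> z" by simp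
      then show "(deriv ^^ nat 1) (\<lambda>w. \<alpha> w - \<alpha> z) z \<noteq> 0" using z by simp
    qed auto
    then have "zorder \<Phi> z \<ge> -1" using zorder_pole_ge[OF z(1)] by simp
    moreover have "zorder \<Phi> z < 0"
      using meromorphic_sum z(1) by (intro isolated_pole_imp_neg_zorder) (auto simp: meromorphic_at_iff)
    ultimately show ?thesis by simp
  qed
  ultimately show ?thesis
    unfolding meromorphic_simple_poles_def using zorder_pole_ge by blast
qed

text \<open>Near 0 the singular part times w is S_k(w) divided by the difference quotient of
  \<alpha>, which tends to \<alpha>'(0) \<noteq> 0. As only this limit is used, S_k(0) = 0 is no
  separate case.\<close>

lemma residue_sum:
  assumes "\<alpha> 0 = of_nat k"
  shows "residue \<Phi> 0 = - (1 / deriv \<alpha> 0) * S k 0"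
proof -
  from local_pole[OF assms] obtain W B where W: "open W" "0 \<in> W" "B holomorphic_on W"
    and eq: "\<And>z. z \<in> W \<Longrightarrow> \<Phi> z = B z - S k z / (\<alpha> z - of_nat k)" by metis
  define Q where "Q z = S k z / (\<alpha> z - of_nat k)" for z
  have ne: "eventually (\<lambda>w. \<alpha> w \<noteq> of_nat k) (at 0)"
    using nonconstant_imp_eventually_ne[OF \<alpha> \<alpha>', of 0] by (simp add: assms)
  then obtain r where r: "r > 0" "\<And>w. w \<noteq> 0 \<Longrightarrow> dist w 0 < r \<Longrightarrow> \<alpha> w \<noteq> of_nat k"
    by (auto simp: eventually_at)
  define V where "V = W \<inter> ball 0 r"
  have V: "open V" "0 \<in> V" using W r by (auto simp: V_def)
  have Q: "Q holomorphic_on V - {0}" unfolding Q_def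
    by (intro holomorphic_intros holomorphic_on_subset[OF S] holomorphic_on_subset[OF \<alpha>])
       (use r in \<open>auto simp: V_def dist_commute\<close>)
  have B: "B holomorphic_on V" using W by (auto simp: V_def intro: holomorphic_on_subset)
  have "residue \<Phi> 0 = residue (\<lambda>z. B z - Q z) 0"
    by (rule residue_cong) (use eventually_at_in_open'[OF W(1,2)] in \<open>auto elim!: eventually_mono simp: eq Q_def\<close>)
  also have "\<dots> = residue B 0 - residue Q 0"
    by (rule residue_diff[OF V]) (use B Q in \<open>auto intro: holomorphic_on_subset\<close>)
  also have "residue B 0 = 0" by (rule residue_holo[OF V B])
  also have "residue Q 0 = S k 0 / deriv \<alpha> 0"
  proof -
    have "(\<alpha> has_field_derivative deriv \<alpha> 0) (at 0)"
      using \<alpha> by (simp add: holomorphic_derivI)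
    then have "((\<lambda>w. (\<alpha> w - \<alpha> 0) / w) \<longlongrightarrow> deriv \<alpha> 0) (at 0)"
      by (simp add: has_field_derivative_iff)
    moreover have "(S k \<longlongrightarrow> S k 0) (at 0)"
      using S[of k] holomorphic_on_imp_continuous_on[OF S[of k]]
      by (simp add: continuous_on_eq_continuous_at isCont_def)
    ultimately have "((\<lambda>w. S k w / ((\<alpha> w - \<alpha> 0) / w)) \<longlongrightarrow> S k 0 / deriv \<alpha> 0) (at 0)"
      using \<alpha>' by (intro tendsto_divide)
    then have "((\<lambda>w. Q w * (w - 0)) \<longlongrightarrow> S k 0 / deriv \<alpha> 0) (at 0)"
      by (simp add: Q_def assms)
    then show ?thesis
      by (rule residue_simple'[OF V Q])
  qed
  finally show ?thesis by simp
qed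

lemma residue_sum_0:
  assumes "\<forall>k. \<alpha> 0 \<noteq> of_nat k"
  shows "residue \<Phi> 0 = 0"
  using local_regular[OF assms] by (auto simp: analytic_at intro: residue_holo)

end

subsection \<open>Parameter integrals of holomorphic functions\<close>

text \<open>An integrable bound for \<open>f\<close> itself suffices. Cauchy's inequality on circles
  of radius r/4 bounds the z-derivative on the ball of radius r/2 by 4 g / r, the mean value
  inequality passes this bound on to the difference quotients, and dominated convergence
  applies.\<close>

lemma has_field_derivative_lebesgue_integral:
  fixes f :: "complex \<Rightarrow> 'a \<Rightarrow> complex"
  assumes r: "r > 0"
    and hol: "\<And>p. p \<in> space M \<Longrightarrow> (\<lambda>z. f z p) holomorphic_on ball z0 r"
    and meas: "\<And>z. z \<in> ball z0 r \<Longrightarrow> f z \<in> borel_measurable M"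
    and bound: "\<And>z p. z \<in> ball z0 r \<Longrightarrow> p \<in> space M \<Longrightarrow> norm (f z p) \<le> g p"
    and g: "integrable M g"
  shows "((\<lambda>z. LINT p|M. f z p) has_field_derivative (LINT p|M. deriv (\<lambda>z. f z p) z0)) (at z0)"
proof -
  have int: "integrable M (f z)" if "z \<in> ball z0 r" for z
    using g by (rule Bochner_Integration.integrable_bound)
      (use meas that bound in \<open>auto intro!: AE_I2 intro: order_trans[OF _ abs_ge_self]\<close>)
  have quot: "norm ((f (z0 + h) p - f z0 p) / h) \<le> 4 * g p / r"
    if p: "p \<in> space M" and h: "h \<noteq> 0" "norm h < r / 2" for h p
  proof -
    have "norm (f (z0 + h) p - f z0 p) \<le> (4 * g p / r) * norm (z0 + h - z0)"
    proof (rule field_differentiable_bound[of "ball z0 (r/2)" "\<lambda>z. f z p" "deriv (\<lambda>z. f z p)"])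
      fix z assume z: "z \<in> ball z0 (r/2)"
      have sub: "cball z (r/4) \<subseteq> ball z0 r"
      proof (rule subsetI)
        fix w assume "w \<in> cball z (r/4)"
        then show "w \<in> ball z0 r"
          using z r dist_triangle[of z0 w z] by simp
      qed
      show "((\<lambda>z. f z p) has_field_derivative deriv (\<lambda>z. f z p) z) (at z within ball z0 (r / 2))"
        using z r by (intro DERIV_subset[OF holomorphic_derivI[OF hol[OF p]]]) auto
      have hol': "(\<lambda>z. f z p) holomorphic_on cball z (r/4)"
        using hol[OF p] sub by (rule holomorphic_on_subset)
      have "norm ((deriv ^^ 1) (\<lambda>z. f z p) z) \<le> fact 1 * g p / (r/4) ^ 1"
      proof (rule Cauchy_inequality)
        show "(\<lambda>z. f z p) holomorphic_on ball z (r/4)"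
          using hol' by (rule holomorphic_on_subset) auto
        show "norm (f w p) \<le> g p" if "norm (z - w) = r / 4" for w
          using sub p that by (intro bound) (auto simp: subset_iff dist_norm)
      qed (use hol' r in \<open>auto intro: holomorphic_on_imp_continuous_on\<close>)
      then show "norm (deriv (\<lambda>z. f z p) z) \<le> 4 * g p / r" by (simp add: field_simps)
    qed (use h r in \<open>auto simp: dist_norm\<close>)
    then show ?thesis using h by (simp add: norm_divide field_simps)
  qed
  have "((\<lambda>h. LINT p|M. (f (z0 + h) p - f z0 p) / h) \<longlongrightarrow> (LINT p|M. deriv (\<lambda>z. f z p) z0)) (at 0)"
    unfolding tendsto_at_iff_sequentially comp_def
  proof (intro allI impI)
    fix X :: "nat \<Rightarrow> complex"
    assume X: "\<forall>i. X i \<in> UNIV - {0}" "X \<longlonglongrightarrow> 0"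
    then have "eventually (\<lambda>i. norm (X i) < r / 2) sequentially"
      using r by (intro order_tendstoD(2)[OF tendsto_norm_zero]) auto
    \<comment> \<open>Dropping the first \<open>n\<close> terms puts the whole sequence where the
      bound on the quotients holds.\<close>
    then obtain n where n: "\<And>i. i \<ge> n \<Longrightarrow> norm (X i) < r / 2"
      by (auto simp: eventually_sequentially)
    have mem: "z0 + X (i + n) \<in> ball z0 r" for i
      using n[of "i + n"] r by (simp add: dist_norm)
    have "(\<lambda>i. LINT p|M. (f (z0 + X (i + n)) p - f z0 p) / X (i + n)) \<longlonglongrightarrow> (LINT p|M. deriv (\<lambda>z. f z p) z0)"
    proof (rule integral_dominated_convergence[where w = "\<lambda>p. 4 * g p / r"])
      have lim: "(\<lambda>i. (f (z0 + X (i + n)) p - f z0 p) / X (i + n)) \<longlonglongrightarrow> deriv (\<lambda>z. f z p) z0"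
        if "p \<in> space M" for p
      proof -
        have "((\<lambda>h. (f (z0 + h) p - f z0 p) / h) \<longlongrightarrow> deriv (\<lambda>z. f z p) z0) (at 0)"
          using holomorphic_derivI[OF hol[OF that], of z0 UNIV] r by (simp add: DERIV_def)
        moreover have "filterlim (\<lambda>i. X (i + n)) (at 0) sequentially"
          using X by (auto simp: filterlim_at intro: LIMSEQ_ignore_initial_segment)
        ultimately show ?thesis by (rule filterlim_compose)
      qed
      \<comment> \<open>The derivative is measurable as the pointwise limit of difference quotients
        along the sequence.\<close>
      show "(\<lambda>p. deriv (\<lambda>z. f z p) z0) \<in> borel_measurable M"
        by (rule borel_measurable_LIMSEQ_metric[OF _ lim])
           (use mem meas r in \<open>auto intro!: borel_measurable_divide borel_measurable_diff\<close>)
      show "AE p in M. (\<lambda>i. (f (z0 + X (i + n)) p - f z0 p) / X (i + n)) \<longlonglongrightarrow> deriv (\<lambda>z. f z p) z0"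
        using lim by (auto intro!: AE_I2)
      show "integrable M (\<lambda>p. 4 * g p / r)" using g by simp
      show "(\<lambda>p. (f (z0 + X (i + n)) p - f z0 p) / X (i + n)) \<in> borel_measurable M" for i
        using mem meas r by (auto intro!: borel_measurable_divide borel_measurable_diff)
      show "AE p in M. norm ((f (z0 + X (i + n)) p - f z0 p) / X (i + n)) \<le> 4 * g p / r" for i
        using quot X n[of "i + n"] by (auto intro!: AE_I2)
    qed
    then show "(\<lambda>i. LINT p|M. (f (z0 + X i) p - f z0 p) / X i) \<longlonglongrightarrow> (LINT p|M. deriv (\<lambda>z. f z p) z0)"
      by (rule LIMSEQ_offset)
  qed
  moreover have "eventually (\<lambda>h. (LINT p|M. (f (z0 + h) p - f z0 p) / h) =
      ((LINT p|M. f (z0 + h) p) - (LINT p|M. f z0 p)) / h) (at 0)"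
    unfolding eventually_at using r int
    by (intro exI[of _ r]) (auto simp: dist_norm)
  ultimately show ?thesis
    unfolding DERIV_def by (rule Lim_transform_eventually)
qed

lemma holomorphic_on_lebesgue_integral:
  fixes f :: "complex \<Rightarrow> 'a \<Rightarrow> complex"
  assumes "open S"
    and hol: "\<And>p. p \<in> space M \<Longrightarrow> (\<lambda>z. f z p) holomorphic_on S"
    and meas: "\<And>z. z \<in> S \<Longrightarrow> f z \<in> borel_measurable M"
    and bound: "\<And>z0. z0 \<in> S \<Longrightarrow> \<exists>r>0. \<exists>g. integrable M g \<and> (\<forall>z\<in>ball z0 r. \<forall>p\<in>space M. norm (f z p) \<le> g p)"
  shows "(\<lambda>z. LINT p|M. f z p) holomorphic_on S"
  unfolding holomorphic_on_open[OF \<open>open S\<close>]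
proof
  fix z0 assume z0: "z0 \<in> S"
  from bound[OF z0] obtain r g where rg: "r > 0" "integrable M g"
    "\<And>z p. z \<in> ball z0 r \<Longrightarrow> p \<in> space M \<Longrightarrow> norm (f z p) \<le> g p" by blast
  obtain r' where r': "r' > 0" "ball z0 r' \<subseteq> S"
    using \<open>open S\<close> z0 open_contains_ball by blast
  show "\<exists>f'. ((\<lambda>z. LINT p|M. f z p) has_field_derivative f') (at z0)"
    by (rule exI, rule has_field_derivative_lebesgue_integral[of "min r r'" M f z0 g])
       (use rg r' meas in \<open>auto intro!: holomorphic_on_subset[OF hol]\<close>)
qed

text \<open>Some disc contains uncountably many points of \<open>Z\<close>, in particular infinitely
  many, so \<open>Z\<close> has a limit point and the identity theorem applies.\<close>

lemma holomorphic_vanish_uncountable: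
  assumes "f holomorphic_on UNIV" "uncountable Z" "\<And>z. z \<in> Z \<Longrightarrow> f z = 0"
  shows "f w = 0"
proof -
  have "Z = (\<Union>n. Z \<inter> cball 0 (real n))"
    using real_arch_simple by auto
  then have "\<exists>n. uncountable (Z \<inter> cball 0 (real n))"
    using assms(2) countable_UN[of UNIV "\<lambda>n. Z \<inter> cball 0 (real n)"] by auto
  then obtain n where "infinite (Z \<inter> cball 0 (real n))"
    using countable_finite by blast
  then obtain l where "l islimpt (Z \<inter> cball 0 (real n))"
    using compact_cball[of 0 "real n"] unfolding compact_eq_Bolzano_Weierstrass by blast
  then have l: "l islimpt Z" by (rule islimpt_subset) auto
  show ?thesis
    by (rule analytic_continuation[OF assms(1) open_UNIV connected_UNIV subset_UNIV UNIV_I l assms(3) UNIV_I])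
qed

text \<open>
  Although the \<open>x\<close>-support of a holomorphic family may a priori depend on \<open>z\<close>, one of countably many
  compact sets serves uncountably many \<open>z\<close>, and then, by the identity theorem, all of them.
\<close>

lemma uniform_support:
  fixes f :: "complex \<Rightarrow> 'a::euclidean_space \<times> 'b \<Rightarrow> complex"
  assumes U: "open U"
    and supp: "\<And>z. \<exists>K. compact K \<and> K \<subseteq> U \<and> (\<forall>x \<xi>. x \<notin> K \<longrightarrow> f z (x, \<xi>) = 0)"
    and hol: "\<And>x \<xi>. x \<in> U \<Longrightarrow> (\<lambda>z. f z (x, \<xi>)) holomorphic_on UNIV"
  shows "\<exists>K. compact K \<and> K \<subseteq> U \<and> (\<forall>z x \<xi>. x \<notin> K \<longrightarrow> f z (x, \<xi>) = 0)"
proof -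
  obtain C where C: "\<And>n. compact (C n)" "\<And>n. C n \<subseteq> U" "\<And>n. C n \<subseteq> interior (C (Suc n))"
    "\<Union>(range C) = U" "\<And>K. compact K \<Longrightarrow> K \<subseteq> U \<Longrightarrow> \<exists>N. \<forall>n\<ge>N. K \<subseteq> C n"
    using open_Union_compact_subsets[OF U] by metis
  define Z where "Z n = {z. \<forall>x \<xi>. x \<notin> C n \<longrightarrow> f z (x, \<xi>) = 0}" for n
  have "(\<Union>n. Z n) = UNIV"
  proof -
    have "\<exists>n. z \<in> Z n" for z
    proof -
      obtain K where K: "compact K" "K \<subseteq> U" "\<forall>x \<xi>. x \<notin> K \<longrightarrow> f z (x, \<xi>) = 0" using supp by blast
      with C(5)[OF K(1,2)] show ?thesis unfolding Z_def by blast
    qed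
    then show ?thesis by blast
  qed
  then obtain n where n: "uncountable (Z n)"
    using uncountable_UNIV_complex countable_UN[of UNIV Z] by auto
  have "f z (x, \<xi>) = 0" if "x \<notin> C n" for z x \<xi>
  proof (cases "x \<in> U")
    case True
    show ?thesis
      by (rule holomorphic_vanish_uncountable[OF hol[OF True] n]) (use that in \<open>auto simp: Z_def\<close>)
  next
    case False
    then show ?thesis using supp by blast
  qed
  then show ?thesis using C(1,2) by (intro exI[of _ "C n"]) simp
qed

subsection \<open>Homogeneous functions on spherical shells\<close>

lemma Basis_vec_real: "(Basis :: (real ^ 'n::finite) set) = range (\<lambda>i. axis i 1)"
  by (auto simp: Basis_vec_def)

lemma prod_Basis_vec: "(\<Prod>b\<in>Basis. f b) = (\<Prod>i\<in>UNIV. f (axis i 1 :: real ^ 'n::finite))"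
  unfolding Basis_vec_real by (subst prod.reindex) (auto simp: inj_on_def axis_eq_axis)

interpretation lborel_product: product_sigma_finite "\<lambda>_. lborel :: real measure"
  by standard

lemma measurable_vec_lambda:
  "(\<lambda>y. \<chi> i. y i) \<in> borel_measurable (\<Pi>\<^sub>M i\<in>(UNIV :: 'n::finite set). lborel :: real measure)"
  by (subst borel_measurable_euclidean_space) (auto simp: Basis_vec_real inner_axis)

text \<open>Lebesgue measure is characterised by its values on boxes. The identification gives
  Fubini access to the product measures over the coordinates other than i, in which
  \<open>sphere_integral\<close> is written.\<close>

lemma lborel_vec:
  "(lborel :: (real ^ 'n::finite) measure) = distr (\<Pi>\<^sub>M i\<in>UNIV. lborel) borel (\<lambda>y. \<chi> i. y i)"
proof (rule lborel_eqI)
  fix l u :: "real ^ 'n"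
  assume le: "\<And>b. b \<in> Basis \<Longrightarrow> l \<bullet> b \<le> u \<bullet> b"
  have *: "l $ i \<le> u $ i" for i using le[of "axis i 1"] by (simp add: Basis_vec_real inner_axis)
  have "emeasure (distr (\<Pi>\<^sub>M i\<in>UNIV. lborel) borel (\<lambda>y. \<chi> i. y i)) (box l u) =
     emeasure (\<Pi>\<^sub>M i\<in>UNIV. lborel) (\<Pi>\<^sub>E i\<in>(UNIV::'n set). {l $ i<..<u $ i})"
    by (subst emeasure_distr[OF measurable_vec_lambda])
       (auto intro!: arg_cong2[where f = emeasure] simp: mem_box_cart space_PiM PiE_def extensional_def Pi_def)
  also have "\<dots> = (\<Prod>i\<in>UNIV. emeasure lborel {l $ i<..<u $ i})"
    by (rule lborel_product.emeasure_PiM) auto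
  also have "\<dots> = (\<Prod>b\<in>Basis. (u - l) \<bullet> b)"
    using * by (simp add: prod_Basis_vec inner_axis prod_ennreal)
  finally show "emeasure (distr (\<Pi>\<^sub>M i\<in>UNIV. lborel) borel (\<lambda>y. \<chi> i. y i)) (box l u) = (\<Prod>b\<in>Basis. (u - l) \<bullet> b)" .
qed simp

lemma lborel_integral_split_coordinate:
  fixes F :: "real ^ 'n::finite \<Rightarrow> complex"
  assumes F: "integrable lborel F"
  shows "(LINT \<xi>|lborel. F \<xi>) =
    (LINT y|(\<Pi>\<^sub>M j\<in>-{i}. lborel). LINT t|lborel. F (\<chi> j. if j = i then t else y j))"
proof -
  have meas: "F \<in> borel_measurable borel" using F by simp
  have U: "insert i (- {i}) = UNIV" by auto
  have "integrable (distr (\<Pi>\<^sub>M i\<in>UNIV. lborel) borel (\<lambda>y. \<chi> i. y i)) F"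
    using F by (simp add: lborel_vec[symmetric])
  then have int: "integrable (\<Pi>\<^sub>M i\<in>UNIV. lborel) (\<lambda>y. F (\<chi> i. y i))"
    by (rule integrable_distr[OF measurable_vec_lambda])
  have "(LINT \<xi>|lborel. F \<xi>) = (LINT y|(\<Pi>\<^sub>M i\<in>UNIV. lborel). F (\<chi> i. y i))"
    by (subst lborel_vec) (rule integral_distr[OF measurable_vec_lambda meas])
  also have "\<dots> = (LINT y|(\<Pi>\<^sub>M j\<in>-{i}. lborel). LINT t|lborel. F (\<chi> j. (y(i := t)) j))"
    using lborel_product.product_integral_insert[of "-{i}" i "\<lambda>y. F (\<chi> i. y i)"] int by (simp add: U)
  also have "\<dots> = (LINT y|(\<Pi>\<^sub>M j\<in>-{i}. lborel). LINT t|lborel. F (\<chi> j. if j = i then t else y j))"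
    by (simp add: fun_upd_def)
  finally show ?thesis .
qed

section \<open>The divergence theorem on spherical shells\<close>

abbreviation shell :: "real \<Rightarrow> real \<Rightarrow> (real ^ 'n::finite) set" where
  "shell a b \<equiv> {\<xi>. a \<le> norm \<xi> \<and> norm \<xi> \<le> b}"

lemma compact_shell: "compact (shell a b :: (real ^ 'n::finite) set)"
proof -
  have "shell a b = (cball 0 b - ball 0 a :: (real ^ 'n) set)" by (auto simp: not_less)
  moreover have "compact (cball 0 b - ball (0 :: real ^ 'n) a)" by (intro compact_diff) auto
  ultimately show ?thesis by simp
qed

lemma power2_norm_vec_update:
  fixes y :: "'n::finite \<Rightarrow> real"
  shows "(norm (\<chi> j. if j = i then t else y j))\<^sup>2 = t\<^sup>2 + (\<Sum>j\<in>-{i}. (y j)\<^sup>2)"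
proof -
  define p where "p = (\<chi> j. if j = i then t else y j)"
  have "(norm p)\<^sup>2 = (\<Sum>j\<in>UNIV. (p $ j)\<^sup>2)"
    unfolding power2_norm_eq_inner inner_vec_def by (simp add: power2_eq_square)
  also have "\<dots> = t\<^sup>2 + (\<Sum>j\<in>UNIV - {i}. (p $ j)\<^sup>2)"
    by (subst sum.remove[of _ i]) (auto simp: p_def)
  also have "(\<Sum>j\<in>UNIV - {i}. (p $ j)\<^sup>2) = (\<Sum>j\<in>-{i}. (y j)\<^sup>2)"
    by (intro sum.cong) (auto simp: p_def)
  finally show ?thesis by (simp add: p_def)
qed

text \<open>Fubini singles out the coordinate i, and the fundamental theorem of calculus applies on
  each line in that direction. Endpoints on the outer sphere contribute nothing by
  \<open>zero\<close>; those on the unit sphere are the two hemisphere charts. The shell lies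
  outside the unit sphere, hence the minus sign.\<close>

lemma integral_divergence_shell:
  fixes F F' :: "real ^ 'n::finite \<Rightarrow> complex" and i :: 'n
  assumes R: "R > 1"
    and deriv: "\<And>\<xi>. \<xi> \<noteq> 0 \<Longrightarrow> ((\<lambda>t. F (\<xi> + t *\<^sub>R axis i 1)) has_vector_derivative F' \<xi>) (at 0)"
    and cont: "continuous_on (-{0}) F'"
    and zero: "\<And>\<xi>. norm \<xi> = R \<Longrightarrow> F \<xi> = 0"
  shows "(LINT \<xi>:shell 1 R|lborel. F' \<xi>) =
    - (LINT y:{y. (\<Sum>j\<in>-{i}. (y j)\<^sup>2) < 1}|(\<Pi>\<^sub>M j\<in>-{i}. lborel).
        (let r = sqrt (1 - (\<Sum>j\<in>-{i}. (y j)\<^sup>2)); pt = (\<lambda>t. \<chi> j. if j = i then t else y j)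
         in F (pt r) - F (pt (- r))))"
proof -
  define pt where "pt y t = (\<chi> j. if j = i then t else y j)" for y :: "'n \<Rightarrow> real" and t
  define c where "c y = (\<Sum>j\<in>-{i}. (y j)\<^sup>2)" for y :: "'n \<Rightarrow> real"
  have norm_pt: "(norm (pt y t))\<^sup>2 = t\<^sup>2 + c y" for y t
    unfolding pt_def c_def by (rule power2_norm_vec_update)
  have ptc: "continuous_on A (pt y)" for A y
    unfolding pt_def
  proof (rule continuous_on_vec_lambda)
    show "continuous_on A (\<lambda>t. if j = i then t else y j)" for j
      by (cases "j = i") (auto intro: continuous_intros)
  qed
  have shell_iff: "pt y t \<in> shell 1 R \<longleftrightarrow> 1 - c y \<le> t\<^sup>2 \<and> t\<^sup>2 \<le> R\<^sup>2 - c y" for y t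
  proof -
    have "1 \<le> norm (pt y t) \<longleftrightarrow> 1\<^sup>2 \<le> (norm (pt y t))\<^sup>2"
      by (rule power_mono_iff[symmetric]) auto
    moreover have "norm (pt y t) \<le> R \<longleftrightarrow> (norm (pt y t))\<^sup>2 \<le> R\<^sup>2"
      using R by (intro power_mono_iff[symmetric]) auto
    ultimately show ?thesis by (auto simp: norm_pt)
  qed
  have ne: "pt y t \<noteq> 0" if "t\<^sup>2 + c y > 0" for y t
    using that norm_pt[of y t] by auto
  have ftc: "(LINT t|lborel. indicator {a..b} t *\<^sub>R F' (pt y t)) = F (pt y b) - F (pt y a)"
    if "a \<le> b" and pos: "\<And>t. t \<in> {a..b} \<Longrightarrow> t\<^sup>2 + c y > 0" for a b y
  proof (rule integral_FTC_atLeastAtMost[OF \<open>a \<le> b\<close>])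
    show "continuous_on {a..b} (\<lambda>t. F' (pt y t))"
      by (rule continuous_on_compose2[OF cont ptc]) (use ne pos in auto)
    fix t assume t: "a \<le> t" "t \<le> b"
    have eq: "pt y (t + s) = pt y t + s *\<^sub>R axis i 1" for s
      by (auto simp: pt_def vec_eq_iff axis_def)
    have "((\<lambda>s. F (pt y (t + s))) has_vector_derivative F' (pt y t)) (at 0)"
      unfolding eq by (rule deriv) (use ne pos t in auto)
    then have "((\<lambda>s. F (pt y (t + s))) \<circ> (\<lambda>s. s - t) has_vector_derivative 1 *\<^sub>R F' (pt y t)) (at t)"
      by (intro vector_diff_chain_at) (auto intro!: derivative_eq_intros)
    then have "((\<lambda>s. F (pt y s)) has_vector_derivative F' (pt y t)) (at t)"
      by (simp add: comp_def)
    then show "((\<lambda>s. F (pt y s)) has_vector_derivative F' (pt y t)) (at t within {a..b})"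
      by (rule has_vector_derivative_at_within)
  qed
  have slice: "(LINT t|lborel. indicator (shell 1 R) (pt y t) *\<^sub>R F' (pt y t)) =
     - (indicator {y. c y < 1} y *\<^sub>R (F (pt y (sqrt (1 - c y))) - F (pt y (- sqrt (1 - c y)))))" for y
  proof -
    define b where "b = sqrt (R\<^sup>2 - c y)"
    have c0: "c y \<ge> 0" unfolding c_def by (intro sum_nonneg) auto
    have R2: "R\<^sup>2 > 1" using R by (simp add: power2_eq_square less_1_mult)
    have edge: "F (pt y b) = 0" "F (pt y (- b)) = 0" if "c y \<le> R\<^sup>2"
    proof -
      have "(norm (pt y b))\<^sup>2 = R\<^sup>2" "(norm (pt y (-b)))\<^sup>2 = R\<^sup>2"
        using that by (auto simp: norm_pt b_def)
      then show "F (pt y b) = 0" "F (pt y (- b)) = 0"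
        using R by (auto intro!: zero simp: power2_eq_iff_nonneg)
    qed
    have upper: "t\<^sup>2 \<le> R\<^sup>2 - c y \<longleftrightarrow> \<bar>t\<bar> \<le> b" if "c y \<le> R\<^sup>2" for t
      unfolding b_def using that by (metis abs_le_square_iff abs_of_nonneg diff_ge_0_iff_ge real_sqrt_ge_zero real_sqrt_pow2)
    \<comment> \<open>\<open>c y\<close> is the squared distance of the line from the origin: the
      line meets the shell in two segments, in one segment with both ends on the outer sphere, or
      not at all.\<close>
    consider "c y < 1" | "1 \<le> c y" "c y \<le> R\<^sup>2" | "c y > R\<^sup>2" by linarith
    then show ?thesis
    proof cases
      case 1
      define a where "a = sqrt (1 - c y)"
      have a: "a > 0" "a < b" using 1 R2 by (auto simp: a_def b_def)
      have lower: "1 - c y \<le> t\<^sup>2 \<longleftrightarrow> a \<le> \<bar>t\<bar>" for t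
        unfolding a_def using 1 by (metis abs_le_square_iff abs_of_nonneg diff_ge_0_iff_ge less_imp_le real_sqrt_ge_zero real_sqrt_pow2)
      have "indicator (shell 1 R) (pt y t) = (indicator {-b..-a} t + indicator {a..b} t :: real)" for t
        using a 1 R2 by (auto simp: indicator_def shell_iff lower upper simp del: mem_Collect_eq)
      then have "(LINT t|lborel. indicator (shell 1 R) (pt y t) *\<^sub>R F' (pt y t)) =
        (LINT t|lborel. indicator {-b..-a} t *\<^sub>R F' (pt y t) + indicator {a..b} t *\<^sub>R F' (pt y t))"
        by (simp add: scaleR_add_left)
      also have "\<dots> = (LINT t|lborel. indicator {-b..-a} t *\<^sub>R F' (pt y t)) + (LINT t|lborel. indicator {a..b} t *\<^sub>R F' (pt y t))"
      proof (rule Bochner_Integration.integral_add)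
        have "integrable lborel (\<lambda>t. indicator {a'..b'} t *\<^sub>R F' (pt y t))" if "\<And>t. t \<in> {a'..b'} \<Longrightarrow> t\<^sup>2 > 0" for a' b'
        proof -
          have "continuous_on {a'..b'} (\<lambda>t. F' (pt y t))"
            by (rule continuous_on_compose2[OF cont ptc]) (use ne that c0 in \<open>auto simp: add_pos_nonneg\<close>)
          then show ?thesis by (intro borel_integrable_compact) auto
        qed
        then show "integrable lborel (\<lambda>t. indicator {-b..-a} t *\<^sub>R F' (pt y t))"
          "integrable lborel (\<lambda>t. indicator {a..b} t *\<^sub>R F' (pt y t))" using a by force+
      qed
      also have "(LINT t|lborel. indicator {-b..-a} t *\<^sub>R F' (pt y t)) = F (pt y (-a)) - F (pt y (-b))"
        by (rule ftc) (use a c0 in \<open>auto intro!: add_pos_nonneg\<close>)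
      also have "(LINT t|lborel. indicator {a..b} t *\<^sub>R F' (pt y t)) = F (pt y b) - F (pt y a)"
        by (rule ftc) (use a c0 in \<open>auto intro!: add_pos_nonneg\<close>)
      finally show ?thesis using 1 edge R2 by (simp add: a_def)
    next
      case 2
      have "indicator (shell 1 R) (pt y t) = (indicator {-b..b} t :: real)" for t
        using 2 by (auto simp: indicator_def shell_iff upper abs_le_iff simp del: mem_Collect_eq)
          (smt (verit) zero_le_power2)+
      then have "(LINT t|lborel. indicator (shell 1 R) (pt y t) *\<^sub>R F' (pt y t)) = F (pt y b) - F (pt y (-b))"
        using ftc[of "-b" b y] 2 c0 by (simp add: b_def add_nonneg_pos)
      then show ?thesis using 2 edge by simp
    next
      case 3
      have "indicator (shell 1 R) (pt y t) = (0 :: real)" for t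
        using 3 by (auto simp: indicator_def shell_iff simp del: mem_Collect_eq) (smt (verit) zero_le_power2)
      then show ?thesis using 3 R2 by simp
    qed
  qed
  have "(LINT \<xi>:shell 1 R|lborel. F' \<xi>) =
      (LINT y|(\<Pi>\<^sub>M j\<in>-{i}. lborel). LINT t|lborel. indicator (shell 1 R) (pt y t) *\<^sub>R F' (pt y t))"
    unfolding set_lebesgue_integral_def pt_def
    by (rule lborel_integral_split_coordinate)
       (rule borel_integrable_compact[OF compact_shell continuous_on_subset[OF cont]], auto)
  also have "\<dots> = - (LINT y:{y. c y < 1}|(\<Pi>\<^sub>M j\<in>-{i}. lborel).
      F (pt y (sqrt (1 - c y))) - F (pt y (- sqrt (1 - c y))))"
    unfolding slice set_lebesgue_integral_def by simp
  finally show ?thesis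
    by (simp add: Let_def c_def pt_def)
qed

text \<open>
  Euler's relation turns the radial equation \<open>(n + d) G + r G' = g\<close> into \<open>div (\<xi> h(\<xi>) G(|\<xi>|)) = h(\<xi>) g(|\<xi>|)\<close>.
  Since \<open>G(R) = 0\<close>, only the unit sphere contributes to the boundary terms.
\<close>

lemma integral_shell_homogeneous:
  fixes h :: "real ^ 'n::finite \<Rightarrow> complex" and G G' :: "real \<Rightarrow> complex"
  assumes R: "R > 1"
    and hom: "\<And>\<xi> t. t > 0 \<Longrightarrow> \<xi> \<noteq> 0 \<Longrightarrow> h (t *\<^sub>R \<xi>) = of_real t powr d * h \<xi>"
    and h': "\<And>\<xi>. \<xi> \<noteq> 0 \<Longrightarrow> (h has_derivative h' \<xi>) (at \<xi>)"
    and h'_cont: "\<And>i. continuous_on (-{0}) (\<lambda>\<xi>. h' \<xi> (axis i 1))"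
    and G: "\<And>r. r > 0 \<Longrightarrow> (G has_vector_derivative G' r) (at r)"
    and G'_cont: "continuous_on {0<..} G'"
    and GR: "G R = 0"
  shows "(LINT \<xi>:shell 1 R|lborel. h \<xi> * ((of_nat CARD('n) + d) * G (norm \<xi>) + of_real (norm \<xi>) * G' (norm \<xi>)))
    = - (G 1 * sphere_integral h)"
proof -
  \<comment> \<open>\<open>F i\<close> is the i-th component of the vector field \<xi> h(\<xi>)
    G(|\<xi>|), and \<open>F' i\<close> its derivative in the i-th direction.\<close>
  define F where "F i \<xi> = of_real (\<xi> $ i) * h \<xi> * G (norm \<xi>)" for i :: 'n and \<xi>
  define F' where "F' i \<xi> = h \<xi> * G (norm \<xi>) + of_real (\<xi> $ i) * h' \<xi> (axis i 1) * G (norm \<xi>)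
      + of_real (\<xi> $ i) * h \<xi> * (of_real (\<xi> $ i / norm \<xi>) * G' (norm \<xi>))" for i :: 'n and \<xi>
  have h_cont: "continuous_on (-{0}) h"
    by (intro continuous_at_imp_continuous_on ballI has_derivative_continuous[OF h']) auto
  have G_cont: "continuous_on {0<..} G"
    by (intro continuous_at_imp_continuous_on ballI has_vector_derivative_continuous[OF G]) auto
  have norm_cont: "continuous_on (-{0}) (\<lambda>\<xi>::real^'n. G (norm \<xi>))" "continuous_on (-{0}) (\<lambda>\<xi>::real^'n. G' (norm \<xi>))"
    by (intro continuous_on_compose2[OF G_cont] continuous_on_compose2[OF G'_cont] continuous_on_norm continuous_on_id; auto)+
  have F'_cont: "continuous_on (-{0}) (F' i)" for i
    unfolding F'_def by (intro continuous_intros norm_cont h_cont h'_cont) auto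
  have F_deriv: "((\<lambda>t. F i (\<xi> + t *\<^sub>R axis i 1)) has_vector_derivative F' i \<xi>) (at 0)" if \<xi>: "\<xi> \<noteq> 0" for i \<xi>
  proof -
    have line: "((\<lambda>t::real. \<xi> + t *\<^sub>R axis i 1) has_derivative (\<lambda>t. t *\<^sub>R axis i 1)) (at 0)"
      by (auto intro!: derivative_eq_intros)
    have 1: "((\<lambda>t. h (\<xi> + t *\<^sub>R axis i 1)) has_vector_derivative h' \<xi> (axis i 1)) (at 0)"
    proof -
      have "((\<lambda>t. h (\<xi> + t *\<^sub>R axis i 1)) has_derivative (\<lambda>t. h' \<xi> (t *\<^sub>R axis i 1))) (at 0)"
        by (rule has_derivative_compose[OF line]) (use h'[OF \<xi>] in simp)
      moreover have "linear (h' \<xi>)" using h'[OF \<xi>] has_derivative_linear by blast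
      ultimately show ?thesis by (simp add: has_vector_derivative_def linear_cmul)
    qed
    have 2: "((\<lambda>t. norm (\<xi> + t *\<^sub>R axis i 1)) has_vector_derivative \<xi> $ i / norm \<xi>) (at 0)"
    proof -
      have "((\<lambda>t. norm (\<xi> + t *\<^sub>R axis i 1)) has_derivative (\<lambda>t. (t *\<^sub>R axis i 1) \<bullet> sgn \<xi>)) (at 0)"
        by (rule has_derivative_compose[OF line]) (use has_derivative_norm[OF \<xi>] in simp)
      then show ?thesis
        by (simp add: has_vector_derivative_def inner_axis' sgn_div_norm field_simps)
    qed
    have "((\<lambda>t. G (norm (\<xi> + t *\<^sub>R axis i 1))) has_vector_derivative (\<xi> $ i / norm \<xi>) *\<^sub>R G' (norm \<xi>)) (at 0)"
      using vector_diff_chain_at[OF 2, of G "G' (norm \<xi>)"] G[of "norm \<xi>"] \<xi> by (simp add: comp_def)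
    moreover have "((\<lambda>t. of_real (\<xi> $ i + t) :: complex) has_vector_derivative of_real 1) (at 0)"
      by (intro has_vector_derivative_of_real) (auto intro!: derivative_eq_intros)
    ultimately have "((\<lambda>t. of_real (\<xi> $ i + t) * h (\<xi> + t *\<^sub>R axis i 1) * G (norm (\<xi> + t *\<^sub>R axis i 1)))
      has_vector_derivative F' i \<xi>) (at 0)"
      using 1 by (auto intro!: derivative_eq_intros simp: F'_def scaleR_conv_of_real algebra_simps)
    moreover have "(\<xi> + t *\<^sub>R axis i 1) $ i = \<xi> $ i + t" for t by (simp add: axis_def)
    ultimately show ?thesis by (simp add: F_def)
  qed
  \<comment> \<open>Both sides are the derivative of t -> h(t \<xi>) at t = 1, once by the chain
    rule and once by homogeneity.\<close>
  have euler: "h' \<xi> \<xi> = d * h \<xi>" if \<xi>: "\<xi> \<noteq> 0" for \<xi>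
  proof -
    have "((\<lambda>t::real. h (t *\<^sub>R \<xi>)) has_derivative (\<lambda>t. h' \<xi> (t *\<^sub>R \<xi>))) (at 1)"
      by (rule has_derivative_compose[where f = "\<lambda>t. t *\<^sub>R \<xi>"])
         (use h'[OF \<xi>] in \<open>auto intro!: derivative_eq_intros\<close>)
    moreover have "linear (h' \<xi>)" using h'[OF \<xi>] has_derivative_linear by blast
    ultimately have "((\<lambda>t::real. h (t *\<^sub>R \<xi>)) has_vector_derivative h' \<xi> \<xi>) (at 1)"
      by (simp add: has_vector_derivative_def linear_cmul)
    moreover have "((\<lambda>t::real. h (t *\<^sub>R \<xi>)) has_vector_derivative d * h \<xi>) (at 1)"
    proof (rule has_vector_derivative_transform_within_open[of _ _ _ "{0<..}"])
      have "((\<lambda>w. w powr d * h \<xi>) has_field_derivative d * h \<xi>) (at (of_real 1))"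
        by (auto intro!: derivative_eq_intros)
      then show "((\<lambda>t::real. of_real t powr d * h \<xi>) has_vector_derivative d * h \<xi>) (at 1)"
        by (rule has_vector_derivative_real_field)
    qed (use hom \<xi> in auto)
    ultimately show ?thesis by (rule vector_derivative_unique_at)
  qed
  \<comment> \<open>The factor n comes from differentiating \<xi>_i, the d from Euler's relation,
    and the sum of the \<xi>_i^2 / |\<xi>|, which is |\<xi>|, yields the radial derivative.\<close>
  have divergence: "(\<Sum>i\<in>UNIV. F' i \<xi>) =
      h \<xi> * ((of_nat CARD('n) + d) * G (norm \<xi>) + of_real (norm \<xi>) * G' (norm \<xi>))" if \<xi>: "\<xi> \<noteq> 0" for \<xi>
  proof -
    have lin: "linear (h' \<xi>)" using h'[OF \<xi>] has_derivative_linear by blast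
    have "(\<Sum>i\<in>UNIV. \<xi> $ i *\<^sub>R axis i 1) = \<xi>"
      using basis_expansion[of \<xi>] by (simp add: scalar_mult_eq_scaleR)
    then have "h' \<xi> \<xi> = h' \<xi> (\<Sum>i\<in>UNIV. \<xi> $ i *\<^sub>R axis i 1)"
      by (rule arg_cong[OF sym])
    also have "\<dots> = (\<Sum>i\<in>UNIV. \<xi> $ i *\<^sub>R h' \<xi> (axis i 1))"
      by (simp add: linear_sum[OF lin] linear_cmul[OF lin])
    also have "\<dots> = (\<Sum>i\<in>UNIV. of_real (\<xi> $ i) * h' \<xi> (axis i 1))"
      by (simp add: scaleR_conv_of_real)
    finally have a: "(\<Sum>i\<in>UNIV. of_real (\<xi> $ i) * h' \<xi> (axis i 1)) = d * h \<xi>"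
      using euler[OF \<xi>] by simp
    have "(\<Sum>i\<in>UNIV. \<xi> $ i * \<xi> $ i) = norm \<xi> * norm \<xi>"
      using power2_norm_eq_inner[of \<xi>] by (simp add: inner_vec_def power2_eq_square)
    then have "(\<Sum>i\<in>UNIV. of_real (\<xi> $ i * \<xi> $ i)) = (of_real (norm \<xi> * norm \<xi>) :: complex)"
      by (metis of_real_sum)
    then have b: "(\<Sum>i\<in>UNIV. of_real (\<xi> $ i) * of_real (\<xi> $ i / norm \<xi>)) = (of_real (norm \<xi>) :: complex)"
      using \<xi> by (simp add: sum_divide_distrib[symmetric])
    have "(\<Sum>i\<in>UNIV. F' i \<xi>) = of_nat CARD('n) * (h \<xi> * G (norm \<xi>))
       + (\<Sum>i\<in>UNIV. of_real (\<xi> $ i) * h' \<xi> (axis i 1)) * G (norm \<xi>)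
       + (\<Sum>i\<in>UNIV. of_real (\<xi> $ i) * of_real (\<xi> $ i / norm \<xi>)) * (h \<xi> * G' (norm \<xi>))"
      unfolding F'_def sum.distrib sum_distrib_right by (simp add: mult_ac)
    then show ?thesis unfolding a b by (simp add: algebra_simps)
  qed
  have F'_int: "set_integrable lborel (shell 1 R) (F' i)" for i
    unfolding set_integrable_def
    by (rule borel_integrable_compact[OF compact_shell continuous_on_subset[OF F'_cont]]) auto
  have "(LINT \<xi>:shell 1 R|lborel. h \<xi> * ((of_nat CARD('n) + d) * G (norm \<xi>) + of_real (norm \<xi>) * G' (norm \<xi>)))
      = (LINT \<xi>:shell 1 R|lborel. (\<Sum>i\<in>UNIV. F' i \<xi>))"
  proof (rule set_lebesgue_integral_cong)
    show "shell 1 R \<in> sets lborel"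
      using borel_closed[OF compact_imp_closed[OF compact_shell]] by simp
    show "\<forall>\<xi>. \<xi> \<in> shell 1 R \<longrightarrow> h \<xi> * ((of_nat CARD('n) + d) * G (norm \<xi>) + of_real (norm \<xi>) * G' (norm \<xi>))
      = (\<Sum>i\<in>UNIV. F' i \<xi>)"
      by (intro allI impI divergence[symmetric]) auto
  qed
  also have "\<dots> = (\<Sum>i\<in>UNIV. LINT \<xi>:shell 1 R|lborel. F' i \<xi>)"
    unfolding set_lebesgue_integral_def scaleR_sum_right
    by (rule Bochner_Integration.integral_sum) (use F'_int in \<open>simp add: set_integrable_def\<close>)
  also have "\<dots> = (\<Sum>i\<in>UNIV. - (G 1 * (LINT y:{y. (\<Sum>j\<in>-{i}. (y j)\<^sup>2) < 1}|(\<Pi>\<^sub>M j\<in>-{i}. lborel).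
        (let r = sqrt (1 - (\<Sum>j\<in>-{i}. (y j)\<^sup>2));
             pt = (\<lambda>t. \<chi> j. if j = i then t else y j)
         in h (pt r) * of_real r - h (pt (- r)) * of_real (- r)))))"
  proof (intro sum.cong refl)
    fix i :: 'n
    have norm_1: "norm (\<chi> j. if j = i then t else y j) = 1"
      if "t\<^sup>2 = 1 - (\<Sum>j\<in>-{i}. (y j)\<^sup>2)" for t :: real and y :: "'n \<Rightarrow> real"
    proof -
      have "(norm (\<chi> j. if j = i then t else y j))\<^sup>2 = 1\<^sup>2"
        using that by (simp only: power2_norm_vec_update) simp
      then show ?thesis by (rule power2_eq_imp_eq) auto
    qed
    have "(LINT \<xi>:shell 1 R|lborel. F' i \<xi>) = - (LINT y:{y. (\<Sum>j\<in>-{i}. (y j)\<^sup>2) < 1}|(\<Pi>\<^sub>M j\<in>-{i}. lborel).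
        (let r = sqrt (1 - (\<Sum>j\<in>-{i}. (y j)\<^sup>2));
             pt = (\<lambda>t. \<chi> j. if j = i then t else y j)
         in F i (pt r) - F i (pt (- r))))"
      by (rule integral_divergence_shell[OF R F_deriv F'_cont]) (simp_all add: F_def GR)
    also have "(LINT y:{y. (\<Sum>j\<in>-{i}. (y j)\<^sup>2) < 1}|(\<Pi>\<^sub>M j\<in>-{i}. lborel).
        (let r = sqrt (1 - (\<Sum>j\<in>-{i}. (y j)\<^sup>2));
             pt = (\<lambda>t. \<chi> j. if j = i then t else y j)
         in F i (pt r) - F i (pt (- r)))) =
      (LINT y:{y. (\<Sum>j\<in>-{i}. (y j)\<^sup>2) < 1}|(\<Pi>\<^sub>M j\<in>-{i}. lborel).
        G 1 * (let r = sqrt (1 - (\<Sum>j\<in>-{i}. (y j)\<^sup>2));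
             pt = (\<lambda>t. \<chi> j. if j = i then t else y j)
         in h (pt r) * of_real r - h (pt (- r)) * of_real (- r)))"
      unfolding set_lebesgue_integral_def
      by (intro Bochner_Integration.integral_cong refl) (auto simp: indicator_def Let_def F_def norm_1 algebra_simps)
    also have "\<dots> = G 1 * (LINT y:{y. (\<Sum>j\<in>-{i}. (y j)\<^sup>2) < 1}|(\<Pi>\<^sub>M j\<in>-{i}. lborel).
        (let r = sqrt (1 - (\<Sum>j\<in>-{i}. (y j)\<^sup>2));
             pt = (\<lambda>t. \<chi> j. if j = i then t else y j)
         in h (pt r) * of_real r - h (pt (- r)) * of_real (- r)))"
      by (rule set_integral_mult_right)
    finally show "(LINT \<xi>:shell 1 R|lborel. F' i \<xi>) = - (G 1 * (LINT y:{y. (\<Sum>j\<in>-{i}. (y j)\<^sup>2) < 1}|(\<Pi>\<^sub>M j\<in>-{i}. lborel).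
        (let r = sqrt (1 - (\<Sum>j\<in>-{i}. (y j)\<^sup>2));
             pt = (\<lambda>t. \<chi> j. if j = i then t else y j)
         in h (pt r) * of_real r - h (pt (- r)) * of_real (- r))))" .
  qed
  also have "\<dots> = - (G 1 * sphere_integral h)"
    by (simp add: sphere_integral_def sum_negf sum_distrib_left)
  finally show ?thesis .
qed

lemma smooth_on_imp_continuous_on: "smooth_on S f \<Longrightarrow> continuous_on S f"
  unfolding smooth_on_def
  by (metis continuous_at_imp_continuous_on differentiable_imp_continuous_within iter_deriv.simps(1) lists.Nil)

lemma has_vector_derivative_of_real_powr:
  fixes e :: complex
  assumes "r > 0"
  shows "((\<lambda>r. of_real r powr e) has_vector_derivative e * of_real r powr e / of_real r) (at r)"
proof -
  have "((\<lambda>w. w powr e) has_field_derivative e * of_real r powr (e - 1)) (at (of_real r))"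
    using assms by (auto intro!: derivative_eq_intros simp: complex_nonpos_Reals_iff)
  from has_vector_derivative_real_field[OF this] show ?thesis
    using assms by (simp add: powr_diff)
qed

lemma sets_shell [measurable]: "shell a b \<in> sets borel"
  using borel_closed[OF compact_imp_closed[OF compact_shell]] .

context
  fixes U :: "(real ^ 'n::finite) set" and d :: complex and s :: "'n symb" and x :: "real ^ 'n"
  assumes hom: "pos_homogeneous U d s" and x: "x \<in> U"
begin

text \<open>To integrate \<open>s\<close> against a radial weight \<open>g\<close>, one solves the
  linear radial equation with end condition G(R) = 0 and reads the answer off G(1).\<close>

lemma integral_shell_pos_homogeneous:
  fixes G G' :: "real \<Rightarrow> complex"
  assumes "R > 1"
    and "\<And>r. r > 0 \<Longrightarrow> (G has_vector_derivative G' r) (at r)"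
    and "continuous_on {0<..} G'"
    and "G R = 0"
    and g: "\<And>r. r > 0 \<Longrightarrow> (of_nat CARD('n) + d) * G r + of_real r * G' r = g r"
  shows "(LINT \<xi>:shell 1 R|lborel. s (x, \<xi>) * g (norm \<xi>)) = - (G 1 * sphere_integral (\<lambda>\<xi>. s (x, \<xi>)))"
proof -
  have smooth: "smooth_on (U \<times> (-{0})) s" using hom by (simp add: pos_homogeneous_def)
  have 1: "(s has_derivative frechet_derivative s (at (x, \<xi>))) (at (x, \<xi>))" if "\<xi> \<noteq> 0" for \<xi>
    using smooth x that unfolding smooth_on_def
    by (metis (no_types, lifting) ComplI SigmaI frechet_derivative_works iter_deriv.simps(1) lists.Nil singletonD)
  have "(LINT \<xi>:shell 1 R|lborel. s (x, \<xi>) *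
      ((of_nat CARD('n) + d) * G (norm \<xi>) + of_real (norm \<xi>) * G' (norm \<xi>))) = - (G 1 * sphere_integral (\<lambda>\<xi>. s (x, \<xi>)))"
  proof (rule integral_shell_homogeneous[where h' = "\<lambda>\<xi> v. frechet_derivative s (at (x, \<xi>)) (0, v)"])
    show "((\<lambda>\<xi>. s (x, \<xi>)) has_derivative (\<lambda>v. frechet_derivative s (at (x, \<xi>)) (0, v))) (at \<xi>)"
      if "\<xi> \<noteq> 0" for \<xi>
      by (rule has_derivative_compose[where f = "\<lambda>\<xi>. (x, \<xi>)", OF _ 1[OF that]])
         (auto intro!: derivative_eq_intros)
    show "continuous_on (- {0}) (\<lambda>\<xi>. frechet_derivative s (at (x, \<xi>)) (0, axis i 1))" for i
    proof (rule continuous_on_compose2[of "U \<times> (-{0})" "\<lambda>p. frechet_derivative s (at p) (0, axis i 1)"])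
      have "[(0, axis i 1)] \<in> lists (Basis :: ((real ^ 'n) \<times> (real ^ 'n)) set)"
        by (auto simp: Basis_prod_def Basis_vec_def)
      then have "\<forall>p\<in>U \<times> (-{0}). iter_deriv [(0, axis i 1)] s differentiable (at p)"
        using smooth unfolding smooth_on_def by blast
      then show "continuous_on (U \<times> (-{0})) (\<lambda>p. frechet_derivative s (at p) (0, axis i 1))"
        by (intro continuous_at_imp_continuous_on) (auto intro: differentiable_imp_continuous_within)
    qed (use x in \<open>auto intro!: continuous_intros\<close>)
  qed (use assms hom x in \<open>auto simp: pos_homogeneous_def\<close>)
  moreover have "(LINT \<xi>:shell 1 R|lborel. s (x, \<xi>) * g (norm \<xi>)) =
     (LINT \<xi>:shell 1 R|lborel. s (x, \<xi>) * ((of_nat CARD('n) + d) * G (norm \<xi>) + of_real (norm \<xi>) * G' (norm \<xi>)))"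
    by (rule set_lebesgue_integral_cong) (auto intro!: g[symmetric])
  ultimately show ?thesis by simp
qed

lemma integral_shell_power:
  assumes "R > 1"
  shows "(LINT \<xi>:shell 1 R|lborel. s (x, \<xi>)) = sphere_integral (\<lambda>\<xi>. s (x, \<xi>)) *
    (if of_nat CARD('n) + d = 0 then of_real (ln R)
     else (of_real R powr (of_nat CARD('n) + d) - 1) / (of_nat CARD('n) + d))"
proof (cases "of_nat CARD('n) + d = 0")
  case True
  have "(LINT \<xi>:shell 1 R|lborel. s (x, \<xi>) * 1) = - (of_real (ln (1 / R)) * sphere_integral (\<lambda>\<xi>. s (x, \<xi>)))"
  \<comment> \<open>For n + d = 0 and g = 1 the equation is r G' = 1; ln (r / R) is the solution
    vanishing at R.\<close>
  proof (rule integral_shell_pos_homogeneous[where G = "\<lambda>r. of_real (ln (r / R))" and G' = "\<lambda>r. of_real (1 / r)"])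
    show "((\<lambda>r. of_real (ln (r / R)) :: complex) has_vector_derivative of_real (1 / r)) (at r)" if "r > 0" for r
      using that assms by (intro has_vector_derivative_of_real) (auto intro!: derivative_eq_intros)
  qed (use assms True in \<open>auto intro!: continuous_intros\<close>)
  then show ?thesis using True assms by (simp add: ln_div)
next
  case False
  define e where "e = of_nat CARD('n) + d"
  have "(LINT \<xi>:shell 1 R|lborel. s (x, \<xi>) * 1) =
    - ((1 - of_real R powr e * of_real 1 powr (-e)) / e * sphere_integral (\<lambda>\<xi>. s (x, \<xi>)))"
  \<comment> \<open>For e \<noteq> 0 the solution of e G + r G' = 1 with G(R) = 0 is (1 - (R / r)^e)
    / e.\<close>
  proof (rule integral_shell_pos_homogeneous[where G = "\<lambda>r. (1 - of_real R powr e * of_real r powr (-e)) / e"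
        and G' = "\<lambda>r. of_real R powr e * of_real r powr (-e) / of_real r"])
    show "((\<lambda>r. (1 - of_real R powr e * of_real r powr (-e)) / e) has_vector_derivative
        of_real R powr e * of_real r powr (-e) / of_real r) (at r)" if "r > 0" for r
      using that False
      by (auto intro!: derivative_eq_intros has_vector_derivative_of_real_powr simp: e_def[symmetric])
    show "continuous_on {0<..} (\<lambda>r. of_real R powr e * of_real r powr (-e) / complex_of_real r)"
      by (intro continuous_intros) (auto simp: complex_nonpos_Reals_iff)
    show "(1 - of_real R powr e * of_real R powr (-e)) / e = 0"
      using assms by (simp add: powr_minus)
    show "(of_nat CARD('n) + d) * ((1 - of_real R powr e * of_real r powr (-e)) / e) +
        of_real r * (of_real R powr e * of_real r powr (-e) / of_real r) = 1"
      if "r > 0" for r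
      using that False by (simp add: e_def[symmetric])
  qed (use assms in auto)
  moreover have "e \<noteq> 0" using False by (simp add: e_def)
  ultimately show ?thesis unfolding e_def[symmetric] by (simp add: field_simps)
qed

text \<open>
  As a volume integral, the sphere integral of a holomorphic family falls under the results on
  parameter integrals.
\<close>

lemma sphere_integral_eq_shell:
  "sphere_integral (\<lambda>\<xi>. s (x, \<xi>)) =
    (LINT \<xi>:shell 1 2|lborel. s (x, \<xi>) * of_real (norm \<xi>) powr (- (of_nat CARD('n) + d))) / of_real (ln 2)"
proof -
  define e where "e = - (of_nat CARD('n) + d)"
  have "(LINT \<xi>:shell 1 2|lborel. s (x, \<xi>) * of_real (norm \<xi>) powr e) =
    - (of_real 1 powr e * of_real (ln (1 / 2)) * sphere_integral (\<lambda>\<xi>. s (x, \<xi>)))"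
  \<comment> \<open>The weight makes the integrand homogeneous of degree -n, so a logarithm appears
    for every d and no case distinction is left. The radii 1 and 2 contribute only the factor ln
    2.\<close>
  proof (rule integral_shell_pos_homogeneous[where G = "\<lambda>r. of_real r powr e * of_real (ln (r / 2))"
        and G' = "\<lambda>r. e * of_real r powr e * of_real (ln (r / 2)) / of_real r + of_real r powr e / of_real r"])
    fix r :: real assume r: "r > 0"
    note 1 = has_vector_derivative_of_real_powr[OF r, of e]
    have 2: "((\<lambda>r. of_real (ln (r / 2)) :: complex) has_vector_derivative of_real (1 / r)) (at r)"
      using r by (intro has_vector_derivative_of_real) (auto intro!: derivative_eq_intros)
    show "((\<lambda>r. of_real r powr e * of_real (ln (r / 2))) has_vector_derivative
       (e * of_real r powr e * of_real (ln (r / 2)) / of_real r + of_real r powr e / of_real r)) (at r)"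
      using has_vector_derivative_mult[OF 1 2] by (simp add: algebra_simps)
    show "(of_nat CARD('n) + d) * (of_real r powr e * of_real (ln (r / 2))) +
        of_real r * (e * of_real r powr e * of_real (ln (r / 2)) / of_real r + of_real r powr e / of_real r) = of_real r powr e"
    proof -
      have "of_nat CARD('n) + d = - e" by (simp add: e_def)
      then show ?thesis using r by (simp add: field_simps)
    qed
  next
    show "continuous_on {0<..} (\<lambda>r. e * of_real r powr e * of_real (ln (r / 2)) / of_real r + of_real r powr e / of_real r)"
      by (intro continuous_intros) (auto simp: complex_nonpos_Reals_iff)
  qed auto
  then show ?thesis unfolding e_def[symmetric] by (simp add: ln_div)
qed

end

subsection \<open>Uniqueness of homogeneous components\<close>

text \<open>Multiplication by t^(-d) turns the component of degree d into a constant along the ray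
  and every other one into a power with nonzero exponent; \<open>N\<close> is large enough for the
  remainder to decay. Constant terms thus isolate single components.\<close>

lemma classical_expansion_ray:
  fixes U :: "(real ^ 'n::finite) set"
  assumes exp: "classical_expansion \<psi> U m \<sigma> s" and \<psi>: "cutoff_function U \<psi>"
    and x: "x \<in> U" and \<xi>: "\<xi> \<noteq> 0" and N: "N \<ge> 1" "Re m - real N - 1 < Re d"
  shows "has_constant_term (\<lambda>t. \<sigma> (x, t *\<^sub>R \<xi>) * of_real t powr (- d))
    (\<Sum>j=0..N. if m - of_nat j = d then s j (x, \<xi>) else 0)"
proof -
  define q where "q = Re m - real N - 1"
  define \<rho> where "\<rho> p = \<sigma> p - (\<Sum>j=0..N. \<psi> p * s j p)" for p
  have "\<rho> \<in> symbols U q"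
    using exp N(1) unfolding classical_expansion_def \<rho>_def[abs_def] q_def by blast
  then have "\<forall>K A B. compact K \<and> K \<subseteq> U \<longrightarrow> (\<exists>C. \<forall>x\<in>K. \<forall>\<xi>.
           norm (symb_deriv A B \<rho> (x, \<xi>)) \<le> C * (1 + norm \<xi>) powr (q - real (length B)))"
    by (simp add: symbols_def)
  from this[rule_format, of "{x}" "[]" "[]"] x obtain C
    where C: "\<And>\<xi>. norm (\<rho> (x, \<xi>)) \<le> C * (1 + norm \<xi>) powr q"
    by (auto simp: symb_deriv_def)
  have hom: "s j (x, t *\<^sub>R \<xi>) = of_real t powr (m - of_nat j) * s j (x, \<xi>)" if "t > 0" for j t
    using exp x \<xi> that by (auto simp: classical_expansion_def pos_homogeneous_def)
  have decay: "((\<lambda>t. \<rho> (x, t *\<^sub>R \<xi>) * of_real t powr (- d)) \<longlongrightarrow> 0) at_top"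
  proof (rule Lim_null_comparison)
    show "eventually (\<lambda>t. norm (\<rho> (x, t *\<^sub>R \<xi>) * of_real t powr (- d))
        \<le> C * (1 / t + norm \<xi>) powr q * t powr (q - Re d)) at_top"
      using eventually_gt_at_top[of 0]
    proof eventually_elim
      case (elim t)
      have "norm (\<rho> (x, t *\<^sub>R \<xi>) * of_real t powr (- d)) = norm (\<rho> (x, t *\<^sub>R \<xi>)) * t powr (- Re d)"
        using elim by (simp add: norm_mult norm_powr_real_powr)
      also have "\<dots> \<le> C * (1 + t * norm \<xi>) powr q * t powr (- Re d)"
        using C[of "t *\<^sub>R \<xi>"] elim by (intro mult_right_mono) auto
      also have "1 + t * norm \<xi> = t * (1 / t + norm \<xi>)" using elim by (simp add: field_simps)
      also have "(t * (1 / t + norm \<xi>)) powr q = t powr q * (1 / t + norm \<xi>) powr q"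
        by (rule powr_mult)
      finally show ?case by (simp add: powr_diff powr_minus field_simps)
    qed
    have "((\<lambda>t::real. 1 / t) \<longlongrightarrow> 0) at_top"
      by (rule tendsto_divide_0[OF tendsto_const filterlim_at_top_imp_at_infinity[OF filterlim_ident]])
    \<comment> \<open>The base tends to |\<xi>| > 0, so the power converges for negative
      \<open>q\<close> as well.\<close>
    then have a: "((\<lambda>t. (1 / t + norm \<xi>) powr q) \<longlongrightarrow> (0 + norm \<xi>) powr q) at_top"
      by (intro tendsto_powr tendsto_add tendsto_const) (use \<xi> in auto)
    have b: "((\<lambda>t. t powr (q - Re d)) \<longlongrightarrow> 0) at_top"
      using N(2) by (intro tendsto_neg_powr filterlim_ident) (simp add: q_def)
    show "((\<lambda>t. C * (1 / t + norm \<xi>) powr q * t powr (q - Re d)) \<longlongrightarrow> 0) at_top"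
      using tendsto_mult[OF tendsto_mult[OF tendsto_const[of C] a] b] by simp
  qed
  have "has_constant_term (\<lambda>t. \<sigma> (x, t *\<^sub>R \<xi>) * of_real t powr (- d))
    (0 + (\<Sum>j=0..N. if m - of_nat j - d = 0 then s j (x, \<xi>) else 0))"
  proof (rule has_constant_termI[where b = 0])
    show "((\<lambda>t. \<sigma> (x, t *\<^sub>R \<xi>) * of_real t powr (- d) -
        ((\<Sum>j=0..N. s j (x, \<xi>) * of_real t powr (m - of_nat j - d)) + 0 * of_real (ln t) + 0)) \<longlongrightarrow> 0) at_top"
    proof (rule Lim_transform_eventually[OF decay])
      show "eventually (\<lambda>t. \<rho> (x, t *\<^sub>R \<xi>) * of_real t powr (- d) = \<sigma> (x, t *\<^sub>R \<xi>) * of_real t powr (- d) -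
        ((\<Sum>j=0..N. s j (x, \<xi>) * of_real t powr (m - of_nat j - d)) + 0 * of_real (ln t) + 0)) at_top"
        using eventually_gt_at_top[of 0] eventually_ge_at_top[of "1 / norm \<xi>"]
      proof eventually_elim
        case (elim t)
        then have "norm (t *\<^sub>R \<xi>) \<ge> 1" using \<xi> by (simp add: field_simps)
        then have "\<psi> (x, t *\<^sub>R \<xi>) = 1" using \<psi> x by (simp add: cutoff_function_def)
        then have "\<rho> (x, t *\<^sub>R \<xi>) * of_real t powr (- d) = \<sigma> (x, t *\<^sub>R \<xi>) * of_real t powr (- d) -
           (\<Sum>j=0..N. s j (x, t *\<^sub>R \<xi>) * of_real t powr (- d))"
          by (simp add: \<rho>_def left_diff_distrib sum_distrib_right)
        also have "(\<Sum>j=0..N. s j (x, t *\<^sub>R \<xi>) * of_real t powr (- d)) =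
          (\<Sum>j=0..N. s j (x, \<xi>) * of_real t powr (m - of_nat j - d))"
        proof (intro sum.cong refl)
          fix j
          have "of_real t powr (m - of_nat j) * of_real t powr (- d) = of_real t powr (m - of_nat j - d)"
            using powr_add[of "of_real t :: complex" "m - of_nat j" "- d"] by simp
          then show "s j (x, t *\<^sub>R \<xi>) * of_real t powr (- d) = s j (x, \<xi>) * of_real t powr (m - of_nat j - d)"
            using elim by (simp add: hom mult_ac)
        qed
        finally show ?case by simp
      qed
    qed
  qed (auto simp: inj_on_def)
  then show ?thesis by simp
qed

text \<open>The order is not determined by the symbol, as leading components may vanish, so the two
  expansions may have different orders. For a fixed degree their constant terms along rays are
  compared, with one \<open>N\<close> large enough for both.\<close>

lemma classical_expansion_coefficient_unique:
  assumes \<psi>: "cutoff_function U \<psi>" and x: "x \<in> U" and \<xi>: "\<xi> \<noteq> 0"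
    and exp: "classical_expansion \<psi> U m \<sigma> s" "classical_expansion \<psi> U m' \<sigma> s'"
    and j: "m - of_nat j = d"
  shows "s j (x, \<xi>) = 0 \<or> (\<exists>i. m' - of_nat i = d)"
    and "m' - of_nat i = d \<Longrightarrow> s' i (x, \<xi>) = s j (x, \<xi>)"
proof -
  obtain N0 :: nat where N0: "Re m - 1 - Re d < real N0" "Re m' - 1 - Re d < real N0"
    using reals_Archimedean2[of "max (Re m - 1 - Re d) (Re m' - 1 - Re d)"] by auto
  have eq: "(\<Sum>k=0..N. if m - of_nat k = d then s k (x, \<xi>) else 0) =
      (\<Sum>k=0..N. if m' - of_nat k = d then s' k (x, \<xi>) else 0)" if "N \<ge> Suc N0" for N
    by (rule has_constant_term_unique[OF classical_expansion_ray[OF exp(1) \<psi> x \<xi>] classical_expansion_ray[OF exp(2) \<psi> x \<xi>]])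
       (use that N0 in auto)
  have single: "(\<Sum>k=0..N. if m - of_nat k = d then s k (x, \<xi>) else 0) = s j (x, \<xi>)"
    if "m - of_nat j = d" "j \<le> N" for m :: complex and s :: "nat \<Rightarrow> _" and j N
  proof -
    have "m - of_nat k = d \<longleftrightarrow> k = j" for k using that(1) by auto
    then show ?thesis using that(2) by simp
  qed
  show "s' i (x, \<xi>) = s j (x, \<xi>)" if "m' - of_nat i = d"
  proof -
    define N where "N = Suc N0 + i + j"
    then have N: "N \<ge> Suc N0" "i \<le> N" "j \<le> N" by auto
    show ?thesis
      using eq[OF N(1)] unfolding single[OF j N(3)] single[OF that N(2)] by (rule sym)
  qed
  show "s j (x, \<xi>) = 0 \<or> (\<exists>i. m' - of_nat i = d)"
  proof (rule disjCI)
    assume none: "\<not> (\<exists>i. m' - of_nat i = d)"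
    define N where "N = Suc N0 + j"
    then have N: "N \<ge> Suc N0" "j \<le> N" by auto
    have "s j (x, \<xi>) = (\<Sum>k=0..N. if m' - of_nat k = d then s' k (x, \<xi>) else 0)"
      using eq[OF N(1)] unfolding single[OF j N(2)] .
    also have "\<dots> = 0" using none by simp
    finally show "s j (x, \<xi>) = 0" .
  qed
qed

lemma hom_component_eq:
  assumes \<psi>: "cutoff_function U \<psi>" and x: "x \<in> U" and \<xi>: "\<xi> \<noteq> 0"
    and exp: "classical_expansion \<psi> U m \<sigma> s" and j: "m - of_nat j = d"
  shows "hom_component \<psi> U \<sigma> d (x, \<xi>) = s j (x, \<xi>)"
proof -
  have "(THE c. \<exists>m s j. classical_expansion \<psi> U m \<sigma> s \<and> m - of_nat j = d \<and> c = s j (x, \<xi>)) = s j (x, \<xi>)"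
    by (rule the_equality)
       (use exp j classical_expansion_coefficient_unique(2)[OF \<psi> x \<xi> exp _ j] in blast)+
  then show ?thesis unfolding hom_component_def using exp j by auto
qed

text \<open>\<open>hom_component\<close> ranges over all expansions, and one of another order may
  contain degree \<open>d\<close> although the given one does not; its component of that degree is
  then 0.\<close>

lemma hom_component_eq_0:
  assumes \<psi>: "cutoff_function U \<psi>" and x: "x \<in> U" and \<xi>: "\<xi> \<noteq> 0"
    and exp: "classical_expansion \<psi> U m \<sigma> s" and "\<And>j. m - of_nat j \<noteq> d"
  shows "hom_component \<psi> U \<sigma> d (x, \<xi>) = 0"
proof (cases "\<exists>m' s' i. classical_expansion \<psi> U m' \<sigma> s' \<and> m' - of_nat i = d")
  case True
  then obtain m' s' i where *: "classical_expansion \<psi> U m' \<sigma> s'" "m' - of_nat i = d" by blast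
  then have "s' i (x, \<xi>) = 0"
    using classical_expansion_coefficient_unique(1)[OF \<psi> x \<xi> *(1) exp *(2)] assms(5) by blast
  then show ?thesis using hom_component_eq[OF \<psi> x \<xi> *] by simp
next
  case False
  then show ?thesis by (auto simp: hom_component_def)
qed

text \<open>In both charts the i-th coordinate is plus or minus a positive r, so the origin, where
  homogeneous functions carry arbitrary values, does not enter.\<close>

lemma sphere_integral_cong:
  fixes f g :: "real ^ 'n::finite \<Rightarrow> complex"
  assumes "\<And>\<xi>. \<xi> \<noteq> 0 \<Longrightarrow> f \<xi> = g \<xi>"
  shows "sphere_integral f = sphere_integral g"
proof -
  have "f (\<chi> j. if j = i then t else y j) = g (\<chi> j. if j = i then t else y j)" if "t \<noteq> 0"
    for i :: 'n and t :: real and y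
    using that by (intro assms) (auto simp: vec_eq_iff)
  then show ?thesis
    unfolding sphere_integral_def set_lebesgue_integral_def Let_def
    by (intro sum.cong Bochner_Integration.integral_cong refl) (auto simp: indicator_def)
qed

subsection \<open>Cut-off integrals\<close>

text \<open>Multiplying 1 + \<xi>_i^2 \<le> (1 + |\<xi>|)^2 over the n coordinates bounds the
  function by a product of one-variable functions 1 / (1 + t^2). This accounts for the exponent
  -2n.\<close>

lemma integrable_decay:
  "integrable lborel (\<lambda>\<xi> :: real ^ 'n::finite. (1 + norm \<xi>) powr (- 2 * real CARD('n)))"
proof -
  have 1: "integrable lborel (\<lambda>t::real. inverse (1 + t\<^sup>2))"
    using integrable_inverse_1_plus_square by (simp add: set_integrable_def)
  have "integrable (\<Pi>\<^sub>M i\<in>(UNIV :: 'n set). lborel :: real measure) (\<lambda>y. \<Prod>i\<in>UNIV. inverse (1 + (y i)\<^sup>2))"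
    using 1 by (intro lborel_product.product_integrable_prod[where f = "\<lambda>(_ :: 'n) t. inverse (1 + t\<^sup>2)"]) auto
  then have int: "integrable lborel (\<lambda>\<xi> :: real ^ 'n. \<Prod>i\<in>UNIV. inverse (1 + (\<xi> $ i)\<^sup>2))"
    by (subst lborel_vec, subst integrable_distr_eq[OF measurable_vec_lambda]) simp_all
  show ?thesis
  proof (rule Bochner_Integration.integrable_bound[OF int])
    show "AE \<xi> :: real ^ 'n in lborel. norm ((1 + norm \<xi>) powr (- 2 * real CARD('n)))
        \<le> norm (\<Prod>i\<in>UNIV. inverse (1 + (\<xi> $ i)\<^sup>2))"
    proof (rule AE_I2)
      fix \<xi> :: "real ^ 'n"
      have "(\<Prod>i\<in>(UNIV::'n set). inverse ((1 + norm \<xi>)\<^sup>2)) \<le> (\<Prod>i\<in>UNIV. inverse (1 + (\<xi> $ i)\<^sup>2))"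
      proof (intro prod_mono conjI le_imp_inverse_le)
        fix i :: 'n
        have "(\<xi> $ i)\<^sup>2 \<le> (norm \<xi>)\<^sup>2"
          using component_le_norm_cart[of \<xi> i] by (simp add: abs_le_square_iff[symmetric])
        then show "1 + (\<xi> $ i)\<^sup>2 \<le> (1 + norm \<xi>)\<^sup>2"
          by (simp add: power2_sum add_increasing2)
      qed (auto simp: add_pos_nonneg)
      moreover have "(1 + norm \<xi>) powr (- 2 * real CARD('n)) = (\<Prod>i\<in>(UNIV::'n set). inverse ((1 + norm \<xi>)\<^sup>2))"
      proof -
        have "(1 + norm \<xi>) powr (- 2 * real CARD('n)) = inverse ((1 + norm \<xi>) powr real (2 * CARD('n)))"
          by (simp add: powr_minus[symmetric])
        also have "(1 + norm \<xi>) powr real (2 * CARD('n)) = (1 + norm \<xi>) ^ (2 * CARD('n))"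
          by (rule powr_realpow) (simp add: add_pos_nonneg)
        finally show ?thesis by (simp add: power_mult power_inverse)
      qed
      ultimately show "norm ((1 + norm \<xi>) powr (- 2 * real CARD('n))) \<le> norm (\<Prod>i\<in>UNIV. inverse (1 + (\<xi> $ i)\<^sup>2))"
        by (simp add: abs_prod add_pos_nonneg)
    qed
  qed (auto intro!: borel_measurable_continuous_onI continuous_intros simp: add_nonneg_eq_0_iff)
qed

text \<open>\<open>s\<close> is uncontrolled at \<xi> = 0, but \<open>\<psi>\<close> vanishes for
  |\<xi>| < 1/2; continuity is glued from two open sets.\<close>

lemma continuous_on_cutoff_mult:
  fixes U :: "(real ^ 'n::finite) set"
  assumes U: "open U" and \<psi>: "cutoff_function U \<psi>" and s: "continuous_on (U \<times> (-{0})) s"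
  shows "continuous_on (U \<times> UNIV) (\<lambda>p. \<psi> p * s p)"
proof -
  have "continuous_on (U \<times> UNIV) \<psi>"
    using \<psi> by (auto simp: cutoff_function_def intro: smooth_on_imp_continuous_on)
  then have 1: "continuous_on (U \<times> (-{0})) (\<lambda>p. \<psi> p * s p)"
    by (intro continuous_on_mult s) (auto intro: continuous_on_subset)
  have 2: "continuous_on (U \<times> ball 0 (1/2)) (\<lambda>p. \<psi> p * s p)"
    by (rule continuous_on_eq[OF continuous_on_const[of _ 0]]) (use \<psi> in \<open>auto simp: cutoff_function_def\<close>)
  have "continuous_on (U \<times> (-{0}) \<union> U \<times> ball 0 (1/2)) (\<lambda>p. \<psi> p * s p)"
    by (rule continuous_on_open_Un[OF _ _ 1 2]) (use U in \<open>auto intro!: open_Times\<close>)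
  moreover have "U \<times> (-{0}) \<union> U \<times> ball 0 (1/2) = U \<times> (UNIV :: (real ^ 'n) set)" by auto
  ultimately show ?thesis by simp
qed

text \<open>
  The exponent \<open>\<beta> - j + n\<close> vanishes for at most one \<open>j\<close>; this component contributes only a
  logarithm to the expansion, in agreement with \<open>x / 0 = 0\<close> in the formula.
\<close>

lemma cutoff_integral_eq:
  fixes U :: "(real ^ 'n::finite) set"
  assumes U: "open U" and \<psi>: "cutoff_function U \<psi>" and x: "x \<in> U"
    and hom: "\<And>j. pos_homogeneous U (\<beta> - of_nat j) (s j)"
    and rem: "integrable lborel (\<lambda>\<xi>. \<sigma> (x, \<xi>) - (\<Sum>j<N. \<psi> (x, \<xi>) * s j (x, \<xi>)))"
  shows "cutoff_integral (\<lambda>\<xi>. \<sigma> (x, \<xi>)) =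
      (LINT \<xi>|lborel. \<sigma> (x, \<xi>) - (\<Sum>j<N. \<psi> (x, \<xi>) * s j (x, \<xi>)))
      + (\<Sum>j<N. LINT \<xi>:ball 0 1|lborel. \<psi> (x, \<xi>) * s j (x, \<xi>))
      - (\<Sum>j<N. sphere_integral (\<lambda>\<xi>. s j (x, \<xi>)) / (\<beta> + of_nat CARD('n) - of_nat j))"
proof -
  define \<rho> where "\<rho> \<xi> = \<sigma> (x, \<xi>) - (\<Sum>j<N. \<psi> (x, \<xi>) * s j (x, \<xi>))" for \<xi>
  define h where "h j \<xi> = \<psi> (x, \<xi>) * s j (x, \<xi>)" for j \<xi>
  define S where "S j = sphere_integral (\<lambda>\<xi>. s j (x, \<xi>))" for j
  define e where "e j = \<beta> + of_nat CARD('n) - of_nat j" for j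
  define B where "B j = (LINT \<xi>:ball 0 1|lborel. h j \<xi>)" for j
  have \<rho>: "integrable lborel \<rho>" using rem by (simp add: \<rho>_def[abs_def])
  have h_cont: "continuous_on UNIV (h j)" for j
  proof -
    have "continuous_on (U \<times> (-{0})) (s j)"
      using hom[of j] smooth_on_imp_continuous_on by (auto simp: pos_homogeneous_def)
    from continuous_on_cutoff_mult[OF U \<psi> this] show ?thesis
      unfolding h_def by (rule continuous_on_compose2[where f = "\<lambda>\<xi>. (x, \<xi>)"])
        (use x in \<open>auto intro!: continuous_intros\<close>)
  qed
  have h_cball: "set_integrable lborel (cball 0 R) (h j)" for j R
    unfolding set_integrable_def
    by (rule borel_integrable_compact[OF compact_cball continuous_on_subset[OF h_cont]]) simp
  \<comment> \<open>The unit ball carries the cutoff and gives a number independent of R; on the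
    shell \<open>\<psi>\<close> is 1 and the formula for homogeneous functions applies.\<close>
  have split: "(LINT \<xi>:cball 0 R|lborel. h j \<xi>) = B j + S j *
      (if e j = 0 then of_real (ln R) else (of_real R powr e j - 1) / e j)" if R: "R > 1" for j R
  proof -
    have sub: "ball 0 1 \<subseteq> cball (0 :: real ^ 'n) R" "shell 1 R \<subseteq> cball (0 :: real ^ 'n) R"
      using R by auto
    have "cball (0 :: real ^ 'n) R = ball 0 1 \<union> shell 1 R" using R by auto
    then have "(LINT \<xi>:cball 0 R|lborel. h j \<xi>) = (LINT \<xi>:ball 0 1 \<union> shell 1 R|lborel. h j \<xi>)" by simp
    also have "\<dots> = B j + (LINT \<xi>:shell 1 R|lborel. h j \<xi>)" unfolding B_def
      by (rule set_integral_Un) (use sub in \<open>auto intro!: set_integrable_subset[OF h_cball]\<close>)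
    also have "(LINT \<xi>:shell 1 R|lborel. h j \<xi>) = (LINT \<xi>:shell 1 R|lborel. s j (x, \<xi>))"
      by (rule set_lebesgue_integral_cong) (use \<psi> x in \<open>auto simp: h_def cutoff_function_def\<close>)
    also have "\<dots> = S j * (if e j = 0 then of_real (ln R) else (of_real R powr e j - 1) / e j)"
      using integral_shell_power[OF hom[of j] x R] by (simp add: S_def e_def add_ac add_diff_eq)
    finally show ?thesis .
  qed
  have lim: "((\<lambda>R. LINT \<xi>:cball 0 R|lborel. \<rho> \<xi>) \<longlongrightarrow> (LINT \<xi>|lborel. \<rho> \<xi>)) at_top"
    unfolding set_lebesgue_integral_def
  proof (rule integral_dominated_convergence_at_top[where w = "\<lambda>\<xi>. norm (\<rho> \<xi>)"])
    show "\<forall>\<^sub>F R in at_top. AE \<xi> in lborel. norm (indicat_real (cball 0 R) \<xi> *\<^sub>R \<rho> \<xi>) \<le> norm (\<rho> \<xi>)"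
      by (auto simp: indicator_def)
    show "AE \<xi> in lborel. ((\<lambda>R. indicat_real (cball 0 R) \<xi> *\<^sub>R \<rho> \<xi>) \<longlongrightarrow> \<rho> \<xi>) at_top"
    proof (rule AE_I2)
      fix \<xi>
      have "eventually (\<lambda>R. \<rho> \<xi> = indicat_real (cball 0 R) \<xi> *\<^sub>R \<rho> \<xi>) at_top"
        using eventually_ge_at_top[of "norm \<xi>"] by eventually_elim (simp add: indicator_def)
      then show "((\<lambda>R. indicat_real (cball 0 R) \<xi> *\<^sub>R \<rho> \<xi>) \<longlongrightarrow> \<rho> \<xi>) at_top"
        by (rule Lim_transform_eventually[OF tendsto_const])
    qed
  qed (use \<rho> borel_measurable_integrable[OF \<rho>] in \<open>auto intro!: borel_measurable_scaleR borel_measurable_indicator\<close>)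
  \<comment> \<open>The terms \<open>- S j / e j\<close> come from the inner radius 1 of the shell;
    they carry all the poles in z.\<close>
  let ?c = "(LINT \<xi>|lborel. \<rho> \<xi>) + (\<Sum>j<N. B j) - (\<Sum>j<N. S j / e j)"
  have "has_constant_term (\<lambda>R. LINT \<xi>:cball 0 R|lborel. \<sigma> (x, \<xi>))
      (?c + (\<Sum>j<N. if e j = 0 then S j / e j else 0))"
  proof (rule has_constant_termI[where b = "\<Sum>j<N. if e j = 0 then S j else 0"])
    show "((\<lambda>R. (LINT \<xi>:cball 0 R|lborel. \<sigma> (x, \<xi>)) - ((\<Sum>j<N. S j / e j * of_real R powr e j)
        + (\<Sum>j<N. if e j = 0 then S j else 0) * of_real (ln R) + ?c)) \<longlongrightarrow> 0) at_top"
    proof (rule Lim_transform_eventually)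
      show "((\<lambda>R. (LINT \<xi>:cball 0 R|lborel. \<rho> \<xi>) - (LINT \<xi>|lborel. \<rho> \<xi>)) \<longlongrightarrow> 0) at_top"
        using lim by (simp add: LIM_zero_iff)
      show "eventually (\<lambda>R. (LINT \<xi>:cball 0 R|lborel. \<rho> \<xi>) - (LINT \<xi>|lborel. \<rho> \<xi>) =
         (LINT \<xi>:cball 0 R|lborel. \<sigma> (x, \<xi>)) - ((\<Sum>j<N. S j / e j * of_real R powr e j)
        + (\<Sum>j<N. if e j = 0 then S j else 0) * of_real (ln R) + ?c)) at_top"
        using eventually_gt_at_top[of 1]
      proof eventually_elim
        case (elim R)
        have "(LINT \<xi>:cball 0 R|lborel. \<sigma> (x, \<xi>)) = (LINT \<xi>:cball 0 R|lborel. \<rho> \<xi> + (\<Sum>j<N. h j \<xi>))"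
          by (simp add: \<rho>_def h_def)
        also have "\<dots> = (LINT \<xi>:cball 0 R|lborel. \<rho> \<xi>) + (LINT \<xi>:cball 0 R|lborel. \<Sum>j<N. h j \<xi>)"
        proof (rule set_integral_add)
          show "set_integrable lborel (cball 0 R) \<rho>"
            using \<rho> unfolding set_integrable_def by (intro integrable_mult_indicator) auto
          show "set_integrable lborel (cball 0 R) (\<lambda>\<xi>. \<Sum>j<N. h j \<xi>)"
            unfolding set_integrable_def scaleR_sum_right
            by (rule Bochner_Integration.integrable_sum) (use h_cball in \<open>simp add: set_integrable_def\<close>)
        qed
        also have "(LINT \<xi>:cball 0 R|lborel. \<Sum>j<N. h j \<xi>) = (\<Sum>j<N. LINT \<xi>:cball 0 R|lborel. h j \<xi>)"
          unfolding set_lebesgue_integral_def scaleR_sum_right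
          by (rule Bochner_Integration.integral_sum) (use h_cball in \<open>simp add: set_integrable_def\<close>)
        also have "\<dots> = (\<Sum>j<N. B j + S j / e j * of_real R powr e j + (if e j = 0 then S j else 0) * of_real (ln R) - S j / e j)"
          unfolding split[OF elim] by (intro sum.cong) (auto simp: field_simps)
        also have "\<dots> = (\<Sum>j<N. B j) + (\<Sum>j<N. S j / e j * of_real R powr e j)
            + (\<Sum>j<N. if e j = 0 then S j else 0) * of_real (ln R) - (\<Sum>j<N. S j / e j)"
          by (simp add: sum.distrib sum_subtractf sum_distrib_right)
        finally show ?case by simp
      qed
    qed
  qed (auto simp: inj_on_def e_def)
  moreover have "(\<Sum>j<N. if e j = 0 then S j / e j else 0) = 0" by (intro sum.neutral) auto
  ultimately have "has_constant_term (\<lambda>R. LINT \<xi>:cball 0 R|lborel. \<sigma> (x, \<xi>)) ?c" by simp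
  then have "cutoff_integral (\<lambda>\<xi>. \<sigma> (x, \<xi>)) = ?c"
    unfolding cutoff_integral_def by (intro the_equality) (auto intro: has_constant_term_unique)
  then show ?thesis by (simp add: \<rho>_def B_def h_def S_def e_def)
qed

lemma cutoff_integral_0: "cutoff_integral (\<lambda>_. 0) = 0"
proof -
  have "has_constant_term (\<lambda>R. LINT \<xi>:cball 0 R|(lborel :: (real ^ 'n) measure). 0) 0"
    unfolding has_constant_term_def
    by (intro exI[of _ "{}"] exI[of _ "\<lambda>_. 0"] exI[of _ 0]) (auto simp: set_lebesgue_integral_def)
  then show ?thesis
    unfolding cutoff_integral_def by (intro the_equality) (auto intro: has_constant_term_unique)
qed

subsection \<open>Dominated families\<close>

text \<open>These are the hypotheses for integrating over the fibre and then over \<open>K\<close>,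
  with holomorphic dependence on z. The bound \<open>g\<close> depends on \<xi> alone, so that fibre
  integrals are bounded uniformly on \<open>K\<close>. Measurability refers to the function cut off
  to \<open>K\<close>, because homogeneous components are uncontrolled for x outside
  \<open>U\<close>.\<close>

definition dominated_family ::
  "complex set \<Rightarrow> (real ^ 'n::finite) set \<Rightarrow> (complex \<Rightarrow> 'n symb) \<Rightarrow> bool" where
  "dominated_family \<Omega> K q \<longleftrightarrow>
     (\<forall>z\<in>\<Omega>. (\<lambda>p. indicat_real (K \<times> UNIV) p *\<^sub>R q z p) \<in> borel_measurable borel) \<and>
     (\<forall>x\<in>K. \<forall>\<xi>. (\<lambda>z. q z (x, \<xi>)) holomorphic_on \<Omega>) \<and>
     (\<forall>z0\<in>\<Omega>. \<exists>r>0. \<exists>g. integrable lborel g \<and> (\<forall>z\<in>ball z0 r. \<forall>x\<in>K. \<forall>\<xi>. norm (q z (x, \<xi>)) \<le> g \<xi>))"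

lemma dominated_familyD_bound:
  assumes "dominated_family \<Omega> K q" "z0 \<in> \<Omega>"
  obtains r g where "r > 0" "integrable lborel g"
    "\<And>z x \<xi>. z \<in> ball z0 r \<Longrightarrow> x \<in> K \<Longrightarrow> norm (q z (x, \<xi>)) \<le> g \<xi>"
proof -
  have "\<exists>r>0. \<exists>g. integrable lborel g \<and> (\<forall>z\<in>ball z0 r. \<forall>x\<in>K. \<forall>\<xi>. norm (q z (x, \<xi>)) \<le> g \<xi>)"
    using assms by (simp add: dominated_family_def)
  then obtain r g where "r > 0" "integrable lborel g"
    "\<forall>z\<in>ball z0 r. \<forall>x\<in>K. \<forall>\<xi>. norm (q z (x, \<xi>)) \<le> g \<xi>" by (elim exE conjE)
  then show thesis by (intro that[of r g]) auto
qed

lemma dominated_family_add: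
  assumes q: "dominated_family \<Omega> K q" and q': "dominated_family \<Omega> K q'"
  shows "dominated_family \<Omega> K (\<lambda>z p. q z p + q' z p)"
proof -
  have "\<exists>r>0. \<exists>g. integrable lborel g \<and> (\<forall>z\<in>ball z0 r. \<forall>x\<in>K. \<forall>\<xi>. norm (q z (x, \<xi>) + q' z (x, \<xi>)) \<le> g \<xi>)"
    if z0: "z0 \<in> \<Omega>" for z0
  proof -
    obtain r g where 1: "r > 0" "integrable lborel g"
      "\<And>z x \<xi>. z \<in> ball z0 r \<Longrightarrow> x \<in> K \<Longrightarrow> norm (q z (x, \<xi>)) \<le> g \<xi>" by (rule dominated_familyD_bound[OF q z0], rule that)
    obtain r' g' where 2: "r' > 0" "integrable lborel g'"
      "\<And>z x \<xi>. z \<in> ball z0 r' \<Longrightarrow> x \<in> K \<Longrightarrow> norm (q' z (x, \<xi>)) \<le> g' \<xi>" by (rule dominated_familyD_bound[OF q' z0], rule that)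
    show ?thesis
      using 1 2 by (intro exI[of _ "min r r'"] conjI exI[of _ "\<lambda>\<xi>. g \<xi> + g' \<xi>"] ballI allI norm_triangle_mono) auto
  qed
  then show ?thesis
    using q q' unfolding dominated_family_def
    by (auto simp: scaleR_add_right intro!: holomorphic_intros borel_measurable_add)
qed

lemma dominated_family_sum:
  fixes K :: "(real ^ 'n::finite) set"
  assumes "finite J" "\<And>j. j \<in> J \<Longrightarrow> dominated_family \<Omega> K (q j)"
  shows "dominated_family \<Omega> K (\<lambda>z p. \<Sum>j\<in>J. q j z p)"
  using assms
proof (induction J rule: finite_induct)
  case empty
  have "\<exists>r>0. \<exists>g. integrable (lborel :: (real ^ 'n) measure) g \<and> (\<forall>z\<in>ball z0 r. \<forall>x\<in>K. \<forall>\<xi>. norm (0::complex) \<le> g \<xi>)"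
    for z0 :: complex
    by (intro exI[of _ 1] conjI exI[of _ "\<lambda>_. 0"]) auto
  then show ?case by (auto simp: dominated_family_def)
next
  case (insert j J)
  then show ?case by (simp add: dominated_family_add)
qed

context
  fixes \<Omega> :: "complex set" and K :: "(real ^ 'n::finite) set" and q :: "complex \<Rightarrow> 'n symb"
  assumes q: "dominated_family \<Omega> K q" and \<Omega>: "open \<Omega>"
begin

lemma dominated_family_measurable_fibre:
  assumes "z \<in> \<Omega>" "x \<in> K"
  shows "(\<lambda>\<xi>. q z (x, \<xi>)) \<in> borel_measurable borel"
proof -
  have "(\<lambda>p. indicat_real (K \<times> UNIV) p *\<^sub>R q z p) \<in> borel_measurable borel"
    using q assms by (simp add: dominated_family_def)
  then have "(\<lambda>p. indicat_real (K \<times> UNIV) p *\<^sub>R q z p) \<circ> Pair x \<in> borel_measurable borel"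
    by (intro measurable_comp[OF borel_measurable_continuous_onI]) (auto intro!: continuous_intros)
  then show ?thesis using assms by (simp add: comp_def)
qed

lemma dominated_family_integrable_fibre:
  assumes "z \<in> \<Omega>" "x \<in> K"
  shows "integrable lborel (\<lambda>\<xi>. q z (x, \<xi>))"
proof -
  obtain r g where "r > 0" and g: "integrable lborel g"
    and bound: "\<And>w x \<xi>. w \<in> ball z r \<Longrightarrow> x \<in> K \<Longrightarrow> norm (q w (x, \<xi>)) \<le> g \<xi>" by (rule dominated_familyD_bound[OF q assms(1)], rule that)
  show ?thesis
    by (rule Bochner_Integration.integrable_bound[OF g])
       (use bound[of z x] assms \<open>r > 0\<close> dominated_family_measurable_fibre in
         \<open>auto intro!: AE_I2 intro: order_trans[OF _ abs_ge_self]\<close>)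
qed

lemma dominated_family_holomorphic_fibre:
  assumes "x \<in> K"
  shows "(\<lambda>z. LINT \<xi>|lborel. q z (x, \<xi>)) holomorphic_on \<Omega>"
proof (rule holomorphic_on_lebesgue_integral[OF \<Omega>])
  show "(\<lambda>\<xi>. q z (x, \<xi>)) \<in> borel_measurable lborel" if "z \<in> \<Omega>" for z
    using dominated_family_measurable_fibre[OF that assms] by simp
  show "\<exists>r>0. \<exists>g. integrable lborel g \<and> (\<forall>z\<in>ball z0 r. \<forall>\<xi>\<in>space lborel. norm (q z (x, \<xi>)) \<le> g \<xi>)"
    if z0: "z0 \<in> \<Omega>" for z0
  proof -
    obtain r g where "r > 0" "integrable lborel g"
      "\<And>z x \<xi>. z \<in> ball z0 r \<Longrightarrow> x \<in> K \<Longrightarrow> norm (q z (x, \<xi>)) \<le> g \<xi>"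
      by (rule dominated_familyD_bound[OF q z0], rule that)
    then show ?thesis using assms by (intro exI[of _ r] conjI exI[of _ g]) auto
  qed
qed (use q assms in \<open>auto simp: dominated_family_def\<close>)

lemma dominated_family_measurable:
  assumes "z \<in> \<Omega>"
  shows "(\<lambda>x. indicat_real K x *\<^sub>R (LINT \<xi>|lborel. q z (x, \<xi>))) \<in> borel_measurable borel"
proof -
  have "(\<lambda>p. indicat_real (K \<times> UNIV) p *\<^sub>R q z p) \<in> borel_measurable (lborel \<Otimes>\<^sub>M lborel)"
    using q assms by (simp add: dominated_family_def lborel_prod)
  then have "case_prod (\<lambda>x \<xi>. indicat_real K x *\<^sub>R q z (x, \<xi>)) \<in> borel_measurable (lborel \<Otimes>\<^sub>M lborel)"
    by (rule measurable_cong[THEN iffD1, rotated]) (auto simp: indicator_def)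
  then have "(\<lambda>x. LINT \<xi>|lborel. indicat_real K x *\<^sub>R q z (x, \<xi>)) \<in> borel_measurable lborel"
    by (rule lborel.borel_measurable_lebesgue_integral)
  then show ?thesis by simp
qed

context
  assumes K: "compact K"
begin

text \<open>On \<open>K\<close>, which has finite measure, the integral of the fibrewise bound is a
  constant and hence an integrable bound in x.\<close>

lemma dominated_family_total_bound:
  assumes "z0 \<in> \<Omega>"
  obtains r g where "r > 0" "integrable lborel g"
    "\<And>z x. z \<in> ball z0 r \<inter> \<Omega> \<Longrightarrow> norm (indicat_real K x *\<^sub>R (LINT \<xi>|lborel. q z (x, \<xi>))) \<le> g x"
proof -
  obtain r g where "r > 0" and g: "integrable lborel g"
    and bound: "\<And>w x \<xi>. w \<in> ball z0 r \<Longrightarrow> x \<in> K \<Longrightarrow> norm (q w (x, \<xi>)) \<le> g \<xi>" by (rule dominated_familyD_bound[OF q assms], rule that)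
  have bnd: "norm (indicat_real K x *\<^sub>R (LINT \<xi>|lborel. q z (x, \<xi>))) \<le> indicat_real K x * (LINT \<xi>|lborel. g \<xi>)"
    if "z \<in> ball z0 r \<inter> \<Omega>" for z x
  proof (cases "x \<in> K")
    case True
    have "norm (LINT \<xi>|lborel. q z (x, \<xi>)) \<le> (LINT \<xi>|lborel. norm (q z (x, \<xi>)))"
      by (rule integral_norm_bound)
    also have "\<dots> \<le> (LINT \<xi>|lborel. g \<xi>)"
      using that True bound dominated_family_integrable_fibre[of z x] g
      by (intro integral_mono) auto
    finally show ?thesis using True by simp
  qed simp
  have int: "integrable lborel (\<lambda>x. indicat_real K x * (LINT \<xi>|lborel. g \<xi>))"
    using K emeasure_compact_finite[OF K] by (intro integrable_mult_left integrable_real_indicator) (auto intro: borel_compact)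
  show thesis by (rule that[OF \<open>r > 0\<close> int bnd])
qed

lemma dominated_family_integrable_total:
  assumes "z \<in> \<Omega>"
  shows "set_integrable lborel K (\<lambda>x. LINT \<xi>|lborel. q z (x, \<xi>))"
proof -
  obtain r g where "r > 0" and g: "integrable lborel g"
    and bound: "\<And>w x. w \<in> ball z r \<inter> \<Omega> \<Longrightarrow> norm (indicat_real K x *\<^sub>R (LINT \<xi>|lborel. q w (x, \<xi>))) \<le> g x" by (rule dominated_family_total_bound[OF assms], rule that)
  show ?thesis unfolding set_integrable_def
    by (rule Bochner_Integration.integrable_bound[OF g])
       (use bound[of z] assms \<open>r > 0\<close> dominated_family_measurable in
         \<open>auto intro!: AE_I2 intro: order_trans[OF _ abs_ge_self]\<close>)
qed

lemma dominated_family_holomorphic_total: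
  "(\<lambda>z. LINT x:K|lborel. LINT \<xi>|lborel. q z (x, \<xi>)) holomorphic_on \<Omega>"
  unfolding set_lebesgue_integral_def
proof (rule holomorphic_on_lebesgue_integral[OF \<Omega>])
  show "(\<lambda>z. indicat_real K x *\<^sub>R (LINT \<xi>|lborel. q z (x, \<xi>))) holomorphic_on \<Omega>" for x
    using dominated_family_holomorphic_fibre by (cases "x \<in> K") auto
  show "(\<lambda>x. indicat_real K x *\<^sub>R (LINT \<xi>|lborel. q z (x, \<xi>))) \<in> borel_measurable lborel" if "z \<in> \<Omega>" for z
    using dominated_family_measurable[OF that] by simp
  show "\<exists>r>0. \<exists>g. integrable lborel g \<and>
      (\<forall>z\<in>ball z0 r. \<forall>x\<in>space lborel. norm (indicat_real K x *\<^sub>R (LINT \<xi>|lborel. q z (x, \<xi>))) \<le> g x)"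
    if z0: "z0 \<in> \<Omega>" for z0
  proof -
    obtain r g where *: "r > 0" "integrable lborel g"
      "\<And>w x. w \<in> ball z0 r \<inter> \<Omega> \<Longrightarrow> norm (indicat_real K x *\<^sub>R (LINT \<xi>|lborel. q w (x, \<xi>))) \<le> g x" by (rule dominated_family_total_bound[OF z0], rule that)
    obtain r' where "r' > 0" "ball z0 r' \<subseteq> \<Omega>" using \<Omega> z0 open_contains_ball by blast
    with * show ?thesis by (intro exI[of _ "min r r'"] conjI exI[of _ g]) auto
  qed
qed

end

end

lemma measurable_indicator_Times:
  fixes g :: "'n::finite symb"
  assumes "compact K" "K \<subseteq> U" "continuous_on (U \<times> UNIV) g"
  shows "(\<lambda>p. indicat_real (K \<times> UNIV) p *\<^sub>R g p) \<in> borel_measurable borel"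
proof (rule borel_measurable_continuous_on_indicator)
  show "K \<times> UNIV \<in> sets borel"
    by (intro borel_closed closed_Times compact_imp_closed[OF assms(1)] closed_UNIV)
qed (use assms in \<open>auto intro: continuous_on_subset\<close>)

section \<open>Values and local bounds of families holomorphic in C^infinity\<close>

lemma holomorphic_smoothE:
  assumes "holomorphic_smooth S F"
  obtains g where "smooth_on S g" "\<And>L. compact L \<Longrightarrow> L \<subseteq> S \<Longrightarrow>
    uniform_limit L (\<lambda>h p. (F (z + h) p - F z p) / h) g (at 0)"
proof -
  have "\<exists>g. smooth_on S g \<and> (\<forall>K vs. compact K \<and> K \<subseteq> S \<and> vs \<in> lists Basis \<longrightarrow>
      uniform_limit K (\<lambda>h. iter_deriv vs (\<lambda>p. (F (z + h) p - F z p) / h)) (iter_deriv vs g) (at 0))"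
    using assms unfolding holomorphic_smooth_def by (elim conjE allE)
  then obtain g where g: "smooth_on S g" and lim: "\<forall>K vs. compact K \<and> K \<subseteq> S \<and> vs \<in> lists Basis \<longrightarrow>
      uniform_limit K (\<lambda>h. iter_deriv vs (\<lambda>p. (F (z + h) p - F z p) / h)) (iter_deriv vs g) (at 0)"
    by (elim exE conjE)
  show thesis
    by (rule that[OF g]) (use lim[rule_format, of _ "[]"] in simp)
qed

lemma holomorphic_smoothD:
  assumes "holomorphic_smooth S F" "p \<in> S"
  shows "(\<lambda>z. F z p) holomorphic_on UNIV"
proof -
  have "\<exists>D. ((\<lambda>z. F z p) has_field_derivative D) (at z)" for z
  proof -
    obtain g where "\<And>L. compact L \<Longrightarrow> L \<subseteq> S \<Longrightarrow>
        uniform_limit L (\<lambda>h p. (F (z + h) p - F z p) / h) g (at 0)"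
      by (rule holomorphic_smoothE[OF assms(1)], rule that)
    from this[of "{p}"] assms(2) have "uniform_limit {p} (\<lambda>h p. (F (z + h) p - F z p) / h) g (at 0)" by simp
    then have "((\<lambda>h. (F (z + h) p - F z p) / h) \<longlongrightarrow> g p) (at 0)"
      by (rule tendsto_uniform_limitI) simp
    then show ?thesis unfolding DERIV_def by blast
  qed
  then show ?thesis by (simp add: holomorphic_on_open)
qed

text \<open>The difference quotients at \<open>z0\<close> converge uniformly on \<open>L\<close>, so
  near \<open>z0\<close> they differ from the bounded function \<open>g\<close> by less than 1, and
  F(z) differs from F(z0) by at most r (|M1| + 1).\<close>

lemma holomorphic_smooth_locally_bounded:
  assumes F: "holomorphic_smooth S F" and L: "compact L" "L \<subseteq> S"
  obtains r M where "r > 0" "\<And>z p. z \<in> ball z0 r \<Longrightarrow> p \<in> L \<Longrightarrow> norm (F z p) \<le> M"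
proof -
  obtain g where sm: "smooth_on S g" and g: "\<And>L. compact L \<Longrightarrow> L \<subseteq> S \<Longrightarrow>
      uniform_limit L (\<lambda>h p. (F (z0 + h) p - F z0 p) / h) g (at 0)"
    by (rule holomorphic_smoothE[OF F], rule that)
  have bdd: "\<exists>M. \<forall>p\<in>L. norm (k p) \<le> M" if "smooth_on S k" for k :: "_ \<Rightarrow> complex"
  proof -
    have "compact (k ` L)"
      using L smooth_on_imp_continuous_on[OF that] by (blast intro: compact_continuous_image continuous_on_subset)
    then show ?thesis using compact_imp_bounded by (force simp: bounded_iff)
  qed
  obtain M1 where M1: "\<And>p. p \<in> L \<Longrightarrow> norm (g p) \<le> M1" using bdd[OF sm] by blast
  obtain M0 where M0: "\<And>p. p \<in> L \<Longrightarrow> norm (F z0 p) \<le> M0"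
    using bdd[of "F z0"] F by (auto simp: holomorphic_smooth_def)
  have "uniform_limit L (\<lambda>h p. (F (z0 + h) p - F z0 p) / h) g (at 0)"
    using g L by simp
  from uniform_limitD[OF this zero_less_one] obtain r where r: "r > 0"
    "\<And>h p. h \<noteq> 0 \<Longrightarrow> norm h < r \<Longrightarrow> p \<in> L \<Longrightarrow> norm ((F (z0 + h) p - F z0 p) / h - g p) < 1"
    by (auto simp: eventually_at dist_norm)
  have "norm (F z p) \<le> M0 + r * (\<bar>M1\<bar> + 1)" if z: "z \<in> ball z0 r" and p: "p \<in> L" for z p
  proof (cases "z = z0")
    case True
    have "0 \<le> r * (\<bar>M1\<bar> + 1)" using r(1) by simp
    from add_mono[OF M0[OF p] this] show ?thesis by (simp add: True)
  next
    case False
    define h where "h = z - z0"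
    have h: "h \<noteq> 0" "norm h < r" using z False by (auto simp: h_def dist_norm norm_minus_commute)
    define Q where "Q = (F (z0 + h) p - F z0 p) / h"
    have "norm Q \<le> norm (Q - g p) + norm (g p)" using norm_triangle_ineq[of "Q - g p" "g p"] by simp
    also have "\<dots> \<le> 1 + \<bar>M1\<bar>" using r(2)[OF h p] M1[OF p] by (auto simp: Q_def)
    finally have Q: "norm Q \<le> \<bar>M1\<bar> + 1" by simp
    have "F z p = F z0 p + h * Q" using h by (simp add: Q_def h_def)
    then have "norm (F z p) \<le> norm (F z0 p) + norm h * norm Q"
      by (metis norm_mult norm_triangle_ineq)
    also have "\<dots> \<le> M0 + r * (\<bar>M1\<bar> + 1)"
      using M0[OF p] Q h r(1) by (intro add_mono mult_mono) auto
    finally show ?thesis .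
  qed
  then show thesis by (rule that[OF r(1)])
qed

subsection \<open>Cut-off integrals of holomorphic families\<close>

lemma dominated_family_subset:
  "dominated_family \<Omega> K q \<Longrightarrow> \<Omega>' \<subseteq> \<Omega> \<Longrightarrow> dominated_family \<Omega>' K q"
  unfolding dominated_family_def by (meson holomorphic_on_subset subsetD)

text \<open>The estimate of the remainder is the instance k = 0, \<epsilon> = 1. The order lost to
  \<epsilon> is the 1 in the constant n + 1 of the half-planes below.\<close>

lemma holomorphic_familyE:
  assumes "holomorphic_family \<psi> U \<beta> f"
  obtains s where "\<And>z. classical_expansion \<psi> U (\<beta> z) (f z) (s z)"
    "\<And>j. holomorphic_smooth (U \<times> (- {0})) (\<lambda>z. s z j)"
    "\<And>N. N \<ge> 1 \<Longrightarrow> holomorphic_smooth (U \<times> UNIV) (\<lambda>z p. f z p - (\<Sum>j<N. \<psi> p * s z j p))"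
    "\<And>N. N \<ge> 1 \<Longrightarrow> locally_uniform_symbols U (\<lambda>z. Re (\<beta> z) - real N + 1)
       (\<lambda>z p. f z p - (\<Sum>j<N. \<psi> p * s z j p))"
proof -
  from assms obtain s where s: "\<forall>z. classical_expansion \<psi> U (\<beta> z) (f z) (s z)"
    "\<forall>j. holomorphic_smooth (U \<times> (- {0})) (\<lambda>z. s z j)"
    and rem: "\<forall>N\<ge>1. let rem = (\<lambda>z p. f z p - (\<Sum>j<N. \<psi> p * s z j p)) in
           holomorphic_smooth (U \<times> UNIV) rem \<and>
           (\<forall>k. \<forall>\<epsilon>>0. locally_uniform_symbols U (\<lambda>z. Re (\<beta> z) - real N + \<epsilon>)
              (\<lambda>z p. (deriv ^^ k) (\<lambda>w. rem w p) z))"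
    unfolding holomorphic_family_def by (elim exE conjE)
  show thesis
  proof (rule that[of s])
    fix N :: nat assume N: "N \<ge> 1"
    note r = rem[rule_format, OF N, unfolded Let_def]
    show "holomorphic_smooth (U \<times> UNIV) (\<lambda>z p. f z p - (\<Sum>j<N. \<psi> p * s z j p))"
      using r by (rule conjunct1)
    from conjunct2[OF r, rule_format, of 1 0]
    show "locally_uniform_symbols U (\<lambda>z. Re (\<beta> z) - real N + 1) (\<lambda>z p. f z p - (\<Sum>j<N. \<psi> p * s z j p))"
      by simp
  qed (use s in auto)
qed

abbreviation half_plane :: "(complex \<Rightarrow> complex) \<Rightarrow> real \<Rightarrow> nat \<Rightarrow> complex set" where
  "half_plane \<alpha> c N \<equiv> {z. Re (\<alpha> z) + c < real N}"

context
  fixes U :: "(real ^ 'n::finite) set" and \<psi> :: "'n symb" and \<alpha> :: "complex \<Rightarrow> complex"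
    and f :: "complex \<Rightarrow> 'n symb" and s :: "complex \<Rightarrow> nat \<Rightarrow> 'n symb"
  assumes U: "open U"
    and \<psi>: "cutoff_function U \<psi>"
    and \<alpha>: "\<alpha> holomorphic_on UNIV"
    and exp: "\<And>z. classical_expansion \<psi> U (\<alpha> z - of_nat CARD('n)) (f z) (s z)"
    and s_hol: "\<And>j. holomorphic_smooth (U \<times> (- {0})) (\<lambda>z. s z j)"
    and rem_hol: "\<And>N. N \<ge> 1 \<Longrightarrow> holomorphic_smooth (U \<times> UNIV) (\<lambda>z p. f z p - (\<Sum>j<N. \<psi> p * s z j p))"
    and rem_symbol: "\<And>N. N \<ge> 1 \<Longrightarrow> locally_uniform_symbols U (\<lambda>z. Re (\<alpha> z - of_nat CARD('n)) - real N + 1)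
       (\<lambda>z p. f z p - (\<Sum>j<N. \<psi> p * s z j p))"
begin

definition "rem_family N z p = f z p - (\<Sum>j<N. \<psi> p * s z j p)"

text \<open>Cutoff and component stay together as one product, because \<open>s z j\<close> alone
  may blow up at the origin, where \<open>\<psi>\<close> vanishes.\<close>

definition "ball_family j z p = indicat_real (ball 0 1) (snd p) *\<^sub>R (\<psi> p * s z j p)"

text \<open>With d = \<alpha>(z) - n - j the exponent of the weight is -(n + d), so the fibre
  integral is ln 2 times the integral of \<open>s z j\<close> over the unit sphere.\<close>

definition "shell_family j z p =
  indicat_real (shell 1 2) (snd p) *\<^sub>R (s z j p * of_real (norm (snd p)) powr (- (\<alpha> z - of_nat j)))"

text \<open>Integrand of the part of the cut-off integral that is holomorphic for Re \<alpha>(z) + n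
  + 1 < N.\<close>

definition "regular_family N z p = rem_family N z p + (\<Sum>j<N. ball_family j z p)"

definition "sphere_coeff j z x = sphere_integral (\<lambda>\<xi>. s z j (x, \<xi>))"

lemma continuous_\<alpha>: "continuous_on UNIV \<alpha>"
  using \<alpha> by (rule holomorphic_on_imp_continuous_on)

lemma open_half_plane: "open (half_plane \<alpha> (real CARD('n) + 1) N)"
  by (intro open_Collect_less continuous_intros continuous_\<alpha>)

lemma s_homogeneous: "pos_homogeneous U (\<alpha> z - of_nat CARD('n) - of_nat j) (s z j)"
  using exp by (simp add: classical_expansion_def)

lemma s_continuous: "continuous_on (U \<times> (-{0})) (s z j)"
  using s_hol[of j] by (auto simp: holomorphic_smooth_def intro: smooth_on_imp_continuous_on)

lemma \<psi>_continuous: "continuous_on (U \<times> UNIV) \<psi>"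
  using \<psi> by (auto simp: cutoff_function_def intro: smooth_on_imp_continuous_on)

context
  fixes K :: "(real ^ 'n) set"
  assumes K: "compact K" "K \<subseteq> U"
begin

text \<open>
  The constant \<open>n + 1\<close> makes the remainder of order at most \<open>-2n\<close>, so that it is dominated by a
  product of integrable functions of the single coordinates.
\<close>

lemma dominated_rem_family:
  assumes N: "N \<ge> 1"
  shows "dominated_family (half_plane \<alpha> (real CARD('n) + 1) N) K (rem_family N)"
  unfolding dominated_family_def
proof (intro conjI ballI allI)
  have hol: "holomorphic_smooth (U \<times> UNIV) (rem_family N)"
    using rem_hol[OF N] by (simp add: rem_family_def[abs_def])
  show "(\<lambda>p. indicat_real (K \<times> UNIV) p *\<^sub>R rem_family N z p) \<in> borel_measurable borel" for z
    by (rule measurable_indicator_Times[OF K])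
       (use hol in \<open>auto simp: holomorphic_smooth_def intro: smooth_on_imp_continuous_on\<close>)
  show "(\<lambda>z. rem_family N z (x, \<xi>)) holomorphic_on half_plane \<alpha> (real CARD('n) + 1) N" if "x \<in> K" for x \<xi>
    using holomorphic_smoothD[OF hol, of "(x, \<xi>)"] that K by (auto intro: holomorphic_on_subset)
  fix z0 assume "z0 \<in> half_plane \<alpha> (real CARD('n) + 1) N"
  then obtain r where r: "r > 0" "cball z0 r \<subseteq> half_plane \<alpha> (real CARD('n) + 1) N"
    using open_half_plane open_contains_cball by blast
  have "locally_uniform_symbols U (\<lambda>z. Re (\<alpha> z - of_nat CARD('n)) - real N + 1) (rem_family N)"
    using rem_symbol[OF N] by (simp add: rem_family_def[abs_def])
  then have "\<forall>Z K A B. compact Z \<and> compact K \<and> K \<subseteq> U \<longrightarrow> (\<exists>C. \<forall>z\<in>Z. \<forall>x\<in>K. \<forall>\<xi>.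
      norm (symb_deriv A B (rem_family N z) (x, \<xi>)) \<le>
        C * (1 + norm \<xi>) powr (Re (\<alpha> z - of_nat CARD('n)) - real N + 1 - real (length B)))"
    by (simp add: locally_uniform_symbols_def)
  from this[rule_format, of "cball z0 r" K "[]" "[]"] K obtain C where
    C: "\<forall>z\<in>cball z0 r. \<forall>x\<in>K. \<forall>\<xi>. norm (rem_family N z (x, \<xi>)) \<le>
      C * (1 + norm \<xi>) powr (Re (\<alpha> z - of_nat CARD('n)) - real N + 1)"
    by (auto simp: symb_deriv_def)
  have bnd: "norm (rem_family N z (x, \<xi>)) \<le> \<bar>C\<bar> * (1 + norm \<xi>) powr (- 2 * real CARD('n))"
    if z: "z \<in> ball z0 r" and x: "x \<in> K" for z x \<xi>
  proof -
    have "z \<in> half_plane \<alpha> (real CARD('n) + 1) N" using r(2) z by (auto simp: subset_iff)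
    then have e: "Re (\<alpha> z - of_nat CARD('n)) - real N + 1 \<le> - 2 * real CARD('n)" by simp
    have "norm (rem_family N z (x, \<xi>)) \<le> C * (1 + norm \<xi>) powr (Re (\<alpha> z - of_nat CARD('n)) - real N + 1)"
      using z x by (intro C[rule_format]) auto
    also have "\<dots> \<le> \<bar>C\<bar> * (1 + norm \<xi>) powr (- 2 * real CARD('n))"
      by (intro mult_mono powr_mono e) auto
    finally show ?thesis .
  qed
  have int: "integrable lborel (\<lambda>\<xi> :: real ^ 'n. \<bar>C\<bar> * (1 + norm \<xi>) powr (- 2 * real CARD('n)))"
    by (rule integrable_mult_right[OF integrable_decay])
  show "\<exists>r>0. \<exists>g. integrable lborel g \<and> (\<forall>z\<in>ball z0 r. \<forall>x\<in>K. \<forall>\<xi>. norm (rem_family N z (x, \<xi>)) \<le> g \<xi>)"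
    by (rule exI[of _ r], rule conjI[OF r(1)], rule exI, rule conjI[OF int]) (use bnd in blast)
qed

lemma s_locally_bounded:
  assumes a: "a > 0"
  obtains r M where "r > 0"
    "\<And>z x \<xi>. z \<in> ball z0 r \<Longrightarrow> x \<in> K \<Longrightarrow> \<xi> \<in> shell a b \<Longrightarrow> norm (s z j (x, \<xi>)) \<le> M"
proof -
  obtain r M where "r > 0" and M: "\<And>z p. z \<in> ball z0 r \<Longrightarrow> p \<in> K \<times> shell a b \<Longrightarrow> norm (s z j p) \<le> M"
    by (rule holomorphic_smooth_locally_bounded[OF s_hol, of "K \<times> shell a b"], use K a compact_Times[OF K(1) compact_shell] in auto)
  show thesis
    by (rule that[OF \<open>r > 0\<close>]) (use M in auto)
qed

lemma integrable_indicator_bounded: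
  assumes "B \<in> sets borel" "bounded B"
  shows "integrable lborel (\<lambda>\<xi> :: real ^ 'n. M * indicat_real B \<xi>)"
  using assms emeasure_bounded_finite[OF assms(2)]
  by (intro integrable_mult_right integrable_real_indicator) auto

lemma dominated_ball_family: "dominated_family UNIV K (ball_family j)"
  unfolding dominated_family_def
proof (intro conjI ballI allI)
  fix z
  have "(\<lambda>p. indicat_real (K \<times> UNIV) p *\<^sub>R (\<psi> p * s z j p)) \<in> borel_measurable borel"
    by (rule measurable_indicator_Times[OF K continuous_on_cutoff_mult[OF U \<psi> s_continuous]])
  moreover have "(\<lambda>p :: (real ^ 'n) \<times> (real ^ 'n). indicat_real (ball 0 1) (snd p)) \<in> borel_measurable borel"
  proof -
    have "(\<lambda>p :: (real ^ 'n) \<times> (real ^ 'n). indicat_real (ball 0 1) (snd p)) = indicat_real (UNIV \<times> ball 0 1)"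
      by (auto simp: fun_eq_iff indicator_def)
    moreover have "UNIV \<times> ball 0 1 \<in> sets (borel :: ((real ^ 'n) \<times> (real ^ 'n)) measure)"
      by (intro borel_open open_Times) auto
    ultimately show ?thesis by (simp add: borel_measurable_indicator)
  qed
  ultimately have "(\<lambda>p. indicat_real (ball 0 1) (snd p) *\<^sub>R (indicat_real (K \<times> UNIV) p *\<^sub>R (\<psi> p * s z j p))) \<in> borel_measurable borel"
    by (rule borel_measurable_scaleR[rotated])
  then show "(\<lambda>p. indicat_real (K \<times> UNIV) p *\<^sub>R ball_family j z p) \<in> borel_measurable borel"
    by (simp add: ball_family_def mult.commute)
next
  fix x \<xi> assume x: "x \<in> K"
  show "(\<lambda>z. ball_family j z (x, \<xi>)) holomorphic_on UNIV"
  proof (cases "\<xi> = 0")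
    case True
    then have "\<psi> (x, \<xi>) = 0" using \<psi> x K by (auto simp: cutoff_function_def)
    then show ?thesis by (simp add: ball_family_def)
  next
    case False
    have "(\<lambda>z. s z j (x, \<xi>)) holomorphic_on UNIV"
      using holomorphic_smoothD[OF s_hol, of "(x, \<xi>)" j] False x K by auto
    then show ?thesis unfolding ball_family_def by (intro holomorphic_intros) auto
  qed
next
  fix z0 :: complex
  \<comment> \<open>As \<open>\<psi>\<close> vanishes for |\<xi>| \<le> 1/2, a bound for
    \<open>s\<close> on a compact shell away from the origin is enough.\<close>
  obtain r M where r: "r > 0" and M: "\<And>z x \<xi>. z \<in> ball z0 r \<Longrightarrow> x \<in> K \<Longrightarrow> \<xi> \<in> shell (1/2) 1 \<Longrightarrow> norm (s z j (x, \<xi>)) \<le> M"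
    by (rule s_locally_bounded[of "1/2" z0 1 j], simp, rule that)
  have "compact (\<psi> ` (K \<times> cball 0 1))"
    by (intro compact_continuous_image continuous_on_subset[OF \<psi>_continuous] compact_Times K compact_cball)
       (use K in auto)
  then obtain M' where M': "\<And>x \<xi>. x \<in> K \<Longrightarrow> \<xi> \<in> cball 0 1 \<Longrightarrow> norm (\<psi> (x, \<xi>)) \<le> M'"
    using compact_imp_bounded by (force simp: bounded_iff)
  have bnd: "norm (ball_family j z (x, \<xi>)) \<le> \<bar>M'\<bar> * \<bar>M\<bar> * indicat_real (ball 0 1) \<xi>"
    if z: "z \<in> ball z0 r" and x: "x \<in> K" for z x \<xi>
  proof -
    have "norm (\<psi> (x, \<xi>)) * norm (s z j (x, \<xi>)) \<le> \<bar>M'\<bar> * \<bar>M\<bar>" if \<xi>: "norm \<xi> < 1"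
    proof (cases "norm \<xi> \<le> 1/2")
      case True
      then have "\<psi> (x, \<xi>) = 0" using \<psi> x K by (auto simp: cutoff_function_def)
      then show ?thesis by simp
    next
      case False
      then have "norm (\<psi> (x, \<xi>)) \<le> \<bar>M'\<bar>" "norm (s z j (x, \<xi>)) \<le> \<bar>M\<bar>"
        using M'[OF x, of \<xi>] M[OF z x, of \<xi>] \<xi> by auto
      then show ?thesis by (intro mult_mono) auto
    qed
    then show ?thesis by (auto simp: ball_family_def indicator_def norm_mult)
  qed
  have int: "integrable lborel (\<lambda>\<xi> :: real ^ 'n. \<bar>M'\<bar> * \<bar>M\<bar> * indicat_real (ball 0 1) \<xi>)"
    by (intro integrable_indicator_bounded) auto
  show "\<exists>r>0. \<exists>g. integrable lborel g \<and> (\<forall>z\<in>ball z0 r. \<forall>x\<in>K. \<forall>\<xi>. norm (ball_family j z (x, \<xi>)) \<le> g \<xi>)"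
    by (rule exI[of _ r], rule conjI[OF r], rule exI, rule conjI[OF int]) (use bnd in blast)
qed

lemma dominated_regular_family:
  assumes "N \<ge> 1"
  shows "dominated_family (half_plane \<alpha> (real CARD('n) + 1) N) K (regular_family N)"
  unfolding regular_family_def
  by (intro dominated_family_add dominated_rem_family dominated_family_sum
      dominated_family_subset[OF dominated_ball_family] assms) auto

lemma dominated_shell_family: "dominated_family UNIV K (shell_family j)"
  unfolding dominated_family_def
proof (intro conjI ballI allI)
  fix z
  have "(\<lambda>p. indicat_real (K \<times> shell 1 2) p *\<^sub>R (s z j p * of_real (norm (snd p)) powr (- (\<alpha> z - of_nat j))))
     \<in> borel_measurable borel"
  proof (rule borel_measurable_continuous_on_indicator)
    show "K \<times> shell 1 2 \<in> sets borel"
      by (intro borel_closed closed_Times compact_imp_closed K compact_shell)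
    show "continuous_on (K \<times> shell 1 2) (\<lambda>p. s z j p * of_real (norm (snd p)) powr (- (\<alpha> z - of_nat j)))"
      using K by (intro continuous_intros continuous_on_subset[OF s_continuous])
        (auto simp: complex_nonpos_Reals_iff)
  qed
  moreover have "indicat_real (K \<times> shell 1 2) p = indicat_real (K \<times> UNIV) p * indicat_real (shell 1 2) (snd p)"
    for p :: "(real ^ 'n) \<times> (real ^ 'n)"
    by (cases p) (auto simp: indicator_def)
  ultimately show "(\<lambda>p. indicat_real (K \<times> UNIV) p *\<^sub>R shell_family j z p) \<in> borel_measurable borel"
    by (simp add: shell_family_def)
next
  fix x \<xi> assume x: "x \<in> K"
  show "(\<lambda>z. shell_family j z (x, \<xi>)) holomorphic_on UNIV"
  proof (cases "\<xi> = 0")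
    case True
    then show ?thesis by (simp add: shell_family_def)
  next
    case False
    have "(\<lambda>z. s z j (x, \<xi>)) holomorphic_on UNIV"
      using holomorphic_smoothD[OF s_hol, of "(x, \<xi>)" j] False x K by auto
    then show ?thesis unfolding shell_family_def
      using False by (auto intro!: holomorphic_intros \<alpha>)
  qed
next
  fix z0 :: complex
  obtain r M where r: "r > 0" and M: "\<And>z x \<xi>. z \<in> ball z0 r \<Longrightarrow> x \<in> K \<Longrightarrow> \<xi> \<in> shell 1 2 \<Longrightarrow> norm (s z j (x, \<xi>)) \<le> M"
    by (rule s_locally_bounded[of 1 z0 2 j], simp, rule that)
  have "compact ((\<lambda>z. \<alpha> z - of_nat j) ` cball z0 r)"
    by (intro compact_continuous_image continuous_intros continuous_on_subset[OF continuous_\<alpha>] compact_cball) auto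
  then obtain B where B: "\<And>z. z \<in> cball z0 r \<Longrightarrow> norm (\<alpha> z - of_nat j) \<le> B"
    using compact_imp_bounded by (force simp: bounded_iff)
  have bnd: "norm (shell_family j z (x, \<xi>)) \<le> \<bar>M\<bar> * 2 powr B * indicat_real (shell 1 2) \<xi>"
    if z: "z \<in> ball z0 r" and x: "x \<in> K" for z x \<xi>
  proof -
    have "norm (s z j (x, \<xi>)) * norm (of_real (norm \<xi>) powr (- (\<alpha> z - of_nat j)) :: complex) \<le> \<bar>M\<bar> * 2 powr B"
      if \<xi>: "\<xi> \<in> shell 1 2"
    proof (rule mult_mono)
      show "norm (s z j (x, \<xi>)) \<le> \<bar>M\<bar>" using M[OF z x \<xi>] by simp
      \<comment> \<open>For |\<xi>| \<ge> 1 the power grows with its exponent, and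
        \<open>B \<ge> 0\<close> allows |\<xi>| to be replaced by 2.\<close>
      have "- Re (\<alpha> z - of_nat j) \<le> B"
        using B[of z] abs_Re_le_cmod[of "\<alpha> z - of_nat j"] z by simp
      then have "norm \<xi> powr (- Re (\<alpha> z - of_nat j)) \<le> norm \<xi> powr B" using \<xi> by (intro powr_mono) auto
      also have "\<dots> \<le> 2 powr B"
        using \<xi> B[of z0] r norm_ge_zero[of "\<alpha> z0 - of_nat j"] by (intro powr_mono2) (auto simp del: norm_ge_zero)
      finally show "norm (of_real (norm \<xi>) powr (- (\<alpha> z - of_nat j)) :: complex) \<le> 2 powr B"
        using \<xi> by (simp add: norm_powr_real_powr)
    qed auto
    then show ?thesis by (auto simp: shell_family_def indicator_def norm_mult)
  qed
  have int: "integrable lborel (\<lambda>\<xi> :: real ^ 'n. \<bar>M\<bar> * 2 powr B * indicat_real (shell 1 2) \<xi>)"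
    by (rule integrable_indicator_bounded[OF sets_shell compact_imp_bounded[OF compact_shell]])
  show "\<exists>r>0. \<exists>g. integrable lborel g \<and> (\<forall>z\<in>ball z0 r. \<forall>x\<in>K. \<forall>\<xi>. norm (shell_family j z (x, \<xi>)) \<le> g \<xi>)"
    by (rule exI[of _ r], rule conjI[OF r], rule exI, rule conjI[OF int]) (use bnd in blast)
qed

end

lemma sphere_coeff_eq:
  assumes "x \<in> U"
  shows "sphere_coeff j z x = (LINT \<xi>|lborel. shell_family j z (x, \<xi>)) / of_real (ln 2)"
proof -
  have "of_nat CARD('n) + (\<alpha> z - of_nat CARD('n) - of_nat j) = \<alpha> z - of_nat j" by simp
  then show ?thesis
    using sphere_integral_eq_shell[OF s_homogeneous[of z j] assms]
    by (simp only: sphere_coeff_def shell_family_def set_lebesgue_integral_def snd_conv)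
qed

lemma cutoff_integral_family:
  assumes N: "N \<ge> 1" and z: "z \<in> half_plane \<alpha> (real CARD('n) + 1) N" and x: "x \<in> U"
  shows "cutoff_integral (\<lambda>\<xi>. f z (x, \<xi>)) =
    (LINT \<xi>|lborel. regular_family N z (x, \<xi>)) - (\<Sum>j<N. sphere_coeff j z x / (\<alpha> z - of_nat j))"
proof -
  \<comment> \<open>The uniform estimates are applied to the compact set that consists of x
    alone.\<close>
  have K: "compact {x}" "{x} \<subseteq> U" using x by auto
  have rem: "integrable lborel (\<lambda>\<xi>. rem_family N z (x, \<xi>))"
    using dominated_family_integrable_fibre[OF dominated_rem_family[OF K N] open_half_plane z, of x] by simp
  have ball: "integrable lborel (\<lambda>\<xi>. ball_family j z (x, \<xi>))" for j
    using dominated_family_integrable_fibre[OF dominated_ball_family[OF K] open_UNIV UNIV_I, of x] by simp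
  have "cutoff_integral (\<lambda>\<xi>. f z (x, \<xi>)) =
      (LINT \<xi>|lborel. rem_family N z (x, \<xi>)) + (\<Sum>j<N. LINT \<xi>|lborel. ball_family j z (x, \<xi>))
      - (\<Sum>j<N. sphere_coeff j z x / (\<alpha> z - of_nat j))"
    using cutoff_integral_eq[OF U \<psi> x s_homogeneous[of z] rem[unfolded rem_family_def]]
    by (simp add: rem_family_def ball_family_def sphere_coeff_def set_lebesgue_integral_def)
  also have "(LINT \<xi>|lborel. rem_family N z (x, \<xi>)) + (\<Sum>j<N. LINT \<xi>|lborel. ball_family j z (x, \<xi>)) =
      (LINT \<xi>|lborel. regular_family N z (x, \<xi>))"
    unfolding regular_family_def using rem ball by simp
  finally show ?thesis .
qed

text \<open>The family is the remainder for N = 1 plus the cut-off leading component, and both are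
  holomorphic at each point, \<xi> = 0 included since \<open>\<psi>\<close> vanishes there. The
  identity theorem for supports takes this as its input.\<close>

lemma family_holomorphic:
  assumes x: "x \<in> U"
  shows "(\<lambda>z. f z (x, \<xi>)) holomorphic_on UNIV"
proof -
  have "(\<lambda>z. f z (x, \<xi>) - (\<Sum>j<1. \<psi> (x, \<xi>) * s z j (x, \<xi>))) holomorphic_on UNIV"
    using holomorphic_smoothD[OF rem_hol[of 1], of "(x, \<xi>)"] x by simp
  moreover have "(\<lambda>z. \<psi> (x, \<xi>) * s z 0 (x, \<xi>)) holomorphic_on UNIV"
  proof (cases "\<xi> = 0")
    case True
    then have "\<psi> (x, \<xi>) = 0" using \<psi> x by (auto simp: cutoff_function_def)
    then show ?thesis by simp
  next
    case False
    have "(\<lambda>z. s z 0 (x, \<xi>)) holomorphic_on UNIV"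
      using holomorphic_smoothD[OF s_hol, of "(x, \<xi>)" 0] False x by auto
    then show ?thesis by (intro holomorphic_intros)
  qed
  ultimately have "(\<lambda>z. (f z (x, \<xi>) - (\<Sum>j<1. \<psi> (x, \<xi>) * s z j (x, \<xi>))) + \<psi> (x, \<xi>) * s z 0 (x, \<xi>)) holomorphic_on UNIV"
    by (rule holomorphic_on_add)
  then show ?thesis by simp
qed

lemma sphere_coeff_holomorphic:
  assumes x: "x \<in> U"
  shows "(\<lambda>z. sphere_coeff j z x) holomorphic_on UNIV"
proof -
  have "compact {x}" "{x} \<subseteq> U" using x by auto
  from dominated_family_holomorphic_fibre[OF dominated_shell_family[OF this] open_UNIV, of x]
  show ?thesis unfolding sphere_coeff_eq[OF x] by (intro holomorphic_intros) auto
qed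

lemma regular_part_holomorphic:
  assumes x: "x \<in> U" and N: "N \<ge> 1"
  shows "(\<lambda>z. LINT \<xi>|lborel. regular_family N z (x, \<xi>)) holomorphic_on half_plane \<alpha> (real CARD('n) + 1) N"
proof -
  have "compact {x}" "{x} \<subseteq> U" using x by auto
  from dominated_family_holomorphic_fibre[OF dominated_regular_family[OF this N] open_half_plane, of x]
  show ?thesis by simp
qed

text \<open>At z = 0 the components have degree k - n - j, so degree -n is attained exactly at j =
  k.\<close>

lemma symb_res_eq:
  assumes x: "x \<in> U" and k: "\<alpha> 0 = of_nat k"
  shows "symb_res \<psi> U (f 0) x = sphere_coeff k 0 x"
  unfolding symb_res_def sphere_coeff_def
  by (rule sphere_integral_cong, rule hom_component_eq[OF \<psi> x _ exp]) (simp_all add: k)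

lemma symb_res_eq_0:
  assumes x: "x \<in> U" and k: "\<forall>k. \<alpha> 0 \<noteq> of_nat k"
  shows "symb_res \<psi> U (f 0) x = 0"
proof -
  have "symb_res \<psi> U (f 0) x = sphere_integral (\<lambda>\<xi> :: real ^ 'n. 0)"
    unfolding symb_res_def
    by (rule sphere_integral_cong, rule hom_component_eq_0[OF \<psi> x _ exp]) (use k in auto)
  then show ?thesis by (simp add: sphere_integral_def Let_def set_lebesgue_integral_def)
qed

section \<open>Poles and residues in a single fibre\<close>

context
  assumes \<alpha>': "deriv \<alpha> 0 \<noteq> 0"
begin

lemma fibre_meromorphic:
  assumes x: "x \<in> U"
  shows "meromorphic_simple_poles \<alpha> (of_int ` {- int n..}) (\<lambda>z. cutoff_integral (\<lambda>\<xi>. f z (x, \<xi>)))"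
  by (rule meromorphic_simple_poles_sum[where c = "real CARD('n) + 1"
        and A = "\<lambda>N z. LINT \<xi>|lborel. regular_family N z (x, \<xi>)" and S = "\<lambda>j z. sphere_coeff j z x"])
     (use \<alpha> \<alpha>' cutoff_integral_family x in
       \<open>auto intro: regular_part_holomorphic sphere_coeff_holomorphic\<close>)

lemma fibre_residue:
  assumes x: "x \<in> U"
  shows "residue (\<lambda>z. cutoff_integral (\<lambda>\<xi>. f z (x, \<xi>))) 0 = - (1 / deriv \<alpha> 0) * symb_res \<psi> U (f 0) x"
proof (cases "\<exists>k. \<alpha> 0 = of_nat k")
  case True
  then obtain k where k: "\<alpha> 0 = of_nat k" by blast
  have "residue (\<lambda>z. cutoff_integral (\<lambda>\<xi>. f z (x, \<xi>))) 0 = - (1 / deriv \<alpha> 0) * sphere_coeff k 0 x"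
    by (rule residue_sum[where c = "real CARD('n) + 1"
          and A = "\<lambda>N z. LINT \<xi>|lborel. regular_family N z (x, \<xi>)" and S = "\<lambda>j z. sphere_coeff j z x"])
       (use \<alpha> \<alpha>' cutoff_integral_family x k in
         \<open>auto intro: regular_part_holomorphic sphere_coeff_holomorphic\<close>)
  then show ?thesis by (simp add: symb_res_eq[OF x k])
next
  case False
  then have k: "\<forall>k. \<alpha> 0 \<noteq> of_nat k" by blast
  have "residue (\<lambda>z. cutoff_integral (\<lambda>\<xi>. f z (x, \<xi>))) 0 = 0"
    by (rule residue_sum_0[where c = "real CARD('n) + 1" and \<alpha> = \<alpha>
          and A = "\<lambda>N z. LINT \<xi>|lborel. regular_family N z (x, \<xi>)" and S = "\<lambda>j z. sphere_coeff j z x"])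
       (use \<alpha> \<alpha>' cutoff_integral_family x k in
         \<open>auto intro: regular_part_holomorphic sphere_coeff_holomorphic\<close>)
  then show ?thesis by (simp add: symb_res_eq_0[OF x k])
qed

section \<open>Integration over the base\<close>

context
  fixes K :: "(real ^ 'n) set"
  assumes K: "compact K" "K \<subseteq> U" and supp: "\<And>z x \<xi>. x \<notin> K \<Longrightarrow> f z (x, \<xi>) = 0"
begin

lemma set_integral_support:
  fixes g :: "real ^ 'n \<Rightarrow> complex"
  assumes "\<And>x. x \<in> U - K \<Longrightarrow> g x = 0"
  shows "(LINT x:U|lborel. g x) = (LINT x:K|lborel. g x)"
  unfolding set_lebesgue_integral_def
  by (rule Bochner_Integration.integral_cong) (use K assms in \<open>auto simp: indicator_def\<close>)

lemma sphere_coeff_integral: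
  "set_integrable lborel K (\<lambda>x. sphere_coeff j z x)"
  "(LINT x:K|lborel. sphere_coeff j z x) =
    (LINT x:K|lborel. LINT \<xi>|lborel. shell_family j z (x, \<xi>)) / of_real (ln 2)"
proof -
  have eq: "indicat_real K x *\<^sub>R sphere_coeff j z x =
     (indicat_real K x *\<^sub>R (LINT \<xi>|lborel. shell_family j z (x, \<xi>))) / of_real (ln 2)" for x
    using K by (auto simp: indicator_def sphere_coeff_eq subset_iff)
  have "set_integrable lborel K (\<lambda>x. LINT \<xi>|lborel. shell_family j z (x, \<xi>))"
    by (rule dominated_family_integrable_total[OF dominated_shell_family[OF K] open_UNIV K(1) UNIV_I])
  then show "set_integrable lborel K (\<lambda>x. sphere_coeff j z x)"
    unfolding set_integrable_def eq by (rule integrable_divide_zero)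
  show "(LINT x:K|lborel. sphere_coeff j z x) =
    (LINT x:K|lborel. LINT \<xi>|lborel. shell_family j z (x, \<xi>)) / of_real (ln 2)"
    unfolding set_lebesgue_integral_def eq by (rule integral_divide_zero)
qed

lemma total_sphere_coeff_holomorphic: "(\<lambda>z. LINT x:K|lborel. sphere_coeff j z x) holomorphic_on UNIV"
  unfolding sphere_coeff_integral(2)
  using dominated_family_holomorphic_total[OF dominated_shell_family[OF K] open_UNIV K(1)]
  by (intro holomorphic_intros) auto

lemma total_regular_part_holomorphic:
  "N \<ge> 1 \<Longrightarrow> (\<lambda>z. LINT x:K|lborel. LINT \<xi>|lborel. regular_family N z (x, \<xi>)) holomorphic_on
    half_plane \<alpha> (real CARD('n) + 1) N"
  by (rule dominated_family_holomorphic_total[OF dominated_regular_family[OF K] open_half_plane K(1)])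

lemma total_integral_family:
  assumes N: "N \<ge> 1" and z: "z \<in> half_plane \<alpha> (real CARD('n) + 1) N"
  shows "(LINT x:U|lborel. cutoff_integral (\<lambda>\<xi>. f z (x, \<xi>))) =
    (LINT x:K|lborel. LINT \<xi>|lborel. regular_family N z (x, \<xi>)) -
    (\<Sum>j<N. (LINT x:K|lborel. sphere_coeff j z x) / (\<alpha> z - of_nat j))"
proof -
  have "(LINT x:U|lborel. cutoff_integral (\<lambda>\<xi>. f z (x, \<xi>))) = (LINT x:K|lborel. cutoff_integral (\<lambda>\<xi>. f z (x, \<xi>)))"
    by (rule set_integral_support) (simp add: supp cutoff_integral_0)
  also have "\<dots> = (LINT x:K|lborel. (LINT \<xi>|lborel. regular_family N z (x, \<xi>)) -
      (\<Sum>j<N. sphere_coeff j z x / (\<alpha> z - of_nat j)))"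
    by (rule set_lebesgue_integral_cong)
       (use K cutoff_integral_family[OF N z] in \<open>auto intro: borel_compact\<close>)
  also have "\<dots> = (LINT x:K|lborel. LINT \<xi>|lborel. regular_family N z (x, \<xi>)) -
      (LINT x:K|lborel. \<Sum>j<N. sphere_coeff j z x / (\<alpha> z - of_nat j))"
  proof (rule set_integral_diff(2))
    show "set_integrable lborel K (\<lambda>x. LINT \<xi>|lborel. regular_family N z (x, \<xi>))"
      by (rule dominated_family_integrable_total[OF dominated_regular_family[OF K N] open_half_plane K(1) z])
    show "set_integrable lborel K (\<lambda>x. \<Sum>j<N. sphere_coeff j z x / (\<alpha> z - of_nat j))"
      unfolding set_integrable_def scaleR_sum_right
      by (rule Bochner_Integration.integrable_sum)
         (use set_integrable_divide[OF sphere_coeff_integral(1)] in \<open>simp add: set_integrable_def\<close>)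
  qed
  also have "(LINT x:K|lborel. \<Sum>j<N. sphere_coeff j z x / (\<alpha> z - of_nat j)) =
      (\<Sum>j<N. LINT x:K|lborel. sphere_coeff j z x / (\<alpha> z - of_nat j))"
    unfolding set_lebesgue_integral_def scaleR_sum_right
    by (rule Bochner_Integration.integral_sum)
       (use set_integrable_divide[OF sphere_coeff_integral(1)] in \<open>simp add: set_integrable_def\<close>)
  \<comment> \<open>Pulling the denominator out of the integral is valid also for \<alpha>(z) = j,
    where both sides are 0.\<close>
  finally show ?thesis by simp
qed

lemma total_meromorphic:
  "meromorphic_simple_poles \<alpha> (of_int ` {- int n..}) (\<lambda>z. LINT x:U|lborel. cutoff_integral (\<lambda>\<xi>. f z (x, \<xi>)))"
  by (rule meromorphic_simple_poles_sum[where c = "real CARD('n) + 1"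
        and A = "\<lambda>N z. LINT x:K|lborel. LINT \<xi>|lborel. regular_family N z (x, \<xi>)"
        and S = "\<lambda>j z. LINT x:K|lborel. sphere_coeff j z x"])
     (use \<alpha> \<alpha>' total_integral_family in
       \<open>auto intro: total_regular_part_holomorphic total_sphere_coeff_holomorphic\<close>)

lemma total_residue:
  "residue (\<lambda>z. LINT x:U|lborel. cutoff_integral (\<lambda>\<xi>. f z (x, \<xi>))) 0 =
    - (1 / deriv \<alpha> 0) * (LINT x:U|lborel. symb_res \<psi> U (f 0) x)"
proof (cases "\<exists>k. \<alpha> 0 = of_nat k")
  case True
  then obtain k where k: "\<alpha> 0 = of_nat k" by blast
  \<comment> \<open>Outside the common support the cut-off integral vanishes for every z; the
    residue formula in the fibre, with factor 1 / \<alpha>'(0) \<noteq> 0, then forces the residue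
    density to be 0.\<close>
  have "symb_res \<psi> U (f 0) x = 0" if "x \<in> U - K" for x
    using fibre_residue[of x] that \<alpha>' by (auto simp: supp cutoff_integral_0 residue_const)
  then have "(LINT x:U|lborel. symb_res \<psi> U (f 0) x) = (LINT x:K|lborel. symb_res \<psi> U (f 0) x)"
    by (rule set_integral_support)
  also have "\<dots> = (LINT x:K|lborel. sphere_coeff k 0 x)"
    by (rule set_lebesgue_integral_cong) (use K symb_res_eq[OF _ k] in \<open>auto intro: borel_compact\<close>)
  finally have "(LINT x:U|lborel. symb_res \<psi> U (f 0) x) = (LINT x:K|lborel. sphere_coeff k 0 x)" .
  moreover have "residue (\<lambda>z. LINT x:U|lborel. cutoff_integral (\<lambda>\<xi>. f z (x, \<xi>))) 0 =
     - (1 / deriv \<alpha> 0) * (LINT x:K|lborel. sphere_coeff k 0 x)"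
    by (rule residue_sum[where c = "real CARD('n) + 1"
          and A = "\<lambda>N z. LINT x:K|lborel. LINT \<xi>|lborel. regular_family N z (x, \<xi>)"
          and S = "\<lambda>j z. LINT x:K|lborel. sphere_coeff j z x"])
       (use \<alpha> \<alpha>' total_integral_family k in
         \<open>auto intro: total_regular_part_holomorphic total_sphere_coeff_holomorphic\<close>)
  ultimately show ?thesis by simp
next
  case False
  then have k: "\<forall>k. \<alpha> 0 \<noteq> of_nat k" by blast
  have "residue (\<lambda>z. LINT x:U|lborel. cutoff_integral (\<lambda>\<xi>. f z (x, \<xi>))) 0 = 0"
    by (rule residue_sum_0[where c = "real CARD('n) + 1" and \<alpha> = \<alpha>
          and A = "\<lambda>N z. LINT x:K|lborel. LINT \<xi>|lborel. regular_family N z (x, \<xi>)"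
          and S = "\<lambda>j z. LINT x:K|lborel. sphere_coeff j z x"])
       (use \<alpha> \<alpha>' total_integral_family k in
         \<open>auto intro: total_regular_part_holomorphic total_sphere_coeff_holomorphic\<close>)
  moreover have "(LINT x:U|lborel. symb_res \<psi> U (f 0) x) = 0"
  proof -
    have "(LINT x:U|lborel. symb_res \<psi> U (f 0) x) = (LINT x:U|lborel. 0)"
      unfolding set_lebesgue_integral_def
      by (rule Bochner_Integration.integral_cong) (auto simp: indicator_def symb_res_eq_0[OF _ k])
    then show ?thesis by (simp add: set_lebesgue_integral_def)
  qed
  ultimately show ?thesis by simp
qed

end

end

end

section \<open>From a single coefficient to forms\<close>

lemma holomorphic_family_cutoff_integral:
  fixes U :: "(real ^ 'n::finite) set"
  assumes U: "open U" and \<psi>: "cutoff_function U \<psi>" and \<alpha>': "deriv \<alpha> 0 \<noteq> 0"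
    and fam: "holomorphic_family \<psi> U (\<lambda>z. \<alpha> z - of_nat CARD('n)) f"
  shows "x \<in> U \<Longrightarrow> meromorphic_simple_poles \<alpha> (of_int ` {- int CARD('n)..}) (\<lambda>z. cutoff_integral (\<lambda>\<xi>. f z (x, \<xi>)))"
    and "x \<in> U \<Longrightarrow> residue (\<lambda>z. cutoff_integral (\<lambda>\<xi>. f z (x, \<xi>))) 0 = - (1 / deriv \<alpha> 0) * symb_res \<psi> U (f 0) x"
    and "meromorphic_simple_poles \<alpha> (of_int ` {- int CARD('n)..})
      (\<lambda>z. LINT x:U|lborel. cutoff_integral (\<lambda>\<xi>. f z (x, \<xi>)))"
    and "residue (\<lambda>z. LINT x:U|lborel. cutoff_integral (\<lambda>\<xi>. f z (x, \<xi>))) 0 =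
      - (1 / deriv \<alpha> 0) * (LINT x:U|lborel. symb_res \<psi> U (f 0) x)"
proof -
  have "(\<lambda>z. \<alpha> z - of_nat CARD('n)) holomorphic_on UNIV"
    using fam by (simp add: holomorphic_family_def)
  then have "(\<lambda>z. \<alpha> z - of_nat CARD('n) + of_nat CARD('n)) holomorphic_on UNIV"
    by (rule holomorphic_on_add[OF _ holomorphic_on_const])
  then have \<alpha>: "\<alpha> holomorphic_on UNIV" by (rule holomorphic_transform) simp
  obtain s where s: "\<And>z. classical_expansion \<psi> U (\<alpha> z - of_nat CARD('n)) (f z) (s z)"
    "\<And>j. holomorphic_smooth (U \<times> (- {0})) (\<lambda>z. s z j)"
    "\<And>N. N \<ge> 1 \<Longrightarrow> holomorphic_smooth (U \<times> UNIV) (\<lambda>z p. f z p - (\<Sum>j<N. \<psi> p * s z j p))"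
    "\<And>N. N \<ge> 1 \<Longrightarrow> locally_uniform_symbols U (\<lambda>z. Re (\<alpha> z - of_nat CARD('n)) - real N + 1)
       (\<lambda>z p. f z p - (\<Sum>j<N. \<psi> p * s z j p))"
    by (rule holomorphic_familyE[OF fam], rule that)
  note fib = U \<psi> \<alpha> s
  \<comment> \<open>The definition of a family gives a support for each z; the integral over the
    base needs one compact set for all z.\<close>
  have "\<exists>K. compact K \<and> K \<subseteq> U \<and> (\<forall>z x \<xi>. x \<notin> K \<longrightarrow> f z (x, \<xi>) = 0)"
  proof (rule uniform_support[OF U])
    show "\<exists>K. compact K \<and> K \<subseteq> U \<and> (\<forall>x \<xi>. x \<notin> K \<longrightarrow> f z (x, \<xi>) = 0)" for z
      using fam by (simp add: holomorphic_family_def CS_com_order_def)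
    show "(\<lambda>z. f z (x, \<xi>)) holomorphic_on UNIV" if "x \<in> U" for x \<xi>
      by (rule family_holomorphic[OF fib that])
  qed
  then obtain K where K: "compact K" "K \<subseteq> U" "\<forall>z x \<xi>. x \<notin> K \<longrightarrow> f z (x, \<xi>) = 0"
    by (elim exE conjE)
  show "x \<in> U \<Longrightarrow> meromorphic_simple_poles \<alpha> (of_int ` {- int CARD('n)..}) (\<lambda>z. cutoff_integral (\<lambda>\<xi>. f z (x, \<xi>)))"
    by (rule fibre_meromorphic[OF fib \<alpha>'])
  show "x \<in> U \<Longrightarrow> residue (\<lambda>z. cutoff_integral (\<lambda>\<xi>. f z (x, \<xi>))) 0 = - (1 / deriv \<alpha> 0) * symb_res \<psi> U (f 0) x"
    by (rule fibre_residue[OF fib \<alpha>'])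
  show "meromorphic_simple_poles \<alpha> (of_int ` {- int CARD('n)..})
      (\<lambda>z. LINT x:U|lborel. cutoff_integral (\<lambda>\<xi>. f z (x, \<xi>)))"
    by (rule total_meromorphic[OF fib \<alpha>' K(1,2)]) (use K(3) in auto)
  show "residue (\<lambda>z. LINT x:U|lborel. cutoff_integral (\<lambda>\<xi>. f z (x, \<xi>))) 0 =
      - (1 / deriv \<alpha> 0) * (LINT x:U|lborel. symb_res \<psi> U (f 0) x)"
    by (rule total_residue[OF fib \<alpha>' K(1,2)]) (use K(3) in auto)
qed

theorem theorem5:
  fixes U :: "(real ^ 'n::finite) set"
    and \<psi> :: "'n symb"
    and R :: "'n symb \<Rightarrow> complex \<Rightarrow> 'n symb"
    and \<omega> :: "'n symb_form"
    and \<alpha> :: "complex \<Rightarrow> complex"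
  assumes "open U"
    and "cutoff_function U \<psi>"
    and "holomorphic_regularisation \<psi> U R"
    and "holomorphic_form_regularisation \<psi> U (induced_regularisation R)"
    and "\<omega> \<in> form_CS_com \<psi> U"
    and "holomorphic_form_family \<psi> U \<alpha> (induced_regularisation R \<omega>)"
    and "deriv \<alpha> 0 \<noteq> 0"
  shows
    "(\<forall>x\<in>U. \<forall>I. meromorphic_simple_poles \<alpha> (of_int ` {- int CARD('n)..})
         (\<lambda>z. fibre_cutoff_integral (induced_regularisation R \<omega> z) x I)) \<and>
     meromorphic_simple_poles \<alpha> (of_int ` {- int CARD('n)..})
         (\<lambda>z. total_cutoff_integral U (induced_regularisation R \<omega> z)) \<and>
     (\<forall>x\<in>U. \<forall>I. residue (\<lambda>z. fibre_cutoff_integral (induced_regularisation R \<omega> z) x I) 0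
         = - (1 / deriv \<alpha> 0) * fibre_res \<psi> U (induced_regularisation R \<omega> 0) x I) \<and>
     residue (\<lambda>z. total_cutoff_integral U (induced_regularisation R \<omega> z)) 0
         = - (1 / deriv \<alpha> 0) * total_res \<psi> U (induced_regularisation R \<omega> 0)"
proof -
  \<comment> \<open>Integrals and residues see only J = UNIV, whose cardinality n accounts for the
    shift of the order.\<close>
  have "holomorphic_family \<psi> U (\<lambda>z. \<alpha> z - of_nat CARD('n)) (\<lambda>z. induced_regularisation R \<omega> z I UNIV)" for I
    using assms(6) by (simp add: holomorphic_form_family_def)
  note * = holomorphic_family_cutoff_integral[OF assms(1,2,7) this]
  show ?thesis
    unfolding fibre_cutoff_integral_def total_cutoff_integral_def fibre_res_def total_res_def
    by (intro conjI ballI allI *)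
qed

end
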